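(* Let $r\geq2$ be a fixed integer and $V$ a set of $n$ vertices. Assume $d=d(n)$ satisfies $d=\omega(\log n)$ and $d=o(n^{r-1})$. Let $H$ be an $r$-graph on $V$ with $\Delta(H)=O(1)$. Suppose that $\eta=\eta(n)=o(1)$ is such that \[\varepsilon_{n,d}=o(\eta),\qquad\delta_{n,d}=o(\eta),\qquad\eta=\omega(1/n),\] and a.a.s. $X_H(G^{(r)}(n,p_d))=(1\pm\eta)^{|H|}\mathbb{E}[X_H(G^{(r)}(n,p_d))]$. Then a.a.s. \[X_H(G_{n,d}^{(r)})=(1\pm3\eta)^{|H|}\mathbb{E}[X_H(G^{(r)}(n,p_d))].\] Similarly, if the three displayed conditions hold and a.a.s. $X_H(G^{(r)}(n,m_d))=(1\pm\eta)^{|H|}\mathbb{E}[X_H(G^{(r)}(n,m_d))]$, then a.a.s. \[X_H(G_{n,d}^{(r)})=(1\pm3\eta)^{|H|}\mathbb{E}[X_H(G^{(r)}(n,m_d))].\]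
   Context: An $r$-graph is a set of $r$-element subsets (edges) of a vertex set; $|H|$ is the number of edges and $\Delta(H)$ the maximum degree. $H=H(n)$ is a sequence of $r$-graphs indexed by the number of vertices. $G_{n,d}^{(r)}$ is uniform among $d$-regular $r$-graphs on $V$ (assuming $r\mid nd$); $G^{(r)}(n,p)$ is the binomial random $r$-graph on $V$ (each $r$-set an edge independently with probability $p$); $G^{(r)}(n,m)$ is uniform among $r$-graphs on $V$ with $m$ edges. $X_H(G)$ is the number of copies of $H$ in $G$. Set $\varepsilon_{n,d}:=\frac1n+\frac1d+\frac{d}{n^{r-1}}$ and $\delta_{n,d}:=C\left(\left(\frac{d}{n^{r-1}}+\frac{\log n}{d}\right)^{1/3}+\frac1n\right)$, where $C=C(r)>0$ is the constant from the sandwich theorem of Dudek, Frieze, Ruciński and Šileikis (for every $r\ge2$ there is $C>0$ such that whenever $\delta_{n,d}<1$ there is a coupling with $G^{(r)}(n,p_d)\subseteq G_{n,d}^{(r)}$ with probability tending to $1$, and likewise with $G^{(r)}(n,m_d)$), and $p_d:=(1-\delta_{n,d})d/\binom{n-1}{r-1}$, $m_d:=(1-\delta_{n,d})nd/r$. The notation $X=(1\pm\eta)^{k}Y$ means $(1-\eta)^kY\le X\le(1+\eta)^kY$. A.a.s. means with probability tending to $1$ as $n\to\infty$. *)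

theory Defs
  imports "HOL-Probability.Probability" "HOL-Library.Landau_Symbols"
begin

text \<open>Vertex set V = {..<n}. An r-graph on V is a set of r-element subsets of V.\<close>

definition rsets :: "nat \<Rightarrow> nat \<Rightarrow> nat set set" where
  "rsets r n = {e. e \<subseteq> {..<n} \<and> card e = r}"

definition vdeg :: "nat set set \<Rightarrow> nat \<Rightarrow> nat" where
  "vdeg G v = card {e \<in> G. v \<in> e}"

definition maxdeg :: "nat \<Rightarrow> nat set set \<Rightarrow> nat" where
  "maxdeg n H = Max (insert 0 ((\<lambda>v. vdeg H v) ` {..<n}))"

definition copies :: "nat \<Rightarrow> nat set set \<Rightarrow> nat set set \<Rightarrow> nat" where
  "copies n H G = card {F. F \<subseteq> G \<and> (\<exists>\<sigma>. \<sigma> permutes {..<n} \<and> F = (\<lambda>e. \<sigma> ` e) ` H)}"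

definition Gnd :: "nat \<Rightarrow> nat \<Rightarrow> nat \<Rightarrow> nat set set pmf" where
  "Gnd r n d = pmf_of_set {G. G \<subseteq> rsets r n \<and> (\<forall>v<n. vdeg G v = d)}"

definition Gnp :: "nat \<Rightarrow> nat \<Rightarrow> real \<Rightarrow> nat set set pmf" where
  "Gnp r n p = map_pmf (\<lambda>f. {e \<in> rsets r n. f e}) (Pi_pmf (rsets r n) False (\<lambda>_. bernoulli_pmf p))"

definition Gnm :: "nat \<Rightarrow> nat \<Rightarrow> nat \<Rightarrow> nat set set pmf" where
  "Gnm r n m = pmf_of_set {G. G \<subseteq> rsets r n \<and> card G = m}"

definition eps_nd :: "nat \<Rightarrow> nat \<Rightarrow> nat \<Rightarrow> real" where
  "eps_nd r n d = 1 / real n + 1 / real d + real d / real n ^ (r - 1)"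

definition delta_nd :: "nat \<Rightarrow> real \<Rightarrow> nat \<Rightarrow> nat \<Rightarrow> real" where
  "delta_nd r C n d = C * ((real d / real n ^ (r - 1) + ln (real n) / real d) powr (1/3) + 1 / real n)"

definition p_d :: "nat \<Rightarrow> real \<Rightarrow> nat \<Rightarrow> nat \<Rightarrow> real" where
  "p_d r C n d = (1 - delta_nd r C n d) * real d / real ((n - 1) choose (r - 1))"

definition m_d :: "nat \<Rightarrow> real \<Rightarrow> nat \<Rightarrow> nat \<Rightarrow> nat" where
  "m_d r C n d = nat \<lfloor>(1 - delta_nd r C n d) * real n * real d / real r\<rfloor>"

text \<open>The filter of n \<rightarrow> \<infinity> along those n for which r divides n d(n)
  (the n for which G_{n,d} is defined).\<close>
definition adm :: "nat \<Rightarrow> (nat \<Rightarrow> nat) \<Rightarrow> nat filter" where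
  "adm r d = sequentially \<sqinter> principal {n. r dvd n * d n}"

definition aas :: "nat filter \<Rightarrow> (nat \<Rightarrow> nat set set pmf) \<Rightarrow> (nat \<Rightarrow> nat set set \<Rightarrow> bool) \<Rightarrow> bool" where
  "aas F M P \<longleftrightarrow> ((\<lambda>n. measure_pmf.prob (M n) {G. P n G}) \<longlongrightarrow> 1) F"

definition pm_approx :: "real \<Rightarrow> nat \<Rightarrow> real \<Rightarrow> real \<Rightarrow> bool" where
  "pm_approx \<eta> k X Y \<longleftrightarrow> (1 - \<eta>) ^ k * Y \<le> X \<and> X \<le> (1 + \<eta>) ^ k * Y"

text \<open>C has the property of the sandwich theorem of Dudek, Frieze, Rucinski and Sileikis.\<close>
definition sandwich_const :: "nat \<Rightarrow> real \<Rightarrow> bool" where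
  "sandwich_const r C \<longleftrightarrow> C > 0 \<and>
    (\<forall>d :: nat \<Rightarrow> nat. infinite {n. r dvd n * d n} \<longrightarrow>
       (\<forall>\<^sub>F n in adm r d. delta_nd r C n (d n) < 1) \<longrightarrow>
       (\<exists>cp :: nat \<Rightarrow> (nat set set \<times> nat set set) pmf.
          (\<forall>\<^sub>F n in adm r d. map_pmf fst (cp n) = Gnp r n (p_d r C n (d n))
                              \<and> map_pmf snd (cp n) = Gnd r n (d n))
        \<and> ((\<lambda>n. measure_pmf.prob (cp n) {x. fst x \<subseteq> snd x}) \<longlongrightarrow> 1) (adm r d))
     \<and> (\<exists>cm :: nat \<Rightarrow> (nat set set \<times> nat set set) pmf.
          (\<forall>\<^sub>F n in adm r d. map_pmf fst (cm n) = Gnm r n (m_d r C n (d n))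
                              \<and> map_pmf snd (cm n) = Gnd r n (d n))
        \<and> ((\<lambda>n. measure_pmf.prob (cm n) {x. fst x \<subseteq> snd x}) \<longlongrightarrow> 1) (adm r d)))"

end

theory Submission
  imports Defs
begin

text \<open>
  The lower bound is immediate from the sandwich coupling. For the upper bound, a switching which replaces
  the rows of an \<open>r \<times> r\<close> matrix of vertices by its columns shows that an edge \<open>e\<close> lies in a uniform
  \<open>d\<close>-regular graph containing a given graph \<open>F\<close> with probability at most
  \<open>1 + O(1/n + d/n\<^sup>r\<^sup>-\<^sup>1)\<close> times the residual density, provided that no residual degree
  is much larger than average. Two consequences cover the two ranges of \<open>|H| \<eta>\<close>.

  When \<open>|H| \<eta>\<close> is large, revealing the edges of a copy one by one bounds the expected number of copies
  in the regular graph by \<open>(1 + \<eta>)\<^bsup>|H|\<^esup> Y\<close>, and Markov's inequality gives failure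
  probability at most \<open>exp (- |H| \<eta>)\<close>.

  When \<open>|H| \<eta>\<close> is bounded, Markov is not enough. Order the edges of the regular graph at random and stop
  when only a proportion \<open>O(\<delta>)\<close> is left: by the hypergeometric tail the residual degrees stay
  balanced, because \<open>\<delta>\<^sup>3 d\<close> is at least of order \<open>log n\<close>, so every step is dominated by the choice of
  slightly more than one uniform edge. Hence this subgraph of the regular graph is stochastically dominated by a
  uniform graph with \<open>(1 - 2 \<delta>) n d / r\<close> edges, to which the hypothesis applies; and passing to
  the subgraph loses only a proportion \<open>O(|H| \<delta>) = o(|H| \<eta>)\<close> of the copies.
\<close>

section \<open>Regular graphs\<close>

text \<open>The sandwich coupling puts the sparse model inside the regular graph but puts nothing
  around it, so the upper tail needs a substitute for an upper coupling. An edge-by-edge comparison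
  breaks down near the end, where residual degrees are small and their relative fluctuations large.
  The cube root in \<delta> marks how late one may stop: with a share of order \<delta> left,
  residual degrees are about \<delta> d, a relative deviation \<delta> has Chernoff exponent of
  order \<delta>^2 (\<delta> d), and this must beat log n. The constant 3 supplies a gap. With k =
  |H|, both the hypothesis and the first moment work at level (1 + \<eta>)^k Y, failure is measured
  at (1 + 3 \<eta>)^k Y, and the quotient of the levels is at most exp(-k \<eta>). If k \<eta> is
  large, the quotient itself bounds the failure; otherwise it stays below 1 by k \<eta> / (1 + k
  \<eta>), which leaves room to discard an o(\<eta>) share of the edges. The choice between the two
  is made separately for each n. Domination is expressed through increasing test functions, so no
  coupling with the dominating graph is constructed.\<close>

definition Reg :: "nat \<Rightarrow> nat \<Rightarrow> nat \<Rightarrow> nat set set set" where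
  "Reg r n d = {G. G \<subseteq> rsets r n \<and> (\<forall>v<n. vdeg G v = d)}"

lemma finite_rsets [simp]: "finite (rsets r n)"
  unfolding rsets_def by (rule finite_subset[of _ "Pow {..<n}"]) auto

lemma card_rsets: "card (rsets r n) = n choose r"
  unfolding rsets_def using n_subsets[of "{..<n}" r] by simp

lemma finite_Reg [simp]: "finite (Reg r n d)"
  unfolding Reg_def by (rule finite_subset[of _ "Pow (rsets r n)"]) auto

lemma finite_edge: "e \<in> rsets r n \<Longrightarrow> finite e"
  unfolding rsets_def by (auto intro: finite_subset[OF _ finite_lessThan])

lemma sum_vdeg:
  assumes "G \<subseteq> rsets r n"
  shows "(\<Sum>v<n. vdeg G v) = r * card G"
proof -
  have fin: "finite G" using assms finite_rsets by (rule finite_subset)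
  have "(\<Sum>v<n. vdeg G v) = (\<Sum>v<n. \<Sum>e\<in>G. if v \<in> e then 1 else 0)"
    unfolding vdeg_def using fin by (simp add: sum.If_cases Int_def)
  also have "\<dots> = (\<Sum>e\<in>G. \<Sum>v<n. if v \<in> e then 1 else 0)" by (rule sum.swap)
  also have "\<dots> = (\<Sum>e\<in>G. r)"
  proof (rule sum.cong)
    fix e assume "e \<in> G"
    then have "e \<subseteq> {..<n}" "card e = r" using assms by (auto simp: rsets_def)
    then show "(\<Sum>v<n. if v \<in> e then 1 else 0) = r"
      by (simp add: sum.If_cases Int_absorb1)
  qed simp
  finally show ?thesis by simp
qed

lemma card_Reg:
  assumes "G \<in> Reg r n d"
  shows "r * card G = n * d"
  using assms sum_vdeg[of G r n] by (simp add: Reg_def)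

lemma vdeg_mono: "finite G \<Longrightarrow> F \<subseteq> G \<Longrightarrow> vdeg F v \<le> vdeg G v"
  unfolding vdeg_def by (rule card_mono) auto

lemma vdeg_diff:
  assumes "finite G" "F \<subseteq> G"
  shows "vdeg (G - F) v = vdeg G v - vdeg F v"
proof -
  have "{e \<in> G - F. v \<in> e} = {e \<in> G. v \<in> e} - {e \<in> F. v \<in> e}" by auto
  moreover have "finite {e \<in> F. v \<in> e}" "{e \<in> F. v \<in> e} \<subseteq> {e \<in> G. v \<in> e}"
    using assms finite_subset[OF assms(2)] by auto
  ultimately show ?thesis unfolding vdeg_def by (simp add: card_Diff_subset)
qed

lemma vdeg_Un_disjoint:
  assumes "finite A" "finite B" "A \<inter> B = {}"
  shows "vdeg (A \<union> B) v = vdeg A v + vdeg B v"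
proof -
  have "{e \<in> A \<union> B. v \<in> e} = {e \<in> A. v \<in> e} \<union> {e \<in> B. v \<in> e}" by auto
  then show ?thesis unfolding vdeg_def using assms by (simp add: card_Un_disjoint disjoint_iff)
qed

text \<open>Balancing: among all graphs with the right number of edges take one minimising the sum of
  the squared degrees; an edge could otherwise be moved from a vertex of large degree to one of small degree.\<close>

lemma exists_balancing_edge:
  assumes G: "G \<subseteq> rsets r n" and v: "v < n" and w: "w < n" and lt: "vdeg G w < vdeg G v"
  obtains e where "e \<in> G" "v \<in> e" "w \<notin> e" "insert w (e - {v}) \<notin> G"
    "insert w (e - {v}) \<in> rsets r n"
proof -
  have fin: "finite G" using G(1) finite_rsets by (rule finite_subset)
  define A where "A = {e\<in>G. v \<in> e \<and> w \<notin> e}"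
  define B where "B = {e\<in>G. w \<in> e \<and> v \<notin> e}"
  define S where "S = {e\<in>G. v \<in> e \<and> w \<in> e}"
  have "vdeg G v = card A + card S" unfolding vdeg_def A_def S_def
    by (subst card_Un_disjoint[symmetric]) (use fin in \<open>auto intro!: arg_cong[where f=card]\<close>)
  moreover have "vdeg G w = card B + card S" unfolding vdeg_def B_def S_def
    by (subst card_Un_disjoint[symmetric]) (use fin in \<open>auto intro!: arg_cong[where f=card]\<close>)
  ultimately have AB: "card B < card A" using lt by simp
  \<comment> \<open>Replacing \<open>v\<close> by \<open>w\<close> is injective on \<open>A\<close>,
    and every image contains \<open>w\<close> but not \<open>v\<close>. As \<open>B\<close> is
    smaller than \<open>A\<close>, some image lies outside \<open>B\<close>, hence outside
    \<open>G\<close>.\<close>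
  define f where "f e = insert w (e - {v})" for e
  have "inj_on f A" unfolding inj_on_def f_def A_def by auto
  then have "card (f ` A) = card A" by (rule card_image)
  then have "\<not> f ` A \<subseteq> B" using AB card_mono[of B "f ` A"] fin by (auto simp: B_def)
  then obtain e where e: "e \<in> A" "f e \<notin> B" by auto
  have vw: "v \<noteq> w" using lt by auto
  have "f e \<notin> G" using e vw by (auto simp: A_def B_def f_def)
  moreover have "f e \<in> rsets r n"
  proof -
    have "e \<subseteq> {..<n}" "card e = r" "finite e" "v \<in> e" "w \<notin> e" using e G finite_edge[of e r n]
      by (auto simp: A_def rsets_def)
    moreover from this have "card (f e) = r" unfolding f_def
      using card_Suc_Diff1[of e v] by simp
    ultimately show ?thesis using w unfolding f_def rsets_def by auto
  qed
  ultimately show ?thesis using that[of e] e unfolding f_def A_def by auto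
qed

text \<open>\<open>Gnd\<close> is a \<open>pmf_of_set\<close>, so its probabilities are counting
  ratios only once regular graphs exist. The bound on \<open>d\<close> is the degree of the complete
  r-graph.\<close>

lemma Reg_nonempty:
  assumes dvd: "r dvd n * d" and r: "r \<ge> 1" and d: "d \<le> (n - 1) choose (r - 1)" and n: "n \<ge> 1"
  shows "Reg r n d \<noteq> {}"
proof -
  define M where "M = n * d div r"
  have rM: "r * M = n * d" unfolding M_def using dvd by simp
  have "r * M \<le> r * (n choose r)"
  proof -
    have "r * (n choose r) = n * ((n - 1) choose (r - 1))"
      using times_binomial_minus1_eq[of r n] r by simp
    then show ?thesis using d rM by simp
  qed
  then have "M \<le> card (rsets r n)" using r by (simp add: card_rsets)
  then obtain G0 where G0: "G0 \<subseteq> rsets r n" "card G0 = M"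
    using obtain_subset_with_card_n by metis
  define Q where "Q G = (\<Sum>v<n. (vdeg G v)^2)" for G
  define P where "P G \<longleftrightarrow> G \<subseteq> rsets r n \<and> card G = M" for G
  define G where "G = arg_min Q P"
  have PG: "P G" and min: "\<And>G'. P G' \<Longrightarrow> Q G \<le> Q G'"
    using arg_min_nat_lemma[of P G0 Q] G0 unfolding P_def G_def by auto
  then have G: "G \<subseteq> rsets r n" "card G = M" by (auto simp: P_def)
  have fin: "finite G" using G(1) finite_rsets by (rule finite_subset)
  have near: "vdeg G v \<le> vdeg G w + 1" if v: "v < n" and w: "w < n" for v w
  proof (rule ccontr)
    assume "\<not> ?thesis"
    then have gt: "vdeg G v > vdeg G w + 1" by simp
    obtain e where e: "e \<in> G" "v \<in> e" "w \<notin> e" "insert w (e - {v}) \<notin> G"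
      "insert w (e - {v}) \<in> rsets r n"
      using exists_balancing_edge[OF G(1) v w] gt by auto
    define e' where "e' = insert w (e - {v})"
    define G' where "G' = (G - {e}) \<union> {e'}"
    have vw: "v \<noteq> w" using e by auto
    have "card G' = M" unfolding G'_def using e fin G(2) card_Suc_Diff1[of G e]
      by (simp add: e'_def)
    then have "P G'" unfolding P_def G'_def using G e by (auto simp: e'_def)
    have dg: "vdeg G' u + vdeg {e} u = vdeg G u + vdeg {e'} u" for u
    proof -
      have "vdeg G' u = vdeg (G - {e}) u + vdeg {e'} u"
        unfolding G'_def by (rule vdeg_Un_disjoint) (use fin e in \<open>auto simp: e'_def\<close>)
      moreover have "vdeg ((G - {e}) \<union> {e}) u = vdeg (G - {e}) u + vdeg {e} u"
        by (rule vdeg_Un_disjoint) (use fin in auto)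
      moreover have "(G - {e}) \<union> {e} = G" using e by auto
      ultimately show ?thesis by simp
    qed
    have single: "vdeg {g} u = (if u \<in> g then 1 else 0)" for g :: "nat set" and u
      unfolding vdeg_def by (auto simp: card_1_singleton_iff)
    have dv: "vdeg G' v + 1 = vdeg G v" using dg[of v] e vw by (simp add: single e'_def)
    have dw: "vdeg G' w = vdeg G w + 1" using dg[of w] e vw by (simp add: single e'_def)
    have du: "vdeg G' u = vdeg G u" if "u \<noteq> v" "u \<noteq> w" for u
      using dg[of u] e that by (auto simp: single e'_def split: if_splits)
    have split: "Q K = (vdeg K v)^2 + (vdeg K w)^2 + (\<Sum>u\<in>{..<n}-{v,w}. (vdeg K u)^2)" for K
    proof -
      have "{..<n} = insert v (insert w ({..<n}-{v,w}))" using v w by auto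
      then have "Q K = (\<Sum>u\<in>insert v (insert w ({..<n}-{v,w})). (vdeg K u)^2)"
        unfolding Q_def by simp
      also have "\<dots> = (vdeg K v)^2 + (vdeg K w)^2 + (\<Sum>u\<in>{..<n}-{v,w}. (vdeg K u)^2)"
        by (subst sum.insert | simp add: vw)+
      finally show ?thesis .
    qed
    have "(\<Sum>u\<in>{..<n}-{v,w}. (vdeg G' u)^2) = (\<Sum>u\<in>{..<n}-{v,w}. (vdeg G u)^2)"
      by (rule sum.cong) (auto simp: du)
    \<comment> \<open>If the two degrees differ by \<open>2 + a\<close>, moving one unit lowers the
      sum of their squares by \<open>2 * (a + 1)\<close>.\<close>
    moreover have "(vdeg G' v)^2 + (vdeg G' w)^2 < (vdeg G v)^2 + (vdeg G w)^2"
    proof -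
      obtain a where a: "vdeg G v = vdeg G w + 2 + a" using gt less_iff_Suc_add by auto
      then have "vdeg G' v = vdeg G w + 1 + a" using dv by simp
      then show ?thesis unfolding dw a by (simp add: power2_eq_square algebra_simps)
    qed
    ultimately have "Q G' < Q G" using split[of G] split[of G'] by simp
    then show False using min[OF \<open>P G'\<close>] by simp
  qed
  have tot: "(\<Sum>v<n. vdeg G v) = (\<Sum>v<n. d)" using sum_vdeg[OF G(1)] G(2) rM by simp
  have "vdeg G v = d" if v: "v < n" for v
  proof (rule ccontr)
    assume ne: "vdeg G v \<noteq> d"
    \<comment> \<open>Degrees differ pairwise by at most one, so a degree above \<open>d\<close>
      keeps all others at least \<open>d\<close> and the total exceeds \<open>n * d\<close>;
      symmetrically below \<open>d\<close>.\<close>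
    show False
    proof (cases "vdeg G v > d")
      case True
      then have "\<forall>w<n. d \<le> vdeg G w" using near[OF v] by fastforce
      then have "(\<Sum>v<n. d) < (\<Sum>v<n. vdeg G v)" using True v by (intro sum_strict_mono_ex1) auto
      then show False using tot by simp
    next
      case False
      then have "\<forall>w<n. vdeg G w \<le> d" using near[OF _ v] ne by fastforce
      moreover have "vdeg G v < d" using False ne by simp
      ultimately have "(\<Sum>v<n. vdeg G v) < (\<Sum>v<n. d)" using v by (intro sum_strict_mono_ex1) auto
      then show False using tot by simp
    qed
  qed
  then show ?thesis using G unfolding Reg_def by auto
qed

section \<open>The switching\<close>

text \<open>The edge \<open>e\<close> occupies row 0 of the matrix, so a column is its top entry
  \<open>v\<close> together with a function on the remaining row indices. Extensionality makes such
  a function the same thing as its entries, so columns can be counted.\<close>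

definition columns :: "nat \<Rightarrow> nat set set \<Rightarrow> nat \<Rightarrow> (nat \<Rightarrow> nat) set" where
  "columns r K v = {c \<in> extensional {1..<r}. inj_on c {1..<r} \<and> v \<notin> c ` {1..<r} \<and>
     insert v (c ` {1..<r}) \<in> K}"

text \<open>A row must be an ordered edge: the order decides which vertex goes into which
  column.\<close>

definition orderings :: "nat set set \<Rightarrow> nat list set" where
  "orderings K = {xs. distinct xs \<and> set xs \<in> K}"

lemma card_bijections:
  assumes "finite B" "card B = m" "finite I" "card I = m"
  shows "card {f \<in> I \<rightarrow>\<^sub>E B. inj_on f I} = fact m"
  using card_inj_on_subset_funcset[of I B I] assms
  by (simp add: fact_prod_rev[of m, where ?'a=nat])

lemma card_columns:
  assumes K: "K \<subseteq> rsets r n"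
  shows "finite (columns r K v)" "card (columns r K v) \<le> vdeg K v * fact (r - 1)"
proof -
  have finK: "finite K" using K finite_rsets by (rule finite_subset)
  define I where "I = {1..<r}"
  define U where "U g = {c \<in> I \<rightarrow>\<^sub>E (g - {v}). inj_on c I}" for g
  have fU: "finite (U g)" if "g \<in> K" for g
  proof -
    have "finite (I \<rightarrow>\<^sub>E (g - {v}))"
      using that K finite_edge[of g r n] by (auto intro!: finite_PiE simp: I_def)
    then show ?thesis unfolding U_def by simp
  qed
  have cU: "card (U g) = fact (r - 1)" if "g \<in> K" "v \<in> g" for g
  proof -
    have "finite g" "card g = r" using that K finite_edge[of g r n] by (auto simp: rsets_def)
    then show ?thesis unfolding U_def using that
      by (intro card_bijections) (auto simp: I_def)
  qed
  have sub: "columns r K v \<subseteq> (\<Union>g\<in>{g\<in>K. v \<in> g}. U g)"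
  proof
    fix c assume c: "c \<in> columns r K v"
    then have "insert v (c ` I) \<in> K" by (simp add: columns_def I_def)
    moreover have "c \<in> U (insert v (c ` I))"
      using c unfolding U_def columns_def I_def by (auto simp: PiE_iff)
    ultimately show "c \<in> (\<Union>g\<in>{g\<in>K. v \<in> g}. U g)" by blast
  qed
  show "finite (columns r K v)" by (rule finite_subset[OF sub]) (use finK fU in auto)
  have "card (columns r K v) \<le> card (\<Union>g\<in>{g\<in>K. v \<in> g}. U g)"
    by (rule card_mono[OF _ sub]) (use finK fU in auto)
  also have "\<dots> \<le> (\<Sum>g\<in>{g\<in>K. v \<in> g}. card (U g))" by (rule card_UN_le) (use finK in auto)
  also have "\<dots> = vdeg K v * fact (r - 1)" by (simp add: cU vdeg_def)
  finally show "card (columns r K v) \<le> vdeg K v * fact (r - 1)" .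
qed

lemma card_orderings:
  assumes K: "K \<subseteq> rsets r n"
  shows "finite (orderings K)" "card (orderings K) = card K * fact r"
proof -
  have finK: "finite K" using K finite_rsets by (rule finite_subset)
  have eq: "orderings K = (\<Union>g\<in>K. permutations_of_set g)"
    by (auto simp: orderings_def permutations_of_set_def)
  show "finite (orderings K)" unfolding eq by (intro finite_UN_I finK finite_permutations_of_set)
  have "card (orderings K) = (\<Sum>g\<in>K. card (permutations_of_set g))"
    unfolding eq by (rule card_UN_disjoint[OF finK])
      (simp add: finite_permutations_of_set, auto simp: permutations_of_set_def)
  also have "\<dots> = (\<Sum>g\<in>K. fact r)"
  proof (rule sum.cong)
    fix g assume "g \<in> K"
    then have "finite g" "card g = r" using K finite_edge[of g r n] by (auto simp: rsets_def)
    then show "card (permutations_of_set g) = fact r" by simp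
  qed simp
  finally show "card (orderings K) = card K * fact r" by simp
qed

lemma card_orderings_through:
  assumes K: "K \<subseteq> rsets r n"
  shows "card {xs \<in> orderings K. u \<in> set xs} = vdeg K u * fact r"
proof -
  have "{xs \<in> orderings K. u \<in> set xs} = orderings {g\<in>K. u \<in> g}" by (auto simp: orderings_def)
  then show ?thesis using card_orderings(2)[of "{g\<in>K. u \<in> g}" r n] K by (auto simp: vdeg_def)
qed

lemma card_orderings_meeting:
  assumes K: "K \<subseteq> rsets r n" and D: "\<And>u. vdeg K u \<le> D" and U: "finite U"
  shows "card {xs \<in> orderings K. set xs \<inter> U \<noteq> {}} \<le> card U * (D * fact r)"
proof -
  have fin: "finite (orderings K)" by (rule card_orderings[OF K])
  have "{xs \<in> orderings K. set xs \<inter> U \<noteq> {}} = (\<Union>u\<in>U. {xs \<in> orderings K. u \<in> set xs})" by auto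
  then have "card {xs \<in> orderings K. set xs \<inter> U \<noteq> {}} \<le> (\<Sum>u\<in>U. card {xs \<in> orderings K. u \<in> set xs})"
    using card_UN_le[OF U] by simp
  also have "\<dots> \<le> (\<Sum>u\<in>U. D * fact r)"
    by (rule sum_mono) (simp add: card_orderings_through[OF K] D)
  finally show ?thesis by simp
qed

text \<open>Choose the coordinates other than \<open>a\<close> freely; at most \<open>b\<close>
  values then remain for \<open>a\<close>. Restricting \<open>W\<close> in the statement expresses
  that the condition on \<open>W a\<close> is determined by the other coordinates.\<close>

lemma card_PiE_coordinate_le:
  assumes I: "finite I" "a \<in> I" and A: "finite A"
    and b: "\<And>W. W \<in> (I - {a}) \<rightarrow>\<^sub>E A \<Longrightarrow> card {x \<in> A. R W x} \<le> b"
  shows "card {W \<in> I \<rightarrow>\<^sub>E A. R (restrict W (I - {a})) (W a)} \<le> card A ^ (card I - 1) * b"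
    (is "card ?S \<le> _")
proof -
  let ?P = "(I - {a}) \<rightarrow>\<^sub>E A"
  define T where "T = Sigma ?P (\<lambda>W. {x \<in> A. R W x})"
  have finP: "finite ?P" by (intro finite_PiE finite_Diff I A)
  have finT: "finite T" unfolding T_def by (intro finite_SigmaI finP) (simp add: A)
  define f where "f W = (restrict W (I - {a}), W a)" for W :: "'a \<Rightarrow> 'b"
  have inj: "inj_on f ?S"
  proof (rule inj_onI)
    fix W W' assume S: "W \<in> ?S" "W' \<in> ?S" and eq: "f W = f W'"
    have 1: "W \<in> I \<rightarrow>\<^sub>E A" "W' \<in> I \<rightarrow>\<^sub>E A" using S by blast+
    have r: "restrict W (I - {a}) = restrict W' (I - {a})" and ra: "W a = W' a"
      using eq unfolding f_def by blast+
    show "W = W'"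
    proof (rule PiE_ext[OF 1])
      fix i assume i: "i \<in> I"
      have "restrict W (I - {a}) i = restrict W' (I - {a}) i" by (simp only: r)
      then show "W i = W' i" using i ra by (cases "i = a") auto
    qed
  qed
  have "f ` ?S \<subseteq> T"
  proof (intro image_subsetI)
    fix W assume W: "W \<in> ?S"
    then have 1: "W \<in> I \<rightarrow>\<^sub>E A" and R: "R (restrict W (I - {a})) (W a)" by blast+
    have "restrict W (I - {a}) \<in> ?P" "W a \<in> A" using 1 I(2) by (auto simp: PiE_iff)
    then show "f W \<in> T" unfolding f_def T_def using R by blast
  qed
  then have "card (f ` ?S) \<le> card T" by (rule card_mono[OF finT])
  then have "card ?S \<le> card T" unfolding card_image[OF inj] .
  also have "\<dots> = (\<Sum>W\<in>?P. card {x \<in> A. R W x})" unfolding T_def using finP A by simp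
  also have "\<dots> \<le> (\<Sum>W\<in>?P. b)" using b by (rule sum_mono)
  also have "\<dots> = card A ^ (card I - 1) * b" using I by (simp add: card_funcsetE card_Diff_singleton)
  finally show ?thesis .
qed

lemma vdeg_disjoint_family:
  assumes "finite A" "\<And>x y. x \<in> A \<Longrightarrow> y \<in> A \<Longrightarrow> x \<noteq> y \<Longrightarrow> x \<inter> y = {}"
  shows "vdeg A u = (if u \<in> \<Union>A then 1 else 0)"
proof (cases "u \<in> \<Union>A")
  case True
  then obtain x where x: "x \<in> A" "u \<in> x" by auto
  have "y = x" if "y \<in> A" "u \<in> y" for y using assms(2)[OF that(1) x(1)] x(2) that(2) by auto
  then have only: "{e \<in> A. u \<in> e} = {x}" using x by blast
  have "vdeg A u = 1" unfolding vdeg_def only by simp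
  then show ?thesis using True by simp
next
  case False
  then have empty: "{e \<in> A. u \<in> e} = {}" by auto
  have "vdeg A u = 0" unfolding vdeg_def empty by simp
  then show ?thesis using False by simp
qed

text \<open>The switching: the edge \<open>e\<close>, listed as \<open>vs\<close>, and \<open>r - 1\<close> further ordered edges \<open>W 1, \<dots>, W (r-1)\<close>
  form the rows of an \<open>r \<times> r\<close> matrix with distinct entries; the rows are replaced by the columns.\<close>

locale switching =
  fixes r n d :: nat and F :: "nat set set" and e :: "nat set" and vs :: "nat list"
  assumes r: "r \<ge> 2" and e: "e \<in> rsets r n" "e \<notin> F"
    and vs: "distinct vs" "set vs = e" "length vs = r"
begin

abbreviation I where "I \<equiv> {1..<r}"

definition col :: "(nat \<Rightarrow> nat list) \<Rightarrow> nat \<Rightarrow> nat \<Rightarrow> nat" where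
  "col W j = (\<lambda>i\<in>I. W i ! j)"

definition colset :: "(nat \<Rightarrow> nat list) \<Rightarrow> nat \<Rightarrow> nat set" where
  "colset W j = insert (vs ! j) (col W j ` I)"

definition rows :: "(nat \<Rightarrow> nat list) \<Rightarrow> nat set set" where
  "rows W = insert e ((\<lambda>i. set (W i)) ` I)"

definition cols :: "(nat \<Rightarrow> nat list) \<Rightarrow> nat set set" where
  "cols W = colset W ` {..<r}"

text \<open>Since each row is already a distinct list, disjointness of the rows from each other and
  from \<open>e\<close> makes all entries of the matrix distinct.\<close>

definition separated :: "(nat \<Rightarrow> nat list) \<Rightarrow> bool" where
  "separated W \<longleftrightarrow> (\<forall>a\<in>I. set (W a) \<inter> (e \<union> (\<Union>i\<in>I-{a}. set (W i))) = {})"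

text \<open>A column already present in \<open>G\<close> would become a double edge, which a set
  cannot record, and the degrees would drop.\<close>

definition good :: "nat set set \<Rightarrow> (nat \<Rightarrow> nat list) set" where
  "good G = {W \<in> I \<rightarrow>\<^sub>E orderings (G - F). separated W \<and> (\<forall>j<r. colset W j \<notin> G)}"

definition switch :: "nat set set \<Rightarrow> (nat \<Rightarrow> nat list) \<Rightarrow> nat set set" where
  "switch G W = (G - rows W) \<union> cols W"

lemma row_props:
  assumes W: "W \<in> I \<rightarrow>\<^sub>E orderings K" and K: "K \<subseteq> rsets r n" and i: "i \<in> I"
  shows "distinct (W i)" "set (W i) \<in> K" "length (W i) = r"
proof -
  have "W i \<in> orderings K" by (rule PiE_mem[OF W i])
  then show 1: "distinct (W i)" and 2: "set (W i) \<in> K" by (simp_all add: orderings_def)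
  have "card (set (W i)) = r" using subsetD[OF K 2] by (simp add: rsets_def)
  then show "length (W i) = r" using distinct_card[OF 1] by simp
qed

context
  fixes W K
  assumes W: "W \<in> I \<rightarrow>\<^sub>E orderings K" and K: "K \<subseteq> rsets r n" and sep: "separated W"
begin

lemma entry_eq:
  assumes "i \<in> I" "i' \<in> I" "j < r" "j' < r" "W i ! j = W i' ! j'"
  shows "i = i' \<and> j = j'"
proof -
  have a: "W i ! j \<in> set (W i)" "W i' ! j' \<in> set (W i')"
    using assms nth_mem[of j "W i"] nth_mem[of j' "W i'"]
    by (simp_all add: row_props(3)[OF W K])
  have "i = i'"
  proof (rule ccontr)
    assume ne: "i \<noteq> i'"
    have "set (W i) \<inter> (e \<union> (\<Union>k\<in>I-{i}. set (W k))) = {}"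
      using sep assms(1) unfolding separated_def by (rule bspec)
    moreover have "i' \<in> I - {i}" using ne assms by blast
    ultimately have "set (W i) \<inter> set (W i') = {}" by blast
    then show False using a assms by auto
  qed
  moreover have "j = j'" using assms(3,4,5) row_props[OF W K assms(1)]
    unfolding \<open>i = i'\<close>[symmetric] by (simp add: nth_eq_iff_index_eq)
  ultimately show ?thesis by simp
qed

lemma entry_not_e:
  assumes "i \<in> I" "j < r"
  shows "W i ! j \<notin> e"
proof -
  have "W i ! j \<in> set (W i)" using assms nth_mem[of j "W i"] row_props(3)[OF W K] by simp
  moreover have "set (W i) \<inter> (e \<union> (\<Union>k\<in>I-{i}. set (W k))) = {}"
    using sep assms(1) unfolding separated_def by (rule bspec)
  ultimately show ?thesis by blast
qed

lemma vs_in_e: "j < r \<Longrightarrow> vs ! j \<in> e" using vs nth_mem[of j vs] by simp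

lemma col_props:
  assumes "j < r"
  shows "inj_on (col W j) I" "vs ! j \<notin> col W j ` I" "col W j \<in> extensional I"
proof -
  show "inj_on (col W j) I"
  proof (rule inj_onI)
    fix i i' assume i: "i \<in> I" "i' \<in> I" and eq: "col W j i = col W j i'"
    have "W i ! j = W i' ! j" using eq i unfolding col_def by simp
    then show "i = i'" using entry_eq[OF i assms assms] by blast
  qed
  show "vs ! j \<notin> col W j ` I"
  proof
    assume "vs ! j \<in> col W j ` I"
    then obtain i where "i \<in> I" "vs ! j = W i ! j" by (auto simp: col_def)
    then show False using entry_not_e[of i j] vs_in_e[of j] assms by simp
  qed
  show "col W j \<in> extensional I" by (simp add: col_def)
qed

lemma colset_in_rsets:
  assumes "j < r"
  shows "colset W j \<in> rsets r n"
proof -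
  have "card (colset W j) = r" unfolding colset_def
    using col_props[OF assms] r by (simp add: card_image)
  moreover have "col W j i < n" if i: "i \<in> I" for i
  proof -
    have "W i ! j \<in> set (W i)" using i assms nth_mem[of j "W i"] row_props(3)[OF W K] by simp
    then show ?thesis using row_props(2)[OF W K i] K i by (auto simp: col_def rsets_def)
  qed
  moreover have "vs ! j < n" using vs_in_e[OF assms] e by (auto simp: rsets_def)
  ultimately show ?thesis by (auto simp: rsets_def colset_def)
qed

lemma colset_disjoint:
  assumes "j < r" "j' < r" "j \<noteq> j'"
  shows "colset W j \<inter> colset W j' = {}"
proof -
  have ne: "vs ! j \<noteq> vs ! j'" using vs assms by (simp add: nth_eq_iff_index_eq)
  have no: "vs ! a \<notin> col W b ` I" if "a < r" "b < r" for a b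
  proof
    assume "vs ! a \<in> col W b ` I"
    then obtain i where "i \<in> I" "vs ! a = W i ! b" by (auto simp: col_def)
    then show False using entry_not_e[of i b] vs_in_e[of a] that by simp
  qed
  have disj: "col W j ` I \<inter> col W j' ` I = {}"
  proof (rule ccontr)
    assume "\<not> ?thesis"
    then obtain i i' where i: "i \<in> I" "i' \<in> I" and eq: "col W j i = col W j' i'" by blast
    have "W i ! j = W i' ! j'" using eq i unfolding col_def by simp
    then show False using entry_eq[OF i assms(1,2)] assms(3) by blast
  qed
  show ?thesis using ne disj no[OF assms(1,2)] no[OF assms(2,1)] unfolding colset_def
    by (simp only: Int_insert_left Int_insert_right) simp
qed

lemma Union_rows_cols: "\<Union>(rows W) = \<Union>(cols W)"
proof -
  have nth_image: "set xs = (\<lambda>j. xs ! j) ` {..<length xs}" for xs :: "nat list"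
    by (auto simp: in_set_conv_nth)
  have e: "e = (\<lambda>j. vs ! j) ` {..<r}" using nth_image[of vs] vs by simp
  have row: "set (W i) = (\<lambda>j. W i ! j) ` {..<r}" if "i \<in> I" for i
    using nth_image[of "W i"] row_props(3)[OF W K that] by simp
  have "\<Union>(rows W) = (\<lambda>j. vs ! j) ` {..<r} \<union> (\<Union>i\<in>I. (\<lambda>j. W i ! j) ` {..<r})"
    unfolding rows_def Union_insert using e row by simp
  also have "\<dots> = (\<Union>j<r. insert (vs ! j) ((\<lambda>i. W i ! j) ` I))" by blast
  also have "\<dots> = \<Union>(cols W)" unfolding cols_def colset_def col_def by simp
  finally show ?thesis .
qed

text \<open>Rows and columns are two partitions of the same set of matrix entries, so every vertex
  has degree 0 in both or degree 1 in both. This is why the switching preserves regularity.\<close>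

lemma vdeg_rows_cols: "vdeg (rows W) u = vdeg (cols W) u"
proof -
  have "vdeg (rows W) u = (if u \<in> \<Union>(rows W) then 1 else 0)"
  proof (rule vdeg_disjoint_family)
    have row: "set (W i) \<inter> (e \<union> (\<Union>k\<in>I-{i}. set (W k))) = {}" if "i \<in> I" for i
      using sep that unfolding separated_def by (rule bspec)
    fix x y assume xy: "x \<in> rows W" "y \<in> rows W" "x \<noteq> y"
    have "x = e \<or> (\<exists>i\<in>I. x = set (W i))" "y = e \<or> (\<exists>i\<in>I. y = set (W i))"
      using xy unfolding rows_def by auto
    then consider "x = e" "y = e" | i where "i \<in> I" "x = set (W i)" "y = e"
      | i where "i \<in> I" "y = set (W i)" "x = e"
      | i k where "i \<in> I" "x = set (W i)" "k \<in> I" "y = set (W k)" "i \<noteq> k"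
      using xy(3) by blast
    then show "x \<inter> y = {}"
    proof cases
      case 4
      then have "k \<in> I - {i}" by blast
      then show ?thesis using row[OF 4(1)] 4 by blast
    qed (use xy row in blast)+
  qed (simp add: rows_def)
  moreover have "vdeg (cols W) u = (if u \<in> \<Union>(cols W) then 1 else 0)"
    by (rule vdeg_disjoint_family) (auto simp: cols_def dest: colset_disjoint)
  ultimately show ?thesis using Union_rows_cols by simp
qed

end

text \<open>The third conclusion makes the switching reversible once \<open>W\<close> is known. The
  fourth says that \<open>W\<close> can be found among the residual edges of the new graph through
  the vertices of \<open>e\<close>, one edge per vertex, which is what bounds the number of
  preimages.\<close>

lemma switch_props:
  assumes G: "G \<in> Reg r n d" "insert e F \<subseteq> G" and W: "W \<in> good G"
  shows "switch G W \<in> Reg r n d" "F \<subseteq> switch G W"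
    "G = (switch G W - cols W) \<union> rows W"
    "j < r \<Longrightarrow> col W j \<in> columns r (switch G W - F) (vs ! j)"
proof -
  have GR: "G \<subseteq> rsets r n" using G by (simp add: Reg_def)
  have fin: "finite G" using GR finite_rsets by (rule finite_subset)
  have K: "G - F \<subseteq> rsets r n" using GR by auto
  have W1: "W \<in> I \<rightarrow>\<^sub>E orderings (G - F)" and sep: "separated W" and new: "\<And>j. j < r \<Longrightarrow> colset W j \<notin> G"
    using W by (auto simp: good_def)
  note props = W1 K sep
  have rows: "rows W \<subseteq> G - F" using row_props(2)[OF W1 K] G e by (auto simp: rows_def)
  have colsG: "cols W \<inter> G = {}" using new by (auto simp: cols_def)
  have cols: "cols W \<subseteq> rsets r n" using colset_in_rsets[OF props] by (auto simp: cols_def)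
  have finc: "finite (cols W)" by (simp add: cols_def)
  show FS: "F \<subseteq> switch G W" using G rows by (auto simp: switch_def)
  show "G = (switch G W - cols W) \<union> rows W" using rows colsG by (auto simp: switch_def)
  have "vdeg (switch G W) u = vdeg G u" for u
  proof -
    have "vdeg (switch G W) u = vdeg (G - rows W) u + vdeg (cols W) u"
      unfolding switch_def by (rule vdeg_Un_disjoint) (use fin finc colsG in auto)
    also have "\<dots> = vdeg (G - rows W) u + vdeg (rows W) u"
      using vdeg_rows_cols[OF props] by simp
    also have "\<dots> = vdeg ((G - rows W) \<union> rows W) u"
      by (rule vdeg_Un_disjoint[symmetric]) (use fin rows in \<open>auto simp: rows_def\<close>)
    also have "(G - rows W) \<union> rows W = G" using rows by auto
    finally show ?thesis .
  qed
  then show "switch G W \<in> Reg r n d" using G cols GR by (auto simp: Reg_def switch_def)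
  show "col W j \<in> columns r (switch G W - F) (vs ! j)" if j: "j < r"
  proof -
    have "colset W j \<in> switch G W - F" using j new[OF j] G by (auto simp: switch_def cols_def)
    then show ?thesis using col_props[OF props j] by (auto simp: columns_def colset_def)
  qed
qed

text \<open>Double counting of pairs \<open>(G, W)\<close>. The columns determine all entries of
  \<open>W\<close>, and \<open>W\<close> with the switched graph determines \<open>G\<close>, so the
  map to switched graph and columns is injective. In the image, column \<open>j\<close> is an
  ordering of the rest of a residual edge at \<open>vs ! j\<close>, of which there are
  \<open>d - vdeg F (vs ! j)\<close>.\<close>

lemma sum_good_le:
  "(\<Sum>G\<in>{G\<in>Reg r n d. insert e F \<subseteq> G}. card (good G))
    \<le> card {G\<in>Reg r n d. F \<subseteq> G} * (\<Prod>j<r. (d - vdeg F (vs ! j)) * fact (r - 1))"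
proof -
  let ?A = "{G\<in>Reg r n d. insert e F \<subseteq> G}" and ?B = "{G\<in>Reg r n d. F \<subseteq> G}"
  define Q where "Q G = (\<Pi>\<^sub>E j\<in>{..<r}. columns r (G - F) (vs ! j))" for G
  have KR: "G - F \<subseteq> rsets r n" if "G \<in> Reg r n d" for G using that by (auto simp: Reg_def)
  have fgood: "finite (good G)" if "G \<in> Reg r n d" for G
  proof -
    have "finite (I \<rightarrow>\<^sub>E orderings (G - F))" using card_orderings(1)[OF KR[OF that]] by (intro finite_PiE) auto
    then show ?thesis unfolding good_def by simp
  qed
  have fQ: "finite (Q G)" if "G \<in> Reg r n d" for G
    unfolding Q_def using card_columns(1)[OF KR[OF that]] by (intro finite_PiE) auto
  have cQ: "card (Q G) \<le> (\<Prod>j<r. (d - vdeg F (vs ! j)) * fact (r - 1))" if G: "G \<in> ?B" for G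
  proof -
    have fG: "finite G" using G finite_subset[OF _ finite_rsets, of G r n] by (simp add: Reg_def)
    have "card (columns r (G - F) (vs ! j)) \<le> (d - vdeg F (vs ! j)) * fact (r - 1)" if j: "j < r" for j
    proof -
      have "vs ! j \<in> e" using vs j nth_mem[of j vs] by simp
      then have "vs ! j < n" using e by (auto simp: rsets_def)
      then have "vdeg (G - F) (vs ! j) = d - vdeg F (vs ! j)"
        using G by (subst vdeg_diff[OF fG]) (auto simp: Reg_def)
      then show ?thesis using card_columns(2)[of "G - F" r n "vs ! j"] KR[of G] G by simp
    qed
    then have "(\<Prod>j<r. card (columns r (G - F) (vs ! j))) \<le> (\<Prod>j<r. (d - vdeg F (vs ! j)) * fact (r - 1))"
      by (intro prod_mono) simp
    then show ?thesis unfolding Q_def by (simp add: card_PiE)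
  qed
  define f where "f = (\<lambda>(G, W). (switch G W, \<lambda>j\<in>{..<r}. col W j))"
  have sub: "f ` (Sigma ?A good) \<subseteq> Sigma ?B Q"
  proof (intro image_subsetI)
    fix x assume "x \<in> Sigma ?A good"
    then obtain G W where x: "x = (G, W)" and *: "G \<in> Reg r n d" "insert e F \<subseteq> G" "W \<in> good G" by auto
    show "f x \<in> Sigma ?B Q" using switch_props[OF *] by (simp add: x f_def Q_def)
  qed
  have inj: "inj_on f (Sigma ?A good)"
  proof (rule inj_onI)
    fix x x' assume x: "x \<in> Sigma ?A good" and x': "x' \<in> Sigma ?A good" and eq: "f x = f x'"
    obtain G W where [simp]: "x = (G, W)" by (cases x)
    obtain G' W' where [simp]: "x' = (G', W')" by (cases x')
    have G: "G \<in> Reg r n d" "insert e F \<subseteq> G" "W \<in> good G" using x by auto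
    have G': "G' \<in> Reg r n d" "insert e F \<subseteq> G'" "W' \<in> good G'" using x' by auto
    have W: "W \<in> I \<rightarrow>\<^sub>E orderings (G - F)" using G by (auto simp: good_def)
    have W': "W' \<in> I \<rightarrow>\<^sub>E orderings (G' - F)" using G' by (auto simp: good_def)
    have sw: "switch G W = switch G' W'" and
      co: "(\<lambda>j\<in>{..<r}. col W j) = (\<lambda>j\<in>{..<r}. col W' j)" using eq by (auto simp: f_def)
    have ent: "W i ! j = W' i ! j" if "i \<in> I" "j < r" for i j
    proof -
      have "(\<lambda>j\<in>{..<r}. col W j) j i = (\<lambda>j\<in>{..<r}. col W' j) j i" by (simp only: co)
      then have "col W j i = col W' j i" using that by simp
      then show ?thesis using that by (simp add: col_def)
    qed
    have "W i = W' i" if i: "i \<in> I" for i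
    proof (rule nth_equalityI)
      show "length (W i) = length (W' i)"
        using row_props(3)[OF W KR[OF G(1)] i] row_props(3)[OF W' KR[OF G'(1)] i] by simp
      show "W i ! j = W' i ! j" if "j < length (W i)" for j
        using ent[OF i] that row_props(3)[OF W KR[OF G(1)] i] by simp
    qed
    then have "W = W'"
      using W W' by (intro extensionalityI[of W I]) (simp_all add: PiE_iff)
    moreover have "G = (switch G' W' - cols W) \<union> rows W"
      using switch_props(3)[OF G] unfolding sw .
    ultimately have "G = G'" using switch_props(3)[OF G'] by (simp only:)
    then show "x = x'" using \<open>W = W'\<close> by simp
  qed
  have fS: "finite (Sigma ?B Q)" using fQ by (intro finite_SigmaI) auto
  have "(\<Sum>G\<in>?A. card (good G)) = card (Sigma ?A good)"
    using fgood by (subst card_SigmaI) auto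
  also have "\<dots> \<le> card (Sigma ?B Q)"
    using card_mono[OF fS sub] card_image[OF inj] by simp
  also have "\<dots> = (\<Sum>G\<in>?B. card (Q G))" using fQ by (subst card_SigmaI) auto
  also have "\<dots> \<le> (\<Sum>G\<in>?B. (\<Prod>j<r. (d - vdeg F (vs ! j)) * fact (r - 1)))"
    using cQ by (rule sum_mono)
  finally show ?thesis by simp
qed

text \<open>From all tuples of ordered residual edges two kinds are removed. Either some row meets
  \<open>e\<close> or another row: these contain at most \<open>r * r\<close> vertices, each on at
  most \<open>D\<close> residual edges. Or some column lies in \<open>G\<close>: choose it among the
  at most \<open>d\<close> edges at its top vertex, order it, and each of the \<open>r - 1\<close>
  rows must then pass through a prescribed vertex.\<close>

lemma card_good_ge:
  assumes G: "G \<in> Reg r n d" "insert e F \<subseteq> G" and D: "\<And>u. vdeg (G - F) u \<le> D"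
  shows "(card (G - F) * fact r) ^ (r - 1) \<le> card (good G)
    + (r - 1) * ((card (G - F) * fact r) ^ (r - 2) * (r * r * (D * fact r)))
    + r * (d * fact (r - 1) * (D * fact r) ^ (r - 1))"
proof -
  define K where "K = G - F"
  have GR: "G \<subseteq> rsets r n" using G by (simp add: Reg_def)
  have K: "K \<subseteq> rsets r n" using GR by (auto simp: K_def)
  have D': "\<And>u. vdeg K u \<le> D" using D by (simp add: K_def)
  define A where "A = orderings K"
  have fA: "finite A" and cA: "card A = card K * fact r" using card_orderings[OF K] by (auto simp: A_def)
  define P where "P = (I \<rightarrow>\<^sub>E A)"
  have fP: "finite P" unfolding P_def using fA by (intro finite_PiE) auto
  have cP: "card P = card A ^ (r - 1)" unfolding P_def by (simp add: card_funcsetE)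
  define R where "R a W x \<longleftrightarrow> set x \<inter> (e \<union> (\<Union>i\<in>I-{a}. set (W i))) \<noteq> {}" for a :: nat and W :: "nat \<Rightarrow> nat list" and x
  define B1 where "B1 a = {W \<in> P. R a (restrict W (I - {a})) (W a)}" for a
  \<comment> \<open>Separation is included so that the column is injective and avoids
    \<open>vs ! j\<close>, hence is counted by \<open>columns\<close>.\<close>
  define B3 where "B3 j = {W \<in> P. separated W \<and> colset W j \<in> G}" for j
  have c1: "card (B1 a) \<le> card A ^ (r - 2) * (r * r * (D * fact r))" if a: "a \<in> I" for a
  proof -
    have "card (B1 a) \<le> card A ^ (card I - 1) * (r * r * (D * fact r))"
      unfolding B1_def P_def
    proof (rule card_PiE_coordinate_le)
      fix W assume W: "W \<in> (I - {a}) \<rightarrow>\<^sub>E A"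
      have len: "finite (set (W i)) \<and> card (set (W i)) = r" if "i \<in> I - {a}" for i
      proof -
        have "W i \<in> A" by (rule PiE_mem[OF W that])
        then have "set (W i) \<in> rsets r n" using K unfolding A_def orderings_def by blast
        then show ?thesis by (simp add: rsets_def)
      qed
      let ?U = "e \<union> (\<Union>i\<in>I-{a}. set (W i))"
      have fU: "finite ?U" using finite_edge[OF e(1)] by auto
      have "card ?U \<le> card e + card (\<Union>i\<in>I-{a}. set (W i))" by (rule card_Un_le)
      also have "\<dots> \<le> r + (\<Sum>i\<in>I-{a}. card (set (W i)))"
        using e card_UN_le[of "I - {a}" "\<lambda>i. set (W i)"] by (auto simp: rsets_def)
      also have "\<dots> = r + (\<Sum>i\<in>I-{a}. r)" using len by simp
      also have "\<dots> = r + (r - 2) * r" using a by (simp add: card_Diff_singleton numeral_2_eq_2)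
      also have "\<dots> \<le> r * r" 
      proof -
        obtain q where "r = Suc (Suc q)" using r by (metis add_2_eq_Suc le_Suc_ex)
        then show ?thesis by simp
      qed
      finally have cU: "card ?U \<le> r * r" .
      have "card {x \<in> A. R a W x} \<le> card ?U * (D * fact r)"
        unfolding A_def R_def by (rule card_orderings_meeting[OF K D' fU])
      also have "\<dots> \<le> r * r * (D * fact r)" using cU by (rule mult_right_mono) simp
      finally show "card {x \<in> A. R a W x} \<le> r * r * (D * fact r)" .
    qed (use a fA in auto)
    then show ?thesis by (simp add: numeral_2_eq_2)
  qed
  have c3: "card (B3 j) \<le> d * fact (r - 1) * (D * fact r) ^ (r - 1)" if j: "j < r" for j
  proof -
    have vj: "vs ! j < n" 
    proof -
      have "vs ! j \<in> e" using vs j nth_mem[of j vs] by simp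
      then show ?thesis using e by (auto simp: rsets_def)
    qed
    define f where "f W = (col W j, W)" for W
    define T where "T = Sigma (columns r G (vs ! j)) (\<lambda>c. (\<Pi>\<^sub>E i\<in>I. {x \<in> A. c i \<in> set x}))"
    have fT: "finite T" unfolding T_def using card_columns(1)[OF GR] fA
      by (intro finite_SigmaI finite_PiE) auto
    have "f ` B3 j \<subseteq> T"
    proof (intro image_subsetI)
      fix W assume "W \<in> B3 j"
      then have W: "W \<in> I \<rightarrow>\<^sub>E orderings K" "separated W" "colset W j \<in> G" by (auto simp: B3_def P_def A_def)
      note props = W(1) K W(2)
      have "col W j \<in> columns r G (vs ! j)"
        using col_props[OF props j] W by (auto simp: columns_def colset_def)
      moreover have "col W j i \<in> set (W i)" if "i \<in> I" for i
        using row_props(3)[OF W(1) K that] j that by (auto simp: col_def)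
      ultimately show "f W \<in> T" using W by (auto simp: f_def T_def A_def PiE_iff)
    qed
    then have "card (f ` B3 j) \<le> card T" by (rule card_mono[OF fT])
    moreover have "inj_on f (B3 j)" by (auto simp: f_def inj_on_def)
    ultimately have "card (B3 j) \<le> card T" by (simp add: card_image)
    also have "\<dots> = (\<Sum>c\<in>columns r G (vs ! j). card (\<Pi>\<^sub>E i\<in>I. {x \<in> A. c i \<in> set x}))"
      unfolding T_def using card_columns(1)[OF GR] fA by (subst card_SigmaI) (auto intro!: finite_PiE)
    also have "\<dots> \<le> (\<Sum>c\<in>columns r G (vs ! j). (D * fact r) ^ (r - 1))"
    proof (rule sum_mono)
      fix c assume "c \<in> columns r G (vs ! j)"
      have "card (\<Pi>\<^sub>E i\<in>I. {x \<in> A. c i \<in> set x}) = (\<Prod>i\<in>I. card {x \<in> A. c i \<in> set x})"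
        by (simp add: card_PiE)
      also have "\<dots> \<le> (\<Prod>i\<in>I. D * fact r)"
        by (rule prod_mono) (simp add: A_def card_orderings_through[OF K] D')
      finally show "card (\<Pi>\<^sub>E i\<in>I. {x \<in> A. c i \<in> set x}) \<le> (D * fact r) ^ (r - 1)" by simp
    qed
    also have "\<dots> = card (columns r G (vs ! j)) * (D * fact r) ^ (r - 1)" by simp
    also have "\<dots> \<le> d * fact (r - 1) * (D * fact r) ^ (r - 1)"
      using card_columns(2)[OF GR, of "vs ! j"] G vj by (intro mult_right_mono) (auto simp: Reg_def)
    finally show ?thesis .
  qed
  have "P \<subseteq> good G \<union> (\<Union>a\<in>I. B1 a) \<union> (\<Union>j<r. B3 j)"
  proof
    fix W assume W: "W \<in> P"
    have rs: "R a (restrict W (I - {a})) x = R a W x" for a x unfolding R_def by simp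
    have sep: "separated W \<longleftrightarrow> (\<forall>a\<in>I. \<not> R a W (W a))" unfolding separated_def R_def by simp
    consider "\<not> separated W" | j where "separated W" "j < r" "colset W j \<in> G"
      | "separated W" "\<forall>j<r. colset W j \<notin> G" by blast
    then show "W \<in> good G \<union> (\<Union>a\<in>I. B1 a) \<union> (\<Union>j<r. B3 j)"
    proof cases
      case 1
      then obtain a where "a \<in> I" "R a W (W a)" using sep by blast
      then have "R a (restrict W (I - {a})) (W a)" by (simp only: rs)
      then have "W \<in> B1 a" unfolding B1_def using W by blast
      then show ?thesis using \<open>a \<in> I\<close> by blast
    next
      case (2 j)
      then have "W \<in> B3 j" unfolding B3_def using W by blast
      then show ?thesis using 2(2) by blast
    next
      case 3
      then have "W \<in> good G" using W unfolding good_def P_def A_def K_def by blast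
      then show ?thesis by blast
    qed
  qed
  moreover have "good G \<subseteq> P" unfolding good_def P_def A_def K_def by blast
  then have "finite (good G)" using fP by (rule finite_subset)
  then have "finite (good G \<union> (\<Union>a\<in>I. B1 a) \<union> (\<Union>j<r. B3 j))" using fP by (simp add: B1_def B3_def)
  ultimately have "card P \<le> card (good G \<union> (\<Union>a\<in>I. B1 a) \<union> (\<Union>j<r. B3 j))" by (intro card_mono)
  also have "\<dots> \<le> card (good G) + card (\<Union>a\<in>I. B1 a) + card (\<Union>j<r. B3 j)"
    by (rule order_trans[OF card_Un_le add_right_mono[OF card_Un_le]])
  also have "\<dots> \<le> card (good G) + (\<Sum>a\<in>I. card (B1 a)) + (\<Sum>j<r. card (B3 j))"
    using card_UN_le[of I B1] card_UN_le[of "{..<r}" B3] by simp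
  also have "\<dots> \<le> card (good G) + (\<Sum>a\<in>I. card A ^ (r - 2) * (r * r * (D * fact r)))
      + (\<Sum>j<r. d * fact (r - 1) * (D * fact r) ^ (r - 1))"
    using c1 c3 by (intro add_mono sum_mono) auto
  finally show ?thesis unfolding cP cA K_def by simp
qed

end

text \<open>The proportion of tuples lost in \<open>card_good_ge\<close> when no residual degree
  exceeds twice the average \<open>r * m / n\<close>: the first term comes from colliding rows, the
  second from columns already present.\<close>

definition switching_loss :: "nat \<Rightarrow> nat \<Rightarrow> nat \<Rightarrow> real" where
  "switching_loss r n d = 2 * real r ^ 4 / real n + fact r * real d * (2 * real r / real n) ^ (r - 1)"

text \<open>Divides the two counts of pairs. The factor 2 over the average residual degree is only
  the crude bound behind \<open>switching_loss\<close>; the exact residual degrees at the vertices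
  of \<open>e\<close> survive in the product.\<close>

lemma (in switching) card_insert_switching:
  fixes m :: real
  assumes n: "n > 0" and M: "r * M = n * d"
    and m: "m = real M - real (card F)"
    and res: "\<And>u. u < n \<Longrightarrow> real d - real (vdeg F u) \<le> 2 * r * m / n"
  shows "card {G\<in>Reg r n d. insert e F \<subseteq> G} * ((m * fact r) ^ (r - 1) * (1 - switching_loss r n d))
    \<le> card {G\<in>Reg r n d. F \<subseteq> G} * (\<Prod>j<r. (real d - real (vdeg F (vs ! j))) * fact (r - 1))"
proof (cases "{G\<in>Reg r n d. insert e F \<subseteq> G} = {}")
  case True
  have nonneg: "real d - real (vdeg F (vs ! j)) \<ge> 0" if "G \<in> Reg r n d" "F \<subseteq> G" "j < r" for G j
  proof -
    have "vs ! j < n" using nth_mem[of j vs] that vs e by (auto simp: rsets_def)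
    moreover have "finite G" using that finite_subset[OF _ finite_rsets, of G r n] by (simp add: Reg_def)
    ultimately have "vdeg F (vs ! j) \<le> d" using vdeg_mono[of G F "vs ! j"] that by (simp add: Reg_def)
    then show ?thesis by simp
  qed
  \<comment> \<open>Over the reals the factors might be negative. A regular graph containing
    \<open>F\<close> bounds the degrees of \<open>F\<close> by \<open>d\<close>; without such a
    graph the count in front vanishes.\<close>
  have "card {G\<in>Reg r n d. F \<subseteq> G} * (\<Prod>j<r. (real d - real (vdeg F (vs ! j))) * fact (r - 1)) \<ge> 0"
  proof (cases "{G\<in>Reg r n d. F \<subseteq> G} = {}")
    case True
    show ?thesis unfolding True by simp
  next
    case False
    then obtain G where G: "G \<in> Reg r n d" "F \<subseteq> G" by blast
    have "(\<Prod>j<r. (real d - real (vdeg F (vs ! j))) * fact (r - 1)) \<ge> 0"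
      using nonneg[OF G] by (intro prod_nonneg mult_nonneg_nonneg) auto
    then show ?thesis by (intro mult_nonneg_nonneg) simp_all
  qed
  then show ?thesis unfolding True by simp
next
  case False
  let ?A = "{G\<in>Reg r n d. insert e F \<subseteq> G}"
  obtain G0 where G0: "G0 \<in> Reg r n d" "insert e F \<subseteq> G0" using False by auto
  have fin: "finite G" if "G \<in> Reg r n d" for G
    using that finite_subset[OF _ finite_rsets, of G r n] by (simp add: Reg_def)
  have cG: "card G = M" if "G \<in> Reg r n d" for G
  proof -
    have "r * card G = r * M" using card_Reg[OF that] M by simp
    then show ?thesis using r by simp
  qed
  have mG: "real (card (G - F)) = m" if "G \<in> ?A" for G
  proof -
    have G: "G \<in> Reg r n d" "F \<subseteq> G" using that by auto
    have "card (G - F) = card G - card F" using card_Diff_subset[of F G] G fin[OF G(1)] finite_subset[OF G(2)] by simp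
    moreover have "card F \<le> card G" using card_mono[OF fin[OF G(1)] G(2)] .
    ultimately show ?thesis using cG[OF G(1)] m by simp
  qed
  have m0: "m \<ge> 0" using mG[of G0] G0 by (metis (mono_tags, lifting) mem_Collect_eq of_nat_0_le_iff)
  define D where "D = nat \<lfloor>2 * r * m / n\<rfloor>"
  have D: "real D \<le> 2 * r * m / n" unfolding D_def using m0 by simp
  have dD: "vdeg (G - F) u \<le> D" if G: "G \<in> ?A" for G u
  proof (cases "u < n")
    case True
    have "vdeg (G - F) u = vdeg G u - vdeg F u" using G fin by (intro vdeg_diff) auto
    moreover have "vdeg F u \<le> vdeg G u" using G fin by (intro vdeg_mono) auto
    moreover have "vdeg G u = d" using G True by (simp add: Reg_def)
    ultimately have "real (vdeg (G - F) u) \<le> 2 * r * m / n" using res[OF True] by simp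
    then show ?thesis unfolding D_def by (simp add: le_nat_floor)
  next
    case False
    then have "{g \<in> G - F. u \<in> g} = {}" using G by (auto simp: Reg_def rsets_def)
    then show ?thesis unfolding vdeg_def by (simp only: card.empty)
  qed
  define a where "a = m * fact r"
  have a0: "a \<ge> 0" using m0 by (simp add: a_def)
  have Da: "real D * fact r \<le> 2 * r / n * a"
    using mult_right_mono[OF D, of "fact r"] by (simp add: a_def)
  have rf: "real r * fact (r - 1) = fact r" using r by (simp add: fact_reduce)
  obtain q where q: "r = Suc (Suc q)" using r by (metis add_2_eq_Suc le_Suc_ex)
  have good: "a ^ (r - 1) * (1 - switching_loss r n d) \<le> card (good G)" if G: "G \<in> ?A" for G
  proof -
    have "(card (G - F) * fact r) ^ (r - 1) \<le> card (good G)
      + (r - 1) * ((card (G - F) * fact r) ^ (r - 2) * (r * r * (D * fact r)))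
      + r * (d * fact (r - 1) * (D * fact r) ^ (r - 1))"
      using G dD[OF G] by (intro card_good_ge) auto
    then have "real ((card (G - F) * fact r) ^ (r - 1)) \<le> real (card (good G)
      + (r - 1) * ((card (G - F) * fact r) ^ (r - 2) * (r * r * (D * fact r)))
      + r * (d * fact (r - 1) * (D * fact r) ^ (r - 1)))" by (rule of_nat_mono)
    then have "a ^ (r - 1) \<le> card (good G) + real (r - 1) * (a ^ (r - 2) * (real r * r * (real D * fact r)))
      + r * (d * fact (r - 1) * (real D * fact r) ^ (r - 1))"
      using mG[OF G] by (simp add: a_def)
    also have "\<dots> \<le> card (good G) + real r * (a ^ (r - 2) * (real r * r * (2 * r / n * a)))
      + r * (d * fact (r - 1) * (2 * r / n * a) ^ (r - 1))"
    proof (intro add_mono order_refl)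
      have "real (r - 1) * (a ^ (r - 2) * (real r * r * (real D * fact r)))
          \<le> real r * (a ^ (r - 2) * (real r * r * (real D * fact r)))"
        using a0 by (intro mult_right_mono) auto
      also have "\<dots> \<le> real r * (a ^ (r - 2) * (real r * r * (2 * r / n * a)))"
        by (intro mult_left_mono Da) (use a0 in auto)
      finally show "real (r - 1) * (a ^ (r - 2) * (real r * r * (real D * fact r)))
          \<le> real r * (a ^ (r - 2) * (real r * r * (2 * r / n * a)))" .
      have "(real D * fact r) ^ (r - 1) \<le> (2 * r / n * a) ^ (r - 1)"
        by (rule power_mono[OF Da]) simp
      then show "r * (d * fact (r - 1) * (real D * fact r) ^ (r - 1))
          \<le> r * (d * fact (r - 1) * (2 * r / n * a) ^ (r - 1))"
        by (intro mult_left_mono) auto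
    qed
    also have "real r * (a ^ (r - 2) * (real r * r * (2 * r / n * a))) = a ^ (r - 1) * (2 * real r ^ 4 / real n)"
      by (simp add: q power4_eq_xxxx)
    also have "r * (d * fact (r - 1) * (2 * r / n * a) ^ (r - 1))
       = a ^ (r - 1) * (fact r * real d * (2 * real r / real n) ^ (r - 1))"
      unfolding power_mult_distrib rf[symmetric] by simp
    finally show ?thesis unfolding switching_loss_def by (simp add: algebra_simps)
  qed
  have "card ?A * (a ^ (r - 1) * (1 - switching_loss r n d)) = (\<Sum>G\<in>?A. a ^ (r - 1) * (1 - switching_loss r n d))"
    by simp
  also have "\<dots> \<le> (\<Sum>G\<in>?A. real (card (good G)))" using good by (rule sum_mono)
  also have "\<dots> \<le> real (card {G\<in>Reg r n d. F \<subseteq> G} * (\<Prod>j<r. (d - vdeg F (vs ! j)) * fact (r - 1)))"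
    using of_nat_mono[OF sum_good_le] by (simp only: of_nat_sum)
  also have "\<dots> = card {G\<in>Reg r n d. F \<subseteq> G} * (\<Prod>j<r. (real d - real (vdeg F (vs ! j))) * fact (r - 1))"
  proof -
    have "vdeg F (vs ! j) \<le> d" if "j < r" for j
    proof -
      have "vs ! j < n" using nth_mem[of j vs] that vs e by (auto simp: rsets_def)
      then show ?thesis using vdeg_mono[OF fin[OF G0(1)], of F "vs ! j"] G0 by (simp add: Reg_def)
    qed
    then have "(\<Prod>j<r. real ((d - vdeg F (vs ! j)) * fact (r - 1))) =
       (\<Prod>j<r. (real d - real (vdeg F (vs ! j))) * fact (r - 1))"
      by (intro prod.cong) auto
    then show ?thesis by simp
  qed
  finally show ?thesis by (simp add: a_def)
qed

text \<open>Balance enters through the product: each of the \<open>r\<close> vertices of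
  \<open>e\<close> has residual degree at most \<open>1 + \<theta>\<close> times the average, giving
  the power \<open>(1 + \<theta>) ^ r\<close>. The bound
  \<open>n choose r \<le> n ^ r / fact r\<close> then turns the power of \<open>n\<close> into the
  number of possible edges, so \<open>e\<close> appears with at most this factor times the residual
  density.\<close>

lemma card_insert_le:
  fixes m \<theta> :: real
  assumes r: "r \<ge> 2" and e: "e \<in> rsets r n" "e \<notin> F" and n: "n > 0" and M: "r * M = n * d"
    and m: "m = real M - real (card F)" "m > 0" and loss: "switching_loss r n d < 1"
    and \<theta>: "0 \<le> \<theta>" "\<theta> \<le> 1"
    and res: "\<And>u. u < n \<Longrightarrow> real d - real (vdeg F u) \<le> (1 + \<theta>) * r * m / n"
    and F: "\<And>u. u < n \<Longrightarrow> vdeg F u \<le> d"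
  shows "real (card {G\<in>Reg r n d. insert e F \<subseteq> G}) * (n choose r)
    \<le> card {G\<in>Reg r n d. F \<subseteq> G} * ((1 + \<theta>) ^ r / (1 - switching_loss r n d) * m)"
proof -
  obtain vs where vs: "distinct vs" "set vs = e"
    using finite_distinct_list[OF finite_edge[OF e(1)]] by blast
  have len: "length vs = r" using distinct_card[OF vs(1)] vs(2) e(1) by (simp add: rsets_def)
  interpret switching r n d F e vs by standard (use r e vs len in auto)
  let ?A = "real (card {G\<in>Reg r n d. insert e F \<subseteq> G})" and ?B = "real (card {G\<in>Reg r n d. F \<subseteq> G})"
  define a where "a = m * fact r"
  have a: "a > 0" using m by (simp add: a_def)
  have rf: "real r * fact (r - 1) = fact r" using r by (simp add: fact_reduce)
  have "(\<Prod>j<r. (real d - real (vdeg F (vs ! j))) * fact (r - 1)) \<le> (\<Prod>j<r. (1 + \<theta>) * a / n)"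
  proof (rule prod_mono)
    fix j assume "j \<in> {..<r}"
    then have vj: "vs ! j < n" using nth_mem[of j vs] len vs e by (auto simp: rsets_def)
    have "(real d - real (vdeg F (vs ! j))) * fact (r - 1) \<le> (1 + \<theta>) * r * m / n * fact (r - 1)"
      using res[OF vj] by (intro mult_right_mono) auto
    also have "\<dots> = (1 + \<theta>) * a / n" unfolding a_def rf[symmetric] by simp
    finally show "0 \<le> (real d - real (vdeg F (vs ! j))) * fact (r - 1) \<and>
        (real d - real (vdeg F (vs ! j))) * fact (r - 1) \<le> (1 + \<theta>) * a / n"
      using F[OF vj] by simp
  qed
  also have "\<dots> = ((1 + \<theta>) * a / n) ^ r" by simp
  finally have prod: "(\<Prod>j<r. (real d - real (vdeg F (vs ! j))) * fact (r - 1)) \<le> ((1 + \<theta>) * a / n) ^ r" .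
  have "?A * (a ^ (r - 1) * (1 - switching_loss r n d))
     \<le> ?B * (\<Prod>j<r. (real d - real (vdeg F (vs ! j))) * fact (r - 1))"
    unfolding a_def
  proof (rule card_insert_switching[OF n M m(1)])
    fix u assume "u < n"
    have "(1 + \<theta>) * (r * m / n) \<le> 2 * (r * m / n)"
      using \<theta> m by (intro mult_right_mono) auto
    then show "real d - real (vdeg F u) \<le> 2 * r * m / n" using res[OF \<open>u < n\<close>] by simp
  qed
  also have "\<dots> \<le> ?B * ((1 + \<theta>) * a / n) ^ r" by (rule mult_left_mono[OF prod]) simp
  also have "\<dots> = ?B * ((1 + \<theta>) ^ r * a / real n ^ r) * a ^ (r - 1)"
    using r by (cases r) (simp_all add: power_mult_distrib power_divide)
  finally have "?A * (1 - switching_loss r n d) * a ^ (r - 1) \<le> ?B * ((1 + \<theta>) ^ r * a / real n ^ r) * a ^ (r - 1)"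
    by (simp add: mult_ac)
  then have 1: "?A * (1 - switching_loss r n d) \<le> ?B * ((1 + \<theta>) ^ r * a / real n ^ r)"
    by (rule mult_right_le_imp_le) (use a in simp)
  have "real (n choose r) * fact r \<le> real n ^ r"
    using binomial_fact_pow[of n r] by (metis of_nat_fact of_nat_le_iff of_nat_mult of_nat_power)
  then have 2: "real (n choose r) * (a / real n ^ r) \<le> m"
    using n m by (simp add: a_def field_simps)
  have "?A * (1 - switching_loss r n d) * (n choose r) \<le> ?B * ((1 + \<theta>) ^ r * a / real n ^ r) * (n choose r)"
    using 1 by (rule mult_right_mono) simp
  also have "\<dots> = ?B * (1 + \<theta>) ^ r * (real (n choose r) * (a / real n ^ r))" by simp
  also have "\<dots> \<le> ?B * (1 + \<theta>) ^ r * m" using 2 \<theta> by (intro mult_left_mono) auto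
  finally show ?thesis using loss by (simp add: field_simps)
qed

section \<open>Edge processes and domination\<close>

text \<open>Test functions for stochastic domination. The upper bound 1 makes an exceptional set
  cost no more than its probability.\<close>

definition increasing_on :: "'a set \<Rightarrow> ('a set \<Rightarrow> real) \<Rightarrow> bool" where
  "increasing_on E \<phi> \<longleftrightarrow> (\<forall>F F'. F \<subseteq> F' \<longrightarrow> F' \<subseteq> E \<longrightarrow> \<phi> F \<le> \<phi> F') \<and> (\<forall>F\<subseteq>E. 0 \<le> \<phi> F \<and> \<phi> F \<le> 1)"

lemma increasing_onD:
  assumes "increasing_on E \<phi>"
  shows "F \<subseteq> F' \<Longrightarrow> F' \<subseteq> E \<Longrightarrow> \<phi> F \<le> \<phi> F'" "F \<subseteq> E \<Longrightarrow> 0 \<le> \<phi> F" "F \<subseteq> E \<Longrightarrow> \<phi> F \<le> 1"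
  using assms unfolding increasing_on_def by simp_all

definition slice :: "'a set \<Rightarrow> nat \<Rightarrow> 'a set set" where
  "slice E t = {F. F \<subseteq> E \<and> card F = t}"

text \<open>The transition operator of the chain that adds a uniform element of \<open>E\<close>,
  possibly one already present. Drawing with replacement keeps the transition law the same at every
  state.\<close>

definition add_edge :: "'a set \<Rightarrow> ('a set \<Rightarrow> real) \<Rightarrow> 'a set \<Rightarrow> real" where
  "add_edge E \<phi> F = (\<Sum>e\<in>E. \<phi> (insert e F)) / card E"

definition slice_mean :: "'a set \<Rightarrow> nat \<Rightarrow> ('a set \<Rightarrow> real) \<Rightarrow> real" where
  "slice_mean E t \<phi> = (\<Sum>F\<in>slice E t. \<phi> F) / (card E choose t)"

lemma finite_slice: "finite E \<Longrightarrow> finite (slice E t)"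
  unfolding slice_def by (rule finite_subset[of _ "Pow E"]) auto

lemma slice_0: "finite E \<Longrightarrow> slice E 0 = {{}}"
  unfolding slice_def using finite_subset[of _ E] by (auto simp: card_eq_0_iff)

lemma card_slice: "finite E \<Longrightarrow> card (slice E t) = card E choose t"
  unfolding slice_def by (rule n_subsets)

text \<open>Both sides count pairs of a set of size \<open>t + 1\<close> and a marked element of it,
  weighted by \<open>a\<close>.\<close>

lemma sum_slice_Suc:
  assumes "finite E"
  shows "real (Suc t) * (\<Sum>F\<in>slice E (Suc t). a F) = (\<Sum>F\<in>slice E t. \<Sum>e\<in>E - F. a (insert e F))"
proof -
  have fin: "finite F" if "F \<subseteq> E" for F
    using that assms by (rule finite_subset)
  have "(\<Sum>F\<in>slice E t. \<Sum>e\<in>E - F. a (insert e F)) = (\<Sum>(F, e)\<in>Sigma (slice E t) (\<lambda>F. E - F). a (insert e F))"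
    using assms by (intro sum.Sigma) (auto simp: finite_slice)
  also have "\<dots> = (\<Sum>(F, e)\<in>Sigma (slice E (Suc t)) (\<lambda>F. F). a F)"
    by (rule sum.reindex_bij_witness[where j = "\<lambda>(F, e). (insert e F, e)" and i = "\<lambda>(F, e). (F - {e}, e)"])
       (auto simp: slice_def insert_absorb card_insert_if fin)
  also have "\<dots> = (\<Sum>F\<in>slice E (Suc t). \<Sum>e\<in>F. a F)"
    by (intro sum.Sigma[symmetric]) (auto simp: finite_slice assms slice_def fin)
  also have "\<dots> = (\<Sum>F\<in>slice E (Suc t). real (Suc t) * a F)"
    by (rule sum.cong) (auto simp: slice_def)
  finally show ?thesis by (simp only: sum_distrib_left)
qed

lemma binomial_step: "real (Suc t) * (n choose Suc t) = real (n choose t) * (real n - real t)"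
proof (cases "t \<le> n")
  case True
  have "Suc t * (n choose Suc t) = (n choose t) * (n - t)"
    using binomial_absorb_comp[of n t] binomial_absorption[of t n] by (simp only: mult.commute)
  then have "real (Suc t * (n choose Suc t)) = real ((n choose t) * (n - t))" by (simp only:)
  then show ?thesis using True by (simp only: of_nat_mult of_nat_diff)
next
  case False
  then show ?thesis by (simp add: binomial_eq_0)
qed

lemma increasing_add_edge:
  assumes "finite E" "E \<noteq> {}" "increasing_on E \<phi>"
  shows "increasing_on E (add_edge E \<phi>)" "F \<subseteq> E \<Longrightarrow> \<phi> F \<le> add_edge E \<phi> F"
proof -
  have c: "real (card E) > 0" using assms by (simp add: card_gt_0_iff)
  have mono: "\<phi> F \<le> \<phi> F'" if "F \<subseteq> F'" "F' \<subseteq> E" for F F' using assms that by (simp add: increasing_on_def)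
  have bd: "0 \<le> \<phi> F \<and> \<phi> F \<le> 1" if "F \<subseteq> E" for F using assms that by (simp add: increasing_on_def)
  show "\<phi> F \<le> add_edge E \<phi> F" if "F \<subseteq> E"
  proof -
    have "(\<Sum>e\<in>E. \<phi> F) \<le> (\<Sum>e\<in>E. \<phi> (insert e F))" using that by (intro sum_mono mono) auto
    then show ?thesis unfolding add_edge_def using c by (simp add: field_simps)
  qed
  show "increasing_on E (add_edge E \<phi>)" unfolding increasing_on_def
  proof (intro conjI allI impI)
    fix F F' assume "F \<subseteq> F'" "F' \<subseteq> E"
    then show "add_edge E \<phi> F \<le> add_edge E \<phi> F'" unfolding add_edge_def
      by (intro divide_right_mono sum_mono mono) auto
  next
    fix F assume F: "F \<subseteq> E"
    show "0 \<le> add_edge E \<phi> F" unfolding add_edge_def using bd F by (intro divide_nonneg_nonneg sum_nonneg) auto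
    have "(\<Sum>e\<in>E. \<phi> (insert e F)) \<le> (\<Sum>e\<in>E. 1)" using bd F by (intro sum_mono) auto
    then show "add_edge E \<phi> F \<le> 1" unfolding add_edge_def using c by simp
  qed
qed

lemma increasing_add_edges:
  assumes "finite E" "E \<noteq> {}" "increasing_on E \<phi>"
  shows "increasing_on E ((add_edge E ^^ j) \<phi>)"
  using assms by (induction j) (auto intro: increasing_add_edge)

lemma add_edges_ge:
  assumes "finite E" "E \<noteq> {}" "increasing_on E \<phi>" "F \<subseteq> E"
  shows "\<phi> F \<le> (add_edge E ^^ j) \<phi> F"
proof (induction j)
  case (Suc j)
  have "(add_edge E ^^ j) \<phi> F \<le> add_edge E ((add_edge E ^^ j) \<phi>) F"
    by (rule increasing_add_edge(2)[OF assms(1,2) increasing_add_edges[OF assms(1-3)] assms(4)])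
  with Suc show ?case by simp
qed simp

text \<open>By monotonicity, drawing an element that may already be present gains no more than
  drawing a new one, and a uniform \<open>t\<close>-set with a uniform new element is a uniform set
  of size \<open>t + 1\<close>.\<close>

lemma slice_mean_add_edge:
  assumes E: "finite E" "E \<noteq> {}" and \<phi>: "increasing_on E \<phi>" and t: "t < card E"
  shows "slice_mean E t (add_edge E \<phi>) \<le> slice_mean E (Suc t) \<phi>"
proof -
  let ?N = "real (card E)"
  have N: "?N > 0" "?N - t > 0" using t by auto
  have pt: "add_edge E \<phi> F \<le> (\<Sum>e\<in>E - F. \<phi> (insert e F)) / (?N - t)" if F: "F \<in> slice E t" for F
  proof -
    have FE: "F \<subseteq> E" "card F = t" using F by (auto simp: slice_def)
    have fin: "finite F" using finite_subset[OF FE(1) E(1)] .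
    have cd: "real (card (E - F)) = ?N - t" using FE fin E card_mono[OF E(1) FE(1)] by (simp add: card_Diff_subset)
    define S where "S = (\<Sum>e\<in>E - F. \<phi> (insert e F))"
    have "(\<Sum>e\<in>E - F. \<phi> F) \<le> S" unfolding S_def
      by (intro sum_mono increasing_onD(1)[OF \<phi>]) (use FE in auto)
    then have S: "(?N - t) * \<phi> F \<le> S" using cd by simp
    have "(\<Sum>e\<in>E. \<phi> (insert e F)) = S + (\<Sum>e\<in>F. \<phi> (insert e F))"
      unfolding S_def using sum.subset_diff[OF FE(1) E(1)] by simp
    also have "(\<Sum>e\<in>F. \<phi> (insert e F)) = (\<Sum>e\<in>F. \<phi> F)"
      by (rule sum.cong) (auto simp: insert_absorb)
    also have "\<dots> = t * \<phi> F" using FE by simp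
    finally have eq: "(\<Sum>e\<in>E. \<phi> (insert e F)) = S + t * \<phi> F" .
    have "t * ((?N - t) * \<phi> F) \<le> t * S" using S by (intro mult_left_mono) auto
    then have "(S + t * \<phi> F) * (?N - t) \<le> S * ?N" by (simp add: algebra_simps)
    then show ?thesis unfolding add_edge_def eq S_def[symmetric] using N by (simp add: field_simps)
  qed
  have "(\<Sum>F\<in>slice E t. add_edge E \<phi> F) \<le> (\<Sum>F\<in>slice E t. (\<Sum>e\<in>E - F. \<phi> (insert e F)) / (?N - t))"
    using pt by (rule sum_mono)
  also have "\<dots> = real (Suc t) * (\<Sum>F\<in>slice E (Suc t). \<phi> F) / (?N - t)"
    unfolding sum_slice_Suc[OF E(1)] sum_divide_distrib ..
  finally have *: "(\<Sum>F\<in>slice E t. add_edge E \<phi> F) * (?N - t) \<le> real (Suc t) * (\<Sum>F\<in>slice E (Suc t). \<phi> F)"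
    using N by (simp add: pos_le_divide_eq)
  have pos: "real (card E choose t) > 0" "real (card E choose Suc t) > 0" using t by auto
  have "slice_mean E t (add_edge E \<phi>) = (\<Sum>F\<in>slice E t. add_edge E \<phi> F) * (?N - t) / ((card E choose t) * (?N - t))"
    unfolding slice_mean_def using N by simp
  also have "\<dots> \<le> real (Suc t) * (\<Sum>F\<in>slice E (Suc t). \<phi> F) / ((card E choose t) * (?N - t))"
    using * N pos by (intro divide_right_mono) auto
  also have "\<dots> = slice_mean E (Suc t) \<phi>"
    unfolding slice_mean_def binomial_step[symmetric] by simp
  finally show ?thesis .
qed

lemma slice_mean_mono_fun:
  assumes "\<And>F. F \<in> slice E t \<Longrightarrow> \<phi> F \<le> \<psi> F"
  shows "slice_mean E t \<phi> \<le> slice_mean E t \<psi>"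
  unfolding slice_mean_def using assms by (intro divide_right_mono sum_mono) auto

lemma slice_mean_mono:
  assumes E: "finite E" "E \<noteq> {}" and \<phi>: "increasing_on E \<phi>" and "s \<le> t" "t \<le> card E"
  shows "slice_mean E s \<phi> \<le> slice_mean E t \<phi>"
  using assms(4,5)
proof (induction t rule: dec_induct)
  case (step t)
  have "slice_mean E t \<phi> \<le> slice_mean E t (add_edge E \<phi>)"
    by (rule slice_mean_mono_fun) (use increasing_add_edge(2)[OF E \<phi>] in \<open>auto simp: slice_def\<close>)
  also have "\<dots> \<le> slice_mean E (Suc t) \<phi>" using step by (intro slice_mean_add_edge E \<phi>) auto
  finally show ?case using step by simp
qed simp

text \<open>Draws with replacement are dominated by draws without. The induction exchanges them one
  at a time: \<open>j - i\<close> draws are made without replacement and the remaining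
  \<open>i\<close> with it.\<close>

lemma add_edges_le_slice_mean:
  assumes E: "finite E" "E \<noteq> {}" and \<phi>: "increasing_on E \<phi>" and "j \<le> card E"
  shows "(add_edge E ^^ j) \<phi> {} \<le> slice_mean E j \<phi>"
proof -
  have "slice_mean E (j - i) ((add_edge E ^^ i) \<phi>) \<le> slice_mean E j \<phi>" if "i \<le> j" for i
    using that
  proof (induction i)
    case (Suc i)
    have "slice_mean E (j - Suc i) ((add_edge E ^^ Suc i) \<phi>) \<le> slice_mean E (Suc (j - Suc i)) ((add_edge E ^^ i) \<phi>)"
      using slice_mean_add_edge[OF E increasing_add_edges[OF E \<phi>], of "j - Suc i" i] Suc assms(4) by simp
    also have "Suc (j - Suc i) = j - i" using Suc by simp
    finally show ?case using Suc by simp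
  qed simp
  from this[of j] have "slice_mean E 0 ((add_edge E ^^ j) \<phi>) \<le> slice_mean E j \<phi>" by simp
  then show ?thesis by (simp add: slice_mean_def slice_0[OF E(1)])
qed

text \<open>The process in mind lists the elements of a uniform member of \<open>R\<close> in random
  order. It is never constructed: its law after \<open>t\<close> steps is given by extension
  counts.\<close>

locale edge_process =
  fixes E :: "'a set" and R :: "'a set set" and M :: nat
  assumes E: "finite E" "E \<noteq> {}" and R: "R \<noteq> {}" "\<And>G. G \<in> R \<Longrightarrow> G \<subseteq> E" "\<And>G. G \<in> R \<Longrightarrow> card G = M"
begin

text \<open>After \<open>t\<close> steps at state \<open>F\<close>, the next element is
  \<open>e\<close> with conditional probability
  \<open>ext (insert e F) / ((M - t) * ext F)\<close>.\<close>

definition ext :: "'a set \<Rightarrow> real" where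
  "ext F = real (card {G\<in>R. F \<subseteq> G})"

text \<open>The mean of \<open>\<phi>\<close> over a uniform \<open>t\<close>-subset of a uniform member of \<open>R\<close>.\<close>
definition mean :: "nat \<Rightarrow> ('a set \<Rightarrow> real) \<Rightarrow> real" where
  "mean t \<phi> = (\<Sum>F\<in>slice E t. ext F * \<phi> F) / (card R * (M choose t))"

lemma finite_R: "finite R"
  by (rule finite_subset[of _ "Pow E"]) (use R E in auto)

lemma card_R_pos: "real (card R) > 0"
  using finite_R R by (simp add: card_gt_0_iff)

lemma sum_ext: "(\<Sum>F\<in>slice E t. ext F * \<phi> F) = (\<Sum>G\<in>R. \<Sum>F\<in>slice G t. \<phi> F)"
proof -
  have "(\<Sum>F\<in>slice E t. ext F * \<phi> F) = (\<Sum>F\<in>slice E t. \<Sum>G\<in>R. if F \<subseteq> G then \<phi> F else 0)"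
    unfolding ext_def using finite_R by (simp add: sum.If_cases Int_def)
  also have "\<dots> = (\<Sum>G\<in>R. \<Sum>F\<in>slice E t. if F \<subseteq> G then \<phi> F else 0)" by (rule sum.swap)
  also have "\<dots> = (\<Sum>G\<in>R. \<Sum>F\<in>slice G t. \<phi> F)"
  proof (rule sum.cong)
    fix G assume "G \<in> R"
    then have "slice E t \<inter> {F. F \<subseteq> G} = slice G t" using R(2) by (auto simp: slice_def)
    then show "(\<Sum>F\<in>slice E t. if F \<subseteq> G then \<phi> F else 0) = (\<Sum>F\<in>slice G t. \<phi> F)"
      using finite_slice[OF E(1)] by (simp add: sum.If_cases)
  qed simp
  finally show ?thesis .
qed

lemma mean_eq: "mean t \<phi> = (\<Sum>G\<in>R. \<Sum>F\<in>slice G t. \<phi> F) / (card R * (M choose t))"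
  unfolding mean_def sum_ext ..

lemma ext_nonneg: "ext F \<ge> 0" by (simp add: ext_def)

text \<open>The conditional probabilities of the next element sum to one: every extension of
  \<open>F\<close> has \<open>M - t\<close> elements outside \<open>F\<close>.\<close>

lemma sum_ext_insert:
  assumes F: "F \<in> slice E t"
  shows "(\<Sum>e\<in>E - F. ext (insert e F)) = (real M - t) * ext F"
proof -
  have fF: "finite F" "card F = t" using F finite_subset[OF _ E(1)] by (auto simp: slice_def)
  have "(\<Sum>e\<in>E - F. ext (insert e F)) = (\<Sum>e\<in>E - F. \<Sum>G\<in>{G\<in>R. F \<subseteq> G}. if e \<in> G then 1 else 0)"
  proof (rule sum.cong)
    fix e
    have "{G\<in>R. insert e F \<subseteq> G} = {G\<in>R. F \<subseteq> G} \<inter> {G. e \<in> G}" by auto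
    then show "ext (insert e F) = (\<Sum>G\<in>{G\<in>R. F \<subseteq> G}. if e \<in> G then 1 else 0)"
      unfolding ext_def using finite_R by (simp add: sum.If_cases)
  qed simp
  also have "\<dots> = (\<Sum>G\<in>{G\<in>R. F \<subseteq> G}. \<Sum>e\<in>E - F. if e \<in> G then 1 else 0)" by (rule sum.swap)
  also have "\<dots> = (\<Sum>G\<in>{G\<in>R. F \<subseteq> G}. real M - t)"
  proof (rule sum.cong)
    fix G assume G: "G \<in> {G\<in>R. F \<subseteq> G}"
    then have "(E - F) \<inter> {e. e \<in> G} = G - F" using R(2) by auto
    moreover have "finite G" using G R(2)[of G] finite_subset[OF _ E(1), of G] by simp
    moreover have "t \<le> card G" using card_mono[of G F] G fF \<open>finite G\<close> by auto
    ultimately show "(\<Sum>e\<in>E - F. if e \<in> G then 1 else 0) = real M - t"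
      using G fF E R(3)[of G] by (simp add: sum.If_cases card_Diff_subset)
  qed simp
  finally show ?thesis by (simp add: ext_def)
qed

lemma mean_Suc:
  assumes "t < M"
  shows "mean (Suc t) \<phi> = (\<Sum>F\<in>slice E t. \<Sum>e\<in>E - F. ext (insert e F) * \<phi> (insert e F))
     / (card R * (M choose t) * (real M - t))"
proof -
  have "mean (Suc t) \<phi> = (real (Suc t) * (\<Sum>F\<in>slice E (Suc t). ext F * \<phi> F)) /
      (card R * (real (Suc t) * (M choose Suc t)))"
    unfolding mean_def by simp
  then show ?thesis unfolding sum_slice_Suc[OF E(1)] binomial_step by (simp add: mult.assoc)
qed

text \<open>If the next edge of the process is \<open>e\<close> with probability at most \<open>1 / (h N)\<close>, a lazy step of the
  process, which advances with probability \<open>h\<close>, is dominated by adding a uniform edge.\<close>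

lemma process_step:
  assumes t: "t < M" and h: "0 \<le> h" "h \<le> 1" and \<phi>: "increasing_on E \<phi>"
    and good: "\<And>F e. F \<in> slice E t \<Longrightarrow> F \<notin> Bad \<Longrightarrow> e \<in> E - F \<Longrightarrow>
       h * ext (insert e F) * card E \<le> (real M - t) * ext F"
  shows "(1 - h) * mean t \<phi> + h * mean (Suc t) \<phi> \<le> mean t (add_edge E \<phi>) + mean t (indicator Bad)"
proof -
  have N: "real (card E) > 0" using E by (simp add: card_gt_0_iff)
  have Mt: "real M - t > 0" using t by simp
  define D where "D = real (card R) * (M choose t)"
  have D: "D > 0" unfolding D_def using card_R_pos t by simp
  have pt: "(1 - h) * (ext F * \<phi> F) + h * ((\<Sum>e\<in>E - F. ext (insert e F) * \<phi> (insert e F)) / (real M - t))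
      \<le> ext F * add_edge E \<phi> F + ext F * indicator Bad F" if F: "F \<in> slice E t" for F
  proof (cases "F \<in> Bad")
    case True
    have FE: "F \<subseteq> E" using F by (simp add: slice_def)
    \<comment> \<open>At a bad state nothing is known about the next element;
      \<open>\<phi> \<le> 1\<close> bounds the whole contribution by \<open>ext F\<close>, which the
      indicator pays for.\<close>
    have "(\<Sum>e\<in>E - F. ext (insert e F) * \<phi> (insert e F)) \<le> (\<Sum>e\<in>E - F. ext (insert e F) * 1)"
      by (intro sum_mono mult_left_mono ext_nonneg increasing_onD(3)[OF \<phi>]) (use FE in auto)
    also have "\<dots> = (real M - t) * ext F" using sum_ext_insert[OF F] by simp
    finally have "(\<Sum>e\<in>E - F. ext (insert e F) * \<phi> (insert e F)) / (real M - t) \<le> ext F"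
      using Mt by (simp add: field_simps)
    moreover have "ext F * \<phi> F \<le> ext F * 1"
      by (intro mult_left_mono ext_nonneg increasing_onD(3)[OF \<phi> FE])
    ultimately have "(1 - h) * (ext F * \<phi> F) + h * ((\<Sum>e\<in>E - F. ext (insert e F) * \<phi> (insert e F)) / (real M - t))
        \<le> (1 - h) * ext F + h * ext F" using h by (intro add_mono mult_left_mono) auto
    also have "\<dots> = ext F" by (simp add: algebra_simps)
    also have "\<dots> \<le> ext F * add_edge E \<phi> F + ext F * indicator Bad F"
    proof -
      have "0 \<le> add_edge E \<phi> F" by (rule increasing_onD(2)[OF increasing_add_edge(1)[OF E \<phi>] FE])
      then show ?thesis using True ext_nonneg[of F] by simp
    qed
    finally show ?thesis .
  next
    case False
    have FE: "F \<subseteq> E" using F by (simp add: slice_def)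
    \<comment> \<open>Passing to increments, which are nonnegative, permits replacing each
      transition probability by its upper bound and enlarging the range of summation from
      \<open>E - F\<close> to \<open>E\<close>.\<close>
    define \<Delta> where "\<Delta> e = \<phi> (insert e F) - \<phi> F" for e
    have \<Delta>: "\<Delta> e \<ge> 0" if "e \<in> E" for e
      using increasing_onD(1)[OF \<phi>, of F "insert e F"] FE that by (auto simp: \<Delta>_def)
    have "(\<Sum>e\<in>E - F. ext (insert e F) * \<phi> (insert e F)) =
       (\<Sum>e\<in>E - F. ext (insert e F)) * \<phi> F + (\<Sum>e\<in>E - F. ext (insert e F) * \<Delta> e)"
      unfolding \<Delta>_def sum_distrib_right sum.distrib[symmetric] by (simp add: algebra_simps)
    then have 1: "(\<Sum>e\<in>E - F. ext (insert e F) * \<phi> (insert e F)) / (real M - t) =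
       ext F * \<phi> F + (\<Sum>e\<in>E - F. ext (insert e F) * \<Delta> e / (real M - t))"
      unfolding sum_ext_insert[OF F] using Mt by (simp add: add_divide_distrib sum_divide_distrib)
    have 2: "add_edge E \<phi> F = \<phi> F + (\<Sum>e\<in>E. \<Delta> e / card E)"
      unfolding add_edge_def \<Delta>_def sum_divide_distrib[symmetric] using N by (simp add: sum_subtractf field_simps)
    have "h * (\<Sum>e\<in>E - F. ext (insert e F) * \<Delta> e / (real M - t))
       = (\<Sum>e\<in>E - F. (h * ext (insert e F) / (real M - t)) * \<Delta> e)"
      unfolding sum_distrib_left by (intro sum.cong) (simp_all add: mult.assoc)
    also have "\<dots> \<le> (\<Sum>e\<in>E - F. (ext F / card E) * \<Delta> e)"
    proof (intro sum_mono mult_right_mono)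
      fix e assume e: "e \<in> E - F"
      show "h * ext (insert e F) / (real M - t) \<le> ext F / card E"
        using good[OF F False e] N Mt by (simp add: field_simps)
      show "0 \<le> \<Delta> e" using \<Delta> e by simp
    qed
    also have "\<dots> \<le> (\<Sum>e\<in>E. (ext F / card E) * \<Delta> e)"
      by (rule sum_mono2) (use E \<Delta> ext_nonneg[of F] in auto)
    also have "\<dots> = ext F * (\<Sum>e\<in>E. \<Delta> e / card E)" by (simp add: sum_distrib_left)
    finally have "h * (\<Sum>e\<in>E - F. ext (insert e F) * \<Delta> e / (real M - t)) \<le> ext F * (\<Sum>e\<in>E. \<Delta> e / card E)" .
    then show ?thesis unfolding 1 2 using False by (simp add: algebra_simps)
  qed
  define S1 where "S1 = (\<Sum>F\<in>slice E t. ext F * \<phi> F)"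
  define S2 where "S2 = (\<Sum>F\<in>slice E t. \<Sum>e\<in>E - F. ext (insert e F) * \<phi> (insert e F))"
  have means: "mean t \<phi> = S1 / D" "mean (Suc t) \<phi> = S2 / (real M - t) / D"
    unfolding mean_Suc[OF t] unfolding mean_def D_def S1_def S2_def by (simp_all add: mult_ac)
  have "(1 - h) * mean t \<phi> + h * mean (Suc t) \<phi> =
     (\<Sum>F\<in>slice E t. (1 - h) * (ext F * \<phi> F)
        + h * ((\<Sum>e\<in>E - F. ext (insert e F) * \<phi> (insert e F)) / (real M - t))) / D"
    unfolding means sum.distrib sum_distrib_left[symmetric] sum_divide_distrib[symmetric]
      S1_def[symmetric] S2_def[symmetric] by (simp add: add_divide_distrib)
  also have "\<dots> \<le> (\<Sum>F\<in>slice E t. ext F * add_edge E \<phi> F + ext F * indicator Bad F) / D"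
    using D by (intro divide_right_mono sum_mono pt) auto
  also have "\<dots> = mean t (add_edge E \<phi>) + mean t (indicator Bad)"
    unfolding mean_def D_def by (simp add: sum.distrib add_divide_distrib)
  finally show ?thesis .
qed

lemma mean_mono:
  assumes "\<And>F. F \<in> slice E t \<Longrightarrow> \<phi> F \<le> \<psi> F"
  shows "mean t \<phi> \<le> mean t \<psi>"
  unfolding mean_def using assms ext_nonneg by (intro divide_right_mono sum_mono mult_left_mono) auto

lemma mean_nonneg:
  assumes "\<And>F. F \<in> slice E t \<Longrightarrow> 0 \<le> \<phi> F"
  shows "0 \<le> mean t \<phi>"
  unfolding mean_def using assms ext_nonneg by (intro divide_nonneg_nonneg sum_nonneg mult_nonneg_nonneg) auto

lemma mean_0: "mean 0 \<phi> = \<phi> {}"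
  using card_R_pos by (simp add: mean_def ext_def slice_0[OF E(1)])

text \<open>The factor \<open>1 - c ^ L * b ^ T\<close> is a Chernoff bound for the event that \<open>L\<close> lazy steps
  make the process advance at least \<open>T\<close> times.\<close>

theorem process_domination:
  assumes T: "T \<le> M" and h: "0 \<le> h" "h \<le> 1" and \<phi>: "increasing_on E \<phi>"
    and b: "b \<ge> 1" and c: "c = 1 - h + h / b" and err: "err \<ge> 0"
    and good: "\<And>t F e. t < T \<Longrightarrow> F \<in> slice E t \<Longrightarrow> F \<notin> Bad t \<Longrightarrow> e \<in> E - F \<Longrightarrow>
       h * ext (insert e F) * card E \<le> (real M - t) * ext F"
    and bad: "\<And>t. t < T \<Longrightarrow> mean t (indicator (Bad t)) \<le> err"
    and L: "L \<le> card E"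
  shows "mean T \<phi> * (1 - c ^ L * b ^ T) \<le> slice_mean E L \<phi> + L * err"
proof -
  define A where "A t j = mean t ((add_edge E ^^ j) \<phi>)" for t j
  define a where "a = mean T \<phi>"
  have inc: "increasing_on E ((add_edge E ^^ j) \<phi>)" for j by (rule increasing_add_edges[OF E \<phi>])
  have nn: "0 \<le> A t j" for t j unfolding A_def
    by (intro mean_nonneg increasing_onD(2)[OF inc]) (simp add: slice_def)
  have a: "0 \<le> a" using nn[of T 0] by (simp add: a_def A_def)
  have aT: "a \<le> A T j" for j unfolding a_def A_def
    by (rule mean_mono) (use add_edges_ge[OF E \<phi>] in \<open>auto simp: slice_def\<close>)
  have c0: "c \<ge> 0" unfolding c using h b by simp
  \<comment> \<open>\<open>A t j\<close> runs the process to time \<open>t\<close> and then adds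
    \<open>j\<close> uniform edges. The factor solves the recursion of a lazy step exactly, since
    \<open>(1 - h) * b ^ s + h * b ^ (s - 1) = c * b ^ s\<close> for \<open>s > 0\<close>. At
    \<open>j = 0\<close> it is at most 0 because \<open>b \<ge> 1\<close>; at \<open>t = T\<close>
    the target is reached and further edges only increase the mean.\<close>
  have main: "a * (1 - c ^ j * b ^ (T - t)) \<le> A t j + j * err" if "t \<le> T" for t j
    using that
  proof (induction j arbitrary: t)
    case 0
    have "1 \<le> b ^ (T - t)" using b by simp
    then have "a * (1 - c ^ 0 * b ^ (T - t)) \<le> 0" using a by (intro mult_nonneg_nonpos) auto
    then show ?case using nn[of t 0] by simp
  next
    case (Suc j)
    show ?case
    proof (cases "t = T")
      case True
      have "a * (1 - c ^ Suc j * b ^ (T - t)) \<le> a * 1"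
        using a c0 True by (intro mult_left_mono) auto
      also have "\<dots> \<le> A t (Suc j) + Suc j * err" using aT[of "Suc j"] True err by (simp add: add_increasing2)
      finally show ?thesis .
    next
      case False
      then have t: "t < T" using Suc by simp
      have "(1 - h) * A t j + h * A (Suc t) j \<le> A t (Suc j) + err"
      proof -
        have "(1 - h) * A t j + h * A (Suc t) j \<le> mean t (add_edge E ((add_edge E ^^ j) \<phi>)) + mean t (indicator (Bad t))"
          unfolding A_def by (rule process_step) (use t T h inc good in auto)
        then show ?thesis using bad[OF t] by (simp add: A_def)
      qed
      moreover have "(1 - h) * (a * (1 - c ^ j * b ^ (T - t))) \<le> (1 - h) * (A t j + j * err)"
        using Suc.IH[of t] Suc.prems h by (intro mult_left_mono) auto
      moreover have "h * (a * (1 - c ^ j * b ^ (T - Suc t))) \<le> h * (A (Suc t) j + j * err)"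
        using Suc.IH[of "Suc t"] t h by (intro mult_left_mono) auto
      moreover have "(1 - h) * (a * (1 - c ^ j * b ^ (T - t))) + h * (a * (1 - c ^ j * b ^ (T - Suc t)))
         = a * (1 - c ^ Suc j * b ^ (T - t))"
      proof -
        have "T - t = Suc (T - Suc t)" using t by simp
        then have bb: "b ^ (T - t) = b * b ^ (T - Suc t)" by simp
        show ?thesis unfolding bb c using b by (simp add: field_simps)
      qed
      ultimately show ?thesis by (simp add: algebra_simps)
    qed
  qed
  have "a * (1 - c ^ L * b ^ T) \<le> A 0 L + L * err" using main[of 0 L] by simp
  also have "A 0 L \<le> slice_mean E L \<phi>" unfolding A_def mean_0
    by (rule add_edges_le_slice_mean[OF E \<phi> L])
  finally show ?thesis by (simp add: a_def)
qed

end

section \<open>Degrees in random subgraphs\<close>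

lemma sum_Pow_power_card:
  fixes x :: real
  assumes "finite B"
  shows "(\<Sum>I\<in>Pow B. x ^ card I) = (1 + x) ^ card B"
  using prod_add[OF assms, of "\<lambda>_. x" "\<lambda>_. 1"] by (simp add: add.commute)

lemma binomial_pred_ratio:
  assumes "i < s" "s \<le> M"
  shows "real ((M - Suc i) choose (s - Suc i)) = real ((M - i) choose (s - i)) * ((real s - i) / (real M - i))"
proof -
  have 1: "M - i = Suc (M - Suc i)" "s - i = Suc (s - Suc i)" using assms by auto
  have "(s - i) * ((M - i) choose (s - i)) = (M - i) * ((M - Suc i) choose (s - Suc i))"
    unfolding 1 using Suc_times_binomial_eq[of "M - Suc i" "s - Suc i"] by (simp add: mult.commute)
  then have "real ((s - i) * ((M - i) choose (s - i))) = real ((M - i) * ((M - Suc i) choose (s - Suc i)))"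
    by (simp only:)
  then show ?thesis using assms by (simp add: of_nat_diff field_simps)
qed

text \<open>The quotient is the probability that a uniform \<open>s\<close>-subset of an
  \<open>M\<close>-set contains a given \<open>i\<close>-set. It is a product of factors
  \<open>(s - j) / (M - j)\<close>, each at most \<open>s / M\<close>.\<close>

lemma binomial_ratio_le:
  assumes "i \<le> s" "s \<le> M"
  shows "real ((M - i) choose (s - i)) \<le> (M choose s) * (real s / M) ^ i"
  using assms
proof (induction i)
  case (Suc i)
  have M: "M > 0" using Suc by simp
  have "real ((M - Suc i) choose (s - Suc i)) = real ((M - i) choose (s - i)) * ((real s - i) / (real M - i))"
    using Suc by (intro binomial_pred_ratio) auto
  also have "\<dots> \<le> real ((M - i) choose (s - i)) * (real s / M)"
  proof (rule mult_left_mono)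
    have "i * real s \<le> i * real M" using Suc by (intro mult_left_mono) auto
    then show "(real s - i) / (real M - i) \<le> real s / M" using Suc M by (simp add: field_simps)
  qed simp
  also have "\<dots> \<le> (M choose s) * (real s / M) ^ i * (real s / M)"
    using Suc by (intro mult_right_mono) auto
  finally show ?case by (simp add: mult_ac)
qed simp

text \<open>The same factors \<open>(s - j) / (M - j)\<close> with \<open>j < k\<close> are at least
  \<open>(s - k) / M\<close>.\<close>

lemma binomial_ratio_ge:
  assumes "i \<le> k" "k \<le> s" "s \<le> M"
  shows "(M choose s) * ((real s - k) / M) ^ i \<le> real ((M - i) choose (s - i))"
  using assms
proof (induction i)
  case (Suc i)
  have "(M choose s) * ((real s - k) / M) ^ Suc i = (M choose s) * ((real s - k) / M) ^ i * ((real s - k) / M)"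
    by simp
  also have "\<dots> \<le> real ((M - i) choose (s - i)) * ((real s - i) / (real M - i))"
  proof (rule mult_mono)
    show "(M choose s) * ((real s - k) / M) ^ i \<le> real ((M - i) choose (s - i))" using Suc by simp
    show "(real s - k) / M \<le> (real s - i) / (real M - i)" using Suc by (intro frac_le) auto
  qed (use Suc in auto)
  also have "\<dots> = real ((M - Suc i) choose (s - Suc i))"
    using Suc by (intro binomial_pred_ratio[symmetric]) auto
  finally show ?case .
qed simp

lemma card_slice_superset:
  assumes G: "finite G" "card G = M" and I: "I \<subseteq> G" and Is: "card I \<le> s"
  shows "card {S \<in> slice G s. I \<subseteq> S} = (M - card I) choose (s - card I)"
proof -
  have fI: "finite I" using I G(1) by (rule finite_subset)
  have "bij_betw (\<lambda>S. S - I) {S \<in> slice G s. I \<subseteq> S} (slice (G - I) (s - card I))"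
  proof (rule bij_betw_byWitness[where f' = "\<lambda>S. S \<union> I"])
    show "(\<lambda>S. S - I) ` {S \<in> slice G s. I \<subseteq> S} \<subseteq> slice (G - I) (s - card I)"
      using fI by (auto simp: slice_def card_Diff_subset)
    show "(\<lambda>S. S \<union> I) ` slice (G - I) (s - card I) \<subseteq> {S \<in> slice G s. I \<subseteq> S}"
    proof (intro image_subsetI)
      fix S assume S: "S \<in> slice (G - I) (s - card I)"
      then have "finite S" using finite_subset[of S G] G by (auto simp: slice_def)
      then have "card (S \<union> I) = card S + card I" using S fI by (intro card_Un_disjoint) (auto simp: slice_def)
      then show "S \<union> I \<in> {S \<in> slice G s. I \<subseteq> S}" using S I Is by (auto simp: slice_def)
    qed
  qed (auto simp: slice_def)
  then have "card {S \<in> slice G s. I \<subseteq> S} = card (slice (G - I) (s - card I))" by (rule bij_betw_same_card)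
  also have "\<dots> = (M - card I) choose (s - card I)"
    using G fI I by (subst card_slice) (auto simp: card_Diff_subset)
  finally show ?thesis .
qed

lemma card_slice_superset_le:
  assumes G: "finite G" "card G = M" and I: "I \<subseteq> G" and s: "s \<le> M"
  shows "real (card {S \<in> slice G s. I \<subseteq> S}) \<le> (M choose s) * (real s / M) ^ card I"
proof (cases "card I \<le> s")
  case True
  show ?thesis using card_slice_superset[OF G I True] binomial_ratio_le[OF True s] by simp
next
  case False
  have none: "{S \<in> slice G s. I \<subseteq> S} = {}"
  proof (rule ccontr)
    assume "\<not> ?thesis"
    then obtain S where S: "S \<in> slice G s" "I \<subseteq> S" by blast
    then have "card I \<le> card S" using G(1) finite_subset[of S G] by (intro card_mono) (auto simp: slice_def)
    then show False using S False by (simp add: slice_def)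
  qed
  show ?thesis unfolding none by simp
qed

text \<open>Expanding \<open>(1 + x) ^ card (S \<inter> A)\<close> over subsets of
  \<open>S \<inter> A\<close> reduces the generating function to inclusion probabilities, and these
  are no larger without replacement than for independent draws. So the binomial bound holds for the
  hypergeometric law.\<close>

lemma hypergeometric_mgf_le:
  fixes x :: real
  assumes G: "finite G" "card G = M" and A: "A \<subseteq> G" and s: "s \<le> M" and x: "x \<ge> 0"
  shows "(\<Sum>S\<in>slice G s. (1 + x) ^ card (S \<inter> A)) \<le> (M choose s) * (1 + x * (real s / M)) ^ card A"
proof -
  have fA: "finite A" using A G(1) by (rule finite_subset)
  have "(\<Sum>S\<in>slice G s. (1 + x) ^ card (S \<inter> A)) = (\<Sum>S\<in>slice G s. \<Sum>I\<in>Pow (S \<inter> A). x ^ card I)"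
    by (intro sum.cong refl sum_Pow_power_card[symmetric]) (simp add: fA)
  also have "\<dots> = (\<Sum>S\<in>slice G s. \<Sum>I\<in>Pow A. if I \<subseteq> S then x ^ card I else 0)"
  proof (rule sum.cong)
    fix S
    have "Pow A \<inter> {I. I \<subseteq> S} = Pow (S \<inter> A)" by auto
    then show "(\<Sum>I\<in>Pow (S \<inter> A). x ^ card I) = (\<Sum>I\<in>Pow A. if I \<subseteq> S then x ^ card I else 0)"
      using fA by (simp add: sum.If_cases)
  qed simp
  also have "\<dots> = (\<Sum>I\<in>Pow A. \<Sum>S\<in>slice G s. if I \<subseteq> S then x ^ card I else 0)" by (rule sum.swap)
  also have "\<dots> = (\<Sum>I\<in>Pow A. card {S \<in> slice G s. I \<subseteq> S} * x ^ card I)"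
    using finite_slice[OF G(1)] by (simp add: sum.If_cases Int_def)
  also have "\<dots> \<le> (\<Sum>I\<in>Pow A. (M choose s) * (x * (real s / M)) ^ card I)"
  proof (rule sum_mono)
    fix I assume "I \<in> Pow A"
    then have "I \<subseteq> G" using A by auto
    then have "card {S \<in> slice G s. I \<subseteq> S} * x ^ card I \<le> (M choose s) * (real s / M) ^ card I * x ^ card I"
      using card_slice_superset_le[OF G _ s] x by (intro mult_right_mono) auto
    then show "card {S \<in> slice G s. I \<subseteq> S} * x ^ card I \<le> (M choose s) * (x * (real s / M)) ^ card I"
      unfolding power_mult_distrib by (simp only: mult_ac)
  qed
  also have "\<dots> = (M choose s) * (1 + x * (real s / M)) ^ card A"
    unfolding sum_distrib_left[symmetric] sum_Pow_power_card[OF fA] ..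
  finally show ?thesis .
qed

lemma hypergeometric_tail:
  fixes \<theta> \<mu> :: real
  assumes G: "finite G" "card G = M" and A: "A \<subseteq> G" and t: "t \<le> M" and \<theta>: "0 \<le> \<theta>" "\<theta> \<le> 1"
    and \<mu>: "\<mu> = card A * (real (M - t) / M)"
  shows "real (card {F \<in> slice G t. (1 + \<theta>) * \<mu> < card ((G - F) \<inter> A)}) \<le> (M choose t) * exp (- (\<theta>\<^sup>2 * \<mu> / 8))"
proof -
  define s where "s = M - t"
  \<comment> \<open>This minimises \<open>2 * x\<^sup>2 - x * \<theta>\<close>, the bound found
    below for the exponent per unit of \<open>\<mu>\<close>, with value
    \<open>- \<theta>\<^sup>2 / 8\<close>.\<close>
  define x where "x = \<theta> / 4"
  have x: "0 \<le> x" "x \<le> 1" using \<theta> by (auto simp: x_def)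
  have \<mu>0: "\<mu> \<ge> 0" unfolding \<mu> by simp
  let ?B = "{F \<in> slice G t. (1 + \<theta>) * \<mu> < card ((G - F) \<inter> A)}"
  have fB: "finite ?B" using finite_slice[OF G(1)] by simp
  have "(x - x\<^sup>2) * ((1 + \<theta>) * \<mu>) \<le> ln (1 + x) * ((1 + \<theta>) * \<mu>)"
    using ln_one_plus_pos_lower_bound[OF x] \<mu>0 \<theta> by (intro mult_right_mono) auto
  then have low: "exp ((x - x\<^sup>2) * ((1 + \<theta>) * \<mu>)) \<le> (1 + x) ^ card ((G - F) \<inter> A)" if "F \<in> ?B" for F
  proof -
    have "ln (1 + x) * ((1 + \<theta>) * \<mu>) \<le> ln (1 + x) * card ((G - F) \<inter> A)"
      using that x by (intro mult_left_mono) auto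
    then have "(x - x\<^sup>2) * ((1 + \<theta>) * \<mu>) \<le> card ((G - F) \<inter> A) * ln (1 + x)"
      using \<open>(x - x\<^sup>2) * ((1 + \<theta>) * \<mu>) \<le> ln (1 + x) * ((1 + \<theta>) * \<mu>)\<close> by (simp add: mult.commute)
    then have "exp ((x - x\<^sup>2) * ((1 + \<theta>) * \<mu>)) \<le> exp (card ((G - F) \<inter> A) * ln (1 + x))" by simp
    also have "\<dots> = (1 + x) ^ card ((G - F) \<inter> A)" using x by (simp add: exp_of_nat_mult)
    finally show ?thesis .
  qed
  have "card ?B * exp ((x - x\<^sup>2) * ((1 + \<theta>) * \<mu>)) = (\<Sum>F\<in>?B. exp ((x - x\<^sup>2) * ((1 + \<theta>) * \<mu>)))" by simp
  also have "\<dots> \<le> (\<Sum>F\<in>?B. (1 + x) ^ card ((G - F) \<inter> A))" using low by (rule sum_mono)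
  also have "\<dots> \<le> (\<Sum>F\<in>slice G t. (1 + x) ^ card ((G - F) \<inter> A))"
    using x finite_slice[OF G(1)] by (intro sum_mono2) auto
  \<comment> \<open>The complement in \<open>G\<close> of a uniform \<open>t\<close>-subset is a
    uniform subset of size \<open>M - t\<close>.\<close>
  also have "\<dots> = (\<Sum>S\<in>slice G s. (1 + x) ^ card (S \<inter> A))"
  proof (rule sum.reindex_bij_witness[where i = "\<lambda>S. G - S" and j = "\<lambda>F. G - F"])
    have c: "card (G - S) = M - card S" if "S \<subseteq> G" for S
      using that G finite_subset[OF that] by (simp add: card_Diff_subset)
    show "G - F \<in> slice G s" if "F \<in> slice G t" for F using that c by (auto simp: slice_def s_def)
    show "G - F \<in> slice G t" if "F \<in> slice G s" for F using that c t by (auto simp: slice_def s_def)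
  qed (auto simp: slice_def double_diff)
  also have "\<dots> \<le> (M choose s) * (1 + x * (real s / M)) ^ card A"
    by (rule hypergeometric_mgf_le[OF G A]) (use x in \<open>auto simp: s_def\<close>)
  also have "\<dots> \<le> (M choose s) * exp (x * \<mu>)"
  proof (rule mult_left_mono)
    have "(1 + x * (real s / M)) ^ card A \<le> exp (x * (real s / M)) ^ card A"
      using x by (intro power_mono exp_ge_add_one_self) auto
    also have "\<dots> = exp (x * \<mu>)" by (simp add: \<mu> s_def exp_of_nat_mult[symmetric] mult_ac)
    finally show "(1 + x * (real s / M)) ^ card A \<le> exp (x * \<mu>)" .
  qed simp
  finally have "card ?B * exp ((x - x\<^sup>2) * ((1 + \<theta>) * \<mu>)) \<le> (M choose s) * exp (x * \<mu>)" .
  then have "card ?B \<le> (M choose s) * (exp (x * \<mu>) / exp ((x - x\<^sup>2) * ((1 + \<theta>) * \<mu>)))"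
    by (simp add: pos_le_divide_eq)
  also have "exp (x * \<mu>) / exp ((x - x\<^sup>2) * ((1 + \<theta>) * \<mu>)) = exp (\<mu> * (x - (x - x\<^sup>2) * (1 + \<theta>)))"
    by (simp add: exp_diff[symmetric] algebra_simps)
  also have "\<dots> \<le> exp (- (\<theta>\<^sup>2 * \<mu> / 8))"
  proof -
    have "x - (x - x\<^sup>2) * (1 + \<theta>) = x\<^sup>2 * (1 + \<theta>) - x * \<theta>" by (simp add: algebra_simps)
    also have "\<dots> \<le> x\<^sup>2 * 2 - x * \<theta>" using \<theta> by (intro diff_right_mono mult_left_mono) auto
    also have "\<dots> = - (\<theta>\<^sup>2 / 8)" by (simp add: x_def power2_eq_square)
    finally have "\<mu> * (x - (x - x\<^sup>2) * (1 + \<theta>)) \<le> \<mu> * (- (\<theta>\<^sup>2 / 8))" using \<mu>0 by (rule mult_left_mono)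
    then show ?thesis by (simp add: mult_ac)
  qed
  finally have "card ?B \<le> (M choose s) * exp (- (\<theta>\<^sup>2 * \<mu> / 8))" by (simp add: mult_left_mono)
  then show ?thesis using binomial_symmetric[OF t] by (simp add: s_def)
qed

section \<open>Copies surviving in a random subgraph\<close>

definition ncopies :: "'a set set \<Rightarrow> 'a set \<Rightarrow> nat" where
  "ncopies \<C> G = card {F\<in>\<C>. F \<subseteq> G}"

lemma ncopies_mono: "finite \<C> \<Longrightarrow> F \<subseteq> G \<Longrightarrow> ncopies \<C> F \<le> ncopies \<C> G"
  unfolding ncopies_def by (rule card_mono) auto

lemma increasing_ncopies: "finite \<C> \<Longrightarrow> increasing_on E (indicator {S. y < real (ncopies \<C> S)})"
proof -
  assume fin: "finite \<C>"
  have "y < real (ncopies \<C> F')" if "F \<subseteq> F'" "y < real (ncopies \<C> F)" for F F'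
    using ncopies_mono[OF fin that(1)] that(2) by simp
  then show ?thesis unfolding increasing_on_def indicator_def by simp
qed

lemma card_slice_avoiding:
  assumes G: "finite G" "card G = M" and e: "e \<in> G"
  shows "real (card {S \<in> slice G T. e \<notin> S}) * M = (M choose T) * (real M - T)"
proof -
  have "{S \<in> slice G T. e \<notin> S} = slice (G - {e}) T" by (auto simp: slice_def)
  then have c: "card {S \<in> slice G T. e \<notin> S} = (M - 1) choose T"
    using G e by (simp add: card_slice)
  show ?thesis
  proof (cases "T \<le> M")
    case True
    have "M * ((M - 1) choose T) = (M choose T) * (M - T)"
      using binomial_absorb_comp[of M T] by (simp add: mult.commute)
    then have "real (M * ((M - 1) choose T)) = real ((M choose T) * (M - T))" by (simp only:)
    then show ?thesis unfolding c using True by (simp add: of_nat_diff mult.commute)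
  next
    case False
    then show ?thesis unfolding c by (simp add: binomial_eq_0)
  qed
qed

text \<open>Markov's inequality for the number of destroyed copies. A copy is destroyed only if one
  of its \<open>k\<close> edges is left out, and each edge is left out with probability
  \<open>(M - T) / M\<close>, so linearity and a union bound over the edges give the
  expectation.\<close>

lemma card_sparse_loss:
  fixes x :: real
  assumes G: "finite G" "card G = M" "M > 0" and \<C>: "finite \<C>" "\<And>F. F \<in> \<C> \<Longrightarrow> card F = k"
    and x: "x \<ge> 0" and T: "T \<le> M"
  shows "real (card {S \<in> slice G T. real (ncopies \<C> S) < (1 - x) * ncopies \<C> G}) * x
    \<le> k * ((real M - T) / M) * (M choose T)"
proof (cases "ncopies \<C> G = 0")
  case True
  have "{S \<in> slice G T. real (ncopies \<C> S) < (1 - x) * ncopies \<C> G} = {}" using True by auto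
  then have "card {S \<in> slice G T. real (ncopies \<C> S) < (1 - x) * ncopies \<C> G} = 0" by (simp only: card.empty)
  then show ?thesis using T by simp
next
  case False
  define X where "X = real (ncopies \<C> G)"
  have X: "X > 0" using False by (simp add: X_def)
  let ?D = "{F\<in>\<C>. F \<subseteq> G}"
  let ?B = "{S \<in> slice G T. real (ncopies \<C> S) < (1 - x) * ncopies \<C> G}"
  have fs: "finite (slice G T)" using finite_slice[OF G(1)] .
  have "X - ncopies \<C> S = (\<Sum>F\<in>?D. if F \<subseteq> S then 0 else 1)" if "S \<in> slice G T" for S
  proof -
    have "{F\<in>\<C>. F \<subseteq> S} = ?D \<inter> {F. F \<subseteq> S}" using that by (auto simp: slice_def)
    then have "real (ncopies \<C> S) = (\<Sum>F\<in>?D. if F \<subseteq> S then 1 else 0)"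
      unfolding ncopies_def using \<C>(1) by (simp add: sum.If_cases)
    moreover have "X = (\<Sum>F\<in>?D. 1)" by (simp add: X_def ncopies_def)
    ultimately have "X - ncopies \<C> S = (\<Sum>F\<in>?D. 1 - (if F \<subseteq> S then 1 else 0))"
      by (simp only: sum_subtractf)
    also have "\<dots> = (\<Sum>F\<in>?D. if F \<subseteq> S then 0 else 1)" by (rule sum.cong) auto
    finally show ?thesis .
  qed
  then have "(\<Sum>S\<in>slice G T. X - ncopies \<C> S) = (\<Sum>S\<in>slice G T. \<Sum>F\<in>?D. if F \<subseteq> S then 0 else 1)"
    by (rule sum.cong[OF refl])
  also have "\<dots> = (\<Sum>F\<in>?D. \<Sum>S\<in>slice G T. if F \<subseteq> S then 0 else 1)" by (rule sum.swap)
  also have "\<dots> \<le> (\<Sum>F\<in>?D. k * ((real M - T) / M) * (M choose T))"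
  proof (rule sum_mono)
    fix F assume F: "F \<in> ?D"
    have fF: "finite F" using F G(1) finite_subset by auto
    have "(\<Sum>S\<in>slice G T. if F \<subseteq> S then 0 else (1::real)) \<le> (\<Sum>S\<in>slice G T. \<Sum>e\<in>F. if e \<notin> S then 1 else 0)"
    proof (rule sum_mono)
      fix S
      show "(if F \<subseteq> S then 0 else (1::real)) \<le> (\<Sum>e\<in>F. if e \<notin> S then 1 else 0)"
      proof (cases "F \<subseteq> S")
        case True
        have "(\<Sum>e\<in>F. if e \<notin> S then 1 else (0::real)) \<ge> 0" by (rule sum_nonneg) auto
        then show ?thesis using True by simp
      next
        case False
        then obtain e where e: "e \<in> F" "e \<notin> S" by auto
        have "(if e \<notin> S then 1 else (0::real)) \<le> (\<Sum>e\<in>F. if e \<notin> S then 1 else 0)"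
          by (rule member_le_sum[OF e(1)]) (use fF in auto)
        then show ?thesis using e False by simp
      qed
    qed
    also have "\<dots> = (\<Sum>e\<in>F. \<Sum>S\<in>slice G T. if e \<notin> S then 1 else 0)" by (rule sum.swap)
    also have "\<dots> = (\<Sum>e\<in>F. ((real M - T) / M) * (M choose T))"
    proof (rule sum.cong)
      fix e assume "e \<in> F"
      then have e: "e \<in> G" using F by auto
      have "(\<Sum>S\<in>slice G T. if e \<notin> S then 1 else 0) = real (card {S \<in> slice G T. e \<notin> S})"
        using fs by (simp add: sum.If_cases Int_def)
      also have "\<dots> = ((real M - T) / M) * (M choose T)"
        using card_slice_avoiding[OF G(1,2) e, of T] G(3) by (simp add: field_simps)
      finally show "(\<Sum>S\<in>slice G T. if e \<notin> S then 1 else 0) = ((real M - T) / M) * (M choose T)" .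
    qed simp
    also have "\<dots> = k * ((real M - T) / M) * (M choose T)" using \<C>(2) F by simp
    finally show "(\<Sum>S\<in>slice G T. if F \<subseteq> S then 0 else (1::real)) \<le> k * ((real M - T) / M) * (M choose T)" .
  qed
  also have "\<dots> = X * (k * ((real M - T) / M) * (M choose T))" by (simp add: X_def ncopies_def)
  finally have 1: "(\<Sum>S\<in>slice G T. X - ncopies \<C> S) \<le> X * (k * ((real M - T) / M) * (M choose T))" .
  have "card ?B * x * X = (\<Sum>S\<in>?B. x * X)" by simp
  also have "\<dots> \<le> (\<Sum>S\<in>?B. X - ncopies \<C> S)"
    by (rule sum_mono) (auto simp: X_def algebra_simps)
  also have "\<dots> \<le> (\<Sum>S\<in>slice G T. X - ncopies \<C> S)"
    using fs ncopies_mono[OF \<C>(1)] by (intro sum_mono2) (auto simp: X_def slice_def)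
  also note 1
  finally have "X * (card ?B * x) \<le> X * (k * ((real M - T) / M) * (M choose T))" by (simp only: mult_ac)
  then show ?thesis using X by (rule mult_left_le_imp_le)
qed

text \<open>Moves an upper tail event from the whole graph to its random \<open>T\<close>-subset: a
  graph with more than \<open>z\<close> copies keeps at least the share \<open>1 - x\<close> of
  them, hence more than \<open>y\<close>, in all but a bounded proportion of its
  \<open>T\<close>-subsets.\<close>

lemma (in edge_process) mean_ncopies_ge:
  fixes x y z :: real
  assumes M: "M > 0" and \<C>: "finite \<C>" "\<And>F. F \<in> \<C> \<Longrightarrow> card F = k" and T: "T \<le> M"
    and x: "0 < x" "x < 1" and yz: "y \<le> (1 - x) * z"
  shows "card {G\<in>R. z < ncopies \<C> G} / card R * (1 - k * ((real M - T) / M) / x)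
    \<le> mean T (indicator {S. y < real (ncopies \<C> S)})"
proof -
  define q where "q = k * ((real M - T) / M) / x"
  let ?\<phi> = "indicator {S. y < real (ncopies \<C> S)} :: 'a set \<Rightarrow> real"
  have MT: "real (M choose T) > 0" using T by simp
  have pt: "(1 - q) * (M choose T) \<le> (\<Sum>F\<in>slice G T. ?\<phi> F)" if G: "G \<in> R" "z < ncopies \<C> G" for G
  proof -
    have fin: "finite G" using R(2)[OF G(1)] E(1) by (rule finite_subset)
    have fs: "finite (slice G T)" using finite_slice[OF fin] .
    let ?B = "{S \<in> slice G T. real (ncopies \<C> S) < (1 - x) * ncopies \<C> G}"
    have "real (card ?B) * x \<le> k * ((real M - T) / M) * (M choose T)"
      using card_sparse_loss[OF fin R(3)[OF G(1)] M \<C> _ T, of x] x by simp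
    then have "real (card ?B) \<le> k * ((real M - T) / M) * (M choose T) / x"
      by (simp only: pos_le_divide_eq[OF x(1)])
    then have B: "real (card ?B) \<le> q * (M choose T)" by (simp add: q_def)
    have gt: "y < real (ncopies \<C> S)" if "S \<in> slice G T - ?B" for S
    proof -
      have "y < (1 - x) * ncopies \<C> G" 
      proof -
        have "(1 - x) * z < (1 - x) * ncopies \<C> G" using G(2) x by (intro mult_strict_left_mono) auto
        then show ?thesis using yz by linarith
      qed
      also have "\<dots> \<le> ncopies \<C> S" using that by auto
      finally show ?thesis .
    qed
    have "(1 - q) * (M choose T) \<le> real (M choose T) - card ?B" using B by (simp add: algebra_simps)
    also have "\<dots> = real (card (slice G T - ?B))"
    proof -
      have "card ?B \<le> card (slice G T)" using fs by (intro card_mono) auto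
      then show ?thesis using fs card_slice[OF fin, of T] R(3)[OF G(1)]
        by (subst card_Diff_subset) (auto simp: of_nat_diff)
    qed
    also have "\<dots> = (\<Sum>F\<in>slice G T - ?B. ?\<phi> F)" using gt by simp
    also have "\<dots> \<le> (\<Sum>F\<in>slice G T. ?\<phi> F)" using fs by (intro sum_mono2) auto
    finally show ?thesis .
  qed
  define P where "P = {G\<in>R. z < ncopies \<C> G}"
  have "real (card P) * ((1 - q) * (M choose T)) = (\<Sum>G\<in>P. (1 - q) * (M choose T))" by simp
  also have "\<dots> \<le> (\<Sum>G\<in>P. \<Sum>F\<in>slice G T. ?\<phi> F)" by (rule sum_mono, rule pt) (auto simp: P_def)
  also have "\<dots> \<le> (\<Sum>G\<in>R. \<Sum>F\<in>slice G T. ?\<phi> F)"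
    using finite_R by (intro sum_mono2 sum_nonneg) (auto simp: P_def)
  finally have "real (card P) * ((1 - q) * (M choose T)) / (card R * (M choose T)) \<le> mean T ?\<phi>"
    unfolding mean_eq using card_R_pos MT by (intro divide_right_mono) auto
  then show ?thesis using MT by (simp add: P_def q_def)
qed

section \<open>Domination and first moment for regular graphs\<close>

lemma Reg_edge_process:
  assumes "Reg r n d \<noteq> {}" "r * M = n * d" "r > 0" "rsets r n \<noteq> {}"
  shows "edge_process (rsets r n) (Reg r n d) M"
proof
  fix G assume G: "G \<in> Reg r n d"
  then show "G \<subseteq> rsets r n" by (simp add: Reg_def)
  have "r * card G = r * M" using card_Reg[OF G] assms(2) by simp
  then show "card G = M" using assms(3) by simp
qed (use assms in auto)

text \<open>The average residual degree is \<open>d - r * card F / n\<close>. Only excess is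
  excluded: a small residual degree makes an edge less likely.\<close>

definition unbalanced :: "nat \<Rightarrow> nat \<Rightarrow> nat \<Rightarrow> real \<Rightarrow> nat set set set" where
  "unbalanced r n d \<theta> = {F. \<exists>v<n. (1 + \<theta>) * (real d - r * card F / n) < real d - vdeg F v}"

text \<open>In a fixed regular graph the residual degree at a vertex counts how many of its
  \<open>d\<close> edges avoid the random \<open>t\<close>-subset, which is hypergeometric; a union
  bound over the vertices gives the factor \<open>n\<close>.\<close>

lemma mean_unbalanced_le:
  assumes Reg: "Reg r n d \<noteq> {}" "r * M = n * d" "r > 0" "rsets r n \<noteq> {}" and M: "M > 0" and t: "t \<le> M"
    and \<theta>: "0 \<le> \<theta>" "\<theta> \<le> 1"
  shows "edge_process.mean (rsets r n) (Reg r n d) M t (indicator (unbalanced r n d \<theta>))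
     \<le> n * exp (- (\<theta>\<^sup>2 * (d * (real (M - t) / M)) / 8))"
proof -
  interpret edge_process "rsets r n" "Reg r n d" M by (rule Reg_edge_process[OF Reg])
  define \<mu> where "\<mu> = real d * (real (M - t) / M)"
  have n0: "n > 0" using Reg M by (cases n) auto
  have rM: "real r * M = real n * d" using Reg(2) by (metis of_nat_mult)
  have \<mu>: "real d - r * real t / n = \<mu>"
  proof -
    have "real r / n = d / M" using rM n0 M by (simp add: field_simps)
    then have "real r / n * t = d / M * t" by (simp only:)
    then have "r * real t / n = d * (real t / M)" by simp
    then show ?thesis unfolding \<mu>_def using t M by (simp add: of_nat_diff field_simps)
  qed
  have "(\<Sum>F\<in>slice G t. indicator (unbalanced r n d \<theta>) F) \<le> n * ((M choose t) * exp (- (\<theta>\<^sup>2 * \<mu> / 8)))"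
    if G: "G \<in> Reg r n d" for G
  proof -
    have fin: "finite G" using R(2)[OF G] E(1) by (rule finite_subset)
    have fs: "finite (slice G t)" using finite_slice[OF fin] .
    define A where "A v = {e\<in>G. v \<in> e}" for v
    have cA: "card (A v) = d" if "v < n" for v using G that by (simp add: A_def Reg_def vdeg_def)
    have deg: "real d - vdeg F v = card ((G - F) \<inter> A v)" if "F \<in> slice G t" "v < n" for F v
    proof -
      have FG: "F \<subseteq> G" using that by (simp add: slice_def)
      have "card ((G - F) \<inter> A v) = vdeg (G - F) v" unfolding vdeg_def A_def by (rule arg_cong[where f=card]) auto
      also have "\<dots> = d - vdeg F v" using vdeg_diff[OF fin FG, of v] G that by (simp add: Reg_def)
      finally show ?thesis using vdeg_mono[OF fin FG, of v] G that by (simp add: Reg_def of_nat_diff)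
    qed
    have "(\<Sum>F\<in>slice G t. indicator (unbalanced r n d \<theta>) F) = real (card (slice G t \<inter> unbalanced r n d \<theta>))"
      using fs by (simp add: indicator_def sum.If_cases)
    also have "\<dots> \<le> real (card (\<Union>v<n. {F \<in> slice G t. (1 + \<theta>) * \<mu> < card ((G - F) \<inter> A v)}))"
    proof (intro of_nat_mono card_mono subsetI)
      show "finite (\<Union>v<n. {F \<in> slice G t. (1 + \<theta>) * \<mu> < card ((G - F) \<inter> A v)})" using fs by simp
      fix F assume F: "F \<in> slice G t \<inter> unbalanced r n d \<theta>"
      then obtain v where v: "v < n" "(1 + \<theta>) * (real d - r * card F / n) < real d - vdeg F v"
        by (auto simp: unbalanced_def)
      have "card F = t" using F by (simp add: slice_def)
      then have "(1 + \<theta>) * \<mu> < card ((G - F) \<inter> A v)" using v deg[of F v] F \<mu> by simp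
      then show "F \<in> (\<Union>v<n. {F \<in> slice G t. (1 + \<theta>) * \<mu> < card ((G - F) \<inter> A v)})" using v F by blast
    qed
    also have "\<dots> \<le> real (\<Sum>v<n. card {F \<in> slice G t. (1 + \<theta>) * \<mu> < card ((G - F) \<inter> A v)})"
      by (intro of_nat_mono card_UN_le) simp
    also have "\<dots> = (\<Sum>v<n. real (card {F \<in> slice G t. (1 + \<theta>) * \<mu> < card ((G - F) \<inter> A v)}))"
      by (rule of_nat_sum)
    also have "\<dots> \<le> (\<Sum>v<n. (M choose t) * exp (- (\<theta>\<^sup>2 * \<mu> / 8)))"
    proof (rule sum_mono)
      fix v assume "v \<in> {..<n}"
      then show "real (card {F \<in> slice G t. (1 + \<theta>) * \<mu> < card ((G - F) \<inter> A v)}) \<le> (M choose t) * exp (- (\<theta>\<^sup>2 * \<mu> / 8))"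
        by (intro hypergeometric_tail[OF fin R(3)[OF G] _ t \<theta>]) (auto simp: A_def[of v] \<mu>_def cA[unfolded A_def])
    qed
    finally show ?thesis by simp
  qed
  then have "mean t (indicator (unbalanced r n d \<theta>))
      \<le> (\<Sum>G\<in>Reg r n d. n * ((M choose t) * exp (- (\<theta>\<^sup>2 * \<mu> / 8)))) / (card (Reg r n d) * (M choose t))"
    unfolding mean_eq by (intro divide_right_mono sum_mono) auto
  also have "\<dots> = n * exp (- (\<theta>\<^sup>2 * \<mu> / 8))" using card_R_pos t Reg(1) by simp
  finally show ?thesis by (simp add: \<mu>_def)
qed

text \<open>\<open>h\<close> is the reciprocal of the factor in \<open>card_insert_le\<close>, so at
  a balanced state \<open>h\<close> times the probability of any next edge is at most the uniform
  one. The error term is evaluated at \<open>T\<close>, where the residual degrees are smallest and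
  concentration is weakest.\<close>

theorem Reg_domination:
  assumes r: "r \<ge> 2" and Reg: "Reg r n d \<noteq> {}" "r * M = n * d" and M: "M > 0" and N: "rsets r n \<noteq> {}"
    and loss: "switching_loss r n d < 1" and \<theta>: "0 \<le> \<theta>" "\<theta> \<le> 1" and T: "T < M"
    and h: "h = (1 - switching_loss r n d) / (1 + \<theta>) ^ r" and b: "b \<ge> 1" and c: "c = 1 - h + h / b"
    and \<phi>: "increasing_on (rsets r n) \<phi>" and L: "L \<le> card (rsets r n)"
  shows "edge_process.mean (rsets r n) (Reg r n d) M T \<phi> * (1 - c ^ L * b ^ T)
    \<le> slice_mean (rsets r n) L \<phi> + L * (n * exp (- (\<theta>\<^sup>2 * (d * (real (M - T) / M)) / 8)))"
proof -
  have r0: "r > 0" using r by simp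
  interpret edge_process "rsets r n" "Reg r n d" M by (rule Reg_edge_process[OF Reg r0 N])
  have n0: "n > 0" using Reg M r0 by (cases n) auto
  have rM: "real r * M = real n * d" using Reg(2) by (metis of_nat_mult)
  have th: "(1 + \<theta>) ^ r \<ge> 1" using \<theta> by simp
  have loss0: "switching_loss r n d \<ge> 0" by (simp add: switching_loss_def)
  show ?thesis
  proof (rule process_domination[where h = h and Bad = "\<lambda>_. unbalanced r n d \<theta>"])
    show "T \<le> M" using T by simp
    show "0 \<le> h" unfolding h using loss \<theta> by simp
    have "1 - switching_loss r n d \<le> (1 + \<theta>) ^ r" using th loss0 by linarith
    then show "h \<le> 1" unfolding h using th by (simp add: field_simps)
    show "0 \<le> n * exp (- (\<theta>\<^sup>2 * (d * (real (M - T) / M)) / 8))" by simp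
    show "mean t (indicator (unbalanced r n d \<theta>)) \<le> n * exp (- (\<theta>\<^sup>2 * (d * (real (M - T) / M)) / 8))"
      if "t < T" for t
    proof -
      have "mean t (indicator (unbalanced r n d \<theta>)) \<le> n * exp (- (\<theta>\<^sup>2 * (d * (real (M - t) / M)) / 8))"
        using that T by (intro mean_unbalanced_le[OF Reg r0 N M _ \<theta>]) auto
      also have "\<dots> \<le> n * exp (- (\<theta>\<^sup>2 * (d * (real (M - T) / M)) / 8))"
      proof -
        have "real (M - T) / M \<le> real (M - t) / M" using that by (intro divide_right_mono) auto
        then have "\<theta>\<^sup>2 * (d * (real (M - T) / M)) \<le> \<theta>\<^sup>2 * (d * (real (M - t) / M))"
          by (intro mult_left_mono) auto
        then show ?thesis by (intro mult_left_mono) auto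
      qed
      finally show ?thesis .
    qed
  next
    fix t F e assume t: "t < T" and F: "F \<in> slice (rsets r n) t" "F \<notin> unbalanced r n d \<theta>" and e: "e \<in> rsets r n - F"
    show "h * ext (insert e F) * card (rsets r n) \<le> (real M - t) * ext F"
    \<comment> \<open>The degree bound \<open>vdeg F u \<le> d\<close> of
      \<open>card_insert_le\<close> comes from a regular graph extending \<open>F\<close>; if there
      is none, both sides vanish.\<close>
    proof (cases "ext F = 0")
      case True
      have "{G\<in>Reg r n d. insert e F \<subseteq> G} \<subseteq> {G\<in>Reg r n d. F \<subseteq> G}" by blast
      then have "ext (insert e F) \<le> ext F" unfolding ext_def by (intro of_nat_mono card_mono) simp_all
      then have "ext (insert e F) = 0" using True ext_nonneg[of "insert e F"] by simp
      then show ?thesis using True by simp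
    next
      case False
      then have "{G\<in>Reg r n d. F \<subseteq> G} \<noteq> {}" unfolding ext_def by (auto simp del: Collect_empty_eq)
      then obtain G where G: "G \<in> Reg r n d" "F \<subseteq> G" by blast
      have fin: "finite G" using R(2)[OF G(1)] E(1) by (rule finite_subset)
      have cF: "card F = t" using F by (simp add: slice_def)
      have Mt: "real M - t > 0" using t T by simp
      have "ext (insert e F) * (n choose r) \<le> ext F * ((1 + \<theta>) ^ r / (1 - switching_loss r n d) * (real M - t))"
        unfolding ext_def
      proof (rule card_insert_le[OF r _ _ n0 Reg(2) _ Mt loss \<theta>])
        fix u assume u: "u < n"
        show "vdeg F u \<le> d" using vdeg_mono[OF fin G(2), of u] G(1) u by (simp add: Reg_def)
        have "real d - vdeg F u \<le> (1 + \<theta>) * (real d - r * t / n)"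
        proof -
          have "\<not> (1 + \<theta>) * (real d - r * card F / n) < real d - vdeg F u"
            using F(2) u unfolding unbalanced_def by blast
          then show ?thesis using cF by simp
        qed
        also have "real d - r * t / n = r * (real M - t) / n"
          using rM n0 by (simp add: field_simps)
        finally show "real d - vdeg F u \<le> (1 + \<theta>) * r * (real M - t) / n" by simp
      qed (use e cF in auto)
      then have "h * (ext (insert e F) * (n choose r))
          \<le> h * (ext F * ((1 + \<theta>) ^ r / (1 - switching_loss r n d) * (real M - t)))"
        using h loss th by (intro mult_left_mono) auto
      also have "\<dots> = (real M - t) * ext F" unfolding h using loss \<theta> by simp
      finally show ?thesis by (simp add: card_rsets mult.assoc)
    qed
  qed (use b c \<phi> L in auto)
qed

text \<open>Edges of \<open>F\<close> are inserted one by one, and no concentration is involved: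
  with \<open>m\<close> edges left, a residual degree is at most \<open>d\<close>, which is
  \<open>M / m\<close> times the residual average. So \<open>\<theta> = M / m - 1\<close> is
  admissible, and \<open>2 * k < M\<close> keeps it at most 1. The product
  \<open>(1 + \<theta>) ^ r * m\<close> equals \<open>M * (M / m) ^ (r - 1)\<close>, hence the
  exponent \<open>r - 1\<close>.\<close>

lemma card_Reg_superset_le:
  assumes r: "r \<ge> 2" and Reg: "r * M = n * d" and n: "n > 0"
    and loss: "switching_loss r n d < 1" and F: "F \<subseteq> rsets r n" and k: "card F \<le> k" "2 * k < M"
  shows "real (card {G\<in>Reg r n d. F \<subseteq> G})
    \<le> card (Reg r n d) * ((real M / (n choose r)) * (real M / (real M - k)) ^ (r - 1) / (1 - switching_loss r n d)) ^ card F"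
proof -
  define N where "N = real (n choose r)"
  define w where "w = (real M / N) * (real M / (real M - k)) ^ (r - 1) / (1 - switching_loss r n d)"
  have rM: "real r * M = real n * d" using Reg by (metis of_nat_mult)
  have finF: "finite F" using F finite_rsets by (rule finite_subset)
  have w0: "w \<ge> 0" unfolding w_def N_def using loss k by simp
  have "real (card {G\<in>Reg r n d. F \<subseteq> G}) \<le> card (Reg r n d) * w ^ card F"
    using finF F k(1)
  proof (induction F)
    case (insert e F)
    have F: "F \<subseteq> rsets r n" "e \<in> rsets r n" "card F < k" using insert by auto
    have "n choose r \<noteq> 0" using F(2) card_rsets[of r n] by (metis card_0_eq empty_iff finite_rsets)
    then have N: "N > 0" by (simp add: N_def)
    define m where "m = real M - card F"
    have m: "m > 0" "m \<ge> real M - k" "real M - k > 0" "2 * m \<ge> real M" "m \<le> M" using F(3) k by (auto simp: m_def)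
    define \<theta> where "\<theta> = real M / m - 1"
    have \<theta>: "0 \<le> \<theta>" "\<theta> \<le> 1" using m by (auto simp: \<theta>_def field_simps)
    show ?case
    proof (cases "{G\<in>Reg r n d. F \<subseteq> G} = {}")
      case True
      then have "{G\<in>Reg r n d. insert e F \<subseteq> G} = {}" by blast
      then have "card {G\<in>Reg r n d. insert e F \<subseteq> G} = 0" by (simp only: card.empty)
      then show ?thesis using w0 by (simp only: of_nat_0) simp
    next
      case False
      then obtain G where G: "G \<in> Reg r n d" "F \<subseteq> G" by blast
      have finG: "finite G" using G(1) finite_subset[OF _ finite_rsets, of G r n] by (simp add: Reg_def)
      have "real (card {G\<in>Reg r n d. insert e F \<subseteq> G}) * (n choose r)
        \<le> card {G\<in>Reg r n d. F \<subseteq> G} * ((1 + \<theta>) ^ r / (1 - switching_loss r n d) * m)"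
      proof (rule card_insert_le[OF r F(2) insert(2) n Reg m_def m(1) loss \<theta>])
        fix u assume u: "u < n"
        show "vdeg F u \<le> d" using vdeg_mono[OF finG G(2), of u] G(1) u by (simp add: Reg_def)
        have "(1 + \<theta>) * r * m / n = d" using rM m n by (simp add: \<theta>_def field_simps)
        then show "real d - vdeg F u \<le> (1 + \<theta>) * r * m / n" by simp
      qed
      also have "(1 + \<theta>) ^ r / (1 - switching_loss r n d) * m \<le> N * w"
      proof -
        have "(1 + \<theta>) ^ r * m = M * (real M / m) ^ (r - 1)"
          using m r by (cases r) (auto simp: \<theta>_def field_simps)
        also have "\<dots> \<le> M * (real M / (real M - k)) ^ (r - 1)"
          using m by (intro mult_left_mono power_mono divide_left_mono) auto
        finally have "(1 + \<theta>) ^ r * m / (1 - switching_loss r n d)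
            \<le> M * (real M / (real M - k)) ^ (r - 1) / (1 - switching_loss r n d)"
          using loss by (intro divide_right_mono) auto
        then show ?thesis unfolding w_def using N by simp
      qed
      finally have "real (card {G\<in>Reg r n d. insert e F \<subseteq> G}) * N \<le> card {G\<in>Reg r n d. F \<subseteq> G} * (N * w)"
        by (simp add: mult_left_mono N_def)
      then have "N * real (card {G\<in>Reg r n d. insert e F \<subseteq> G}) \<le> N * (card {G\<in>Reg r n d. F \<subseteq> G} * w)"
        by (simp only: mult_ac)
      then have "real (card {G\<in>Reg r n d. insert e F \<subseteq> G}) \<le> card {G\<in>Reg r n d. F \<subseteq> G} * w"
        using N by (rule mult_left_le_imp_le)
      also have "\<dots> \<le> card (Reg r n d) * w ^ card F * w"
        using insert F(3) by (intro mult_right_mono w0) auto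
      finally show ?thesis using insert by (simp add: mult_ac)
    qed
  qed simp
  then show ?thesis by (simp add: w_def N_def)
qed

lemma sum_ncopies:
  assumes "finite R" "finite \<C>"
  shows "(\<Sum>G\<in>R. real (ncopies \<C> G)) = (\<Sum>F\<in>\<C>. real (card {G\<in>R. F \<subseteq> G}))"
proof -
  have "(\<Sum>G\<in>R. real (ncopies \<C> G)) = (\<Sum>G\<in>R. \<Sum>F\<in>\<C>. if F \<subseteq> G then 1 else 0)"
    unfolding ncopies_def using assms by (simp add: sum.If_cases Int_def)
  also have "\<dots> = (\<Sum>F\<in>\<C>. \<Sum>G\<in>R. if F \<subseteq> G then 1 else 0)" by (rule sum.swap)
  also have "\<dots> = (\<Sum>F\<in>\<C>. real (card {G\<in>R. F \<subseteq> G}))"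
    using assms by (simp add: sum.If_cases Int_def)
  finally show ?thesis .
qed

lemma Reg_ncopies_markov:
  fixes z :: real
  assumes r: "r \<ge> 2" and Reg: "r * M = n * d" and n: "n > 0"
    and loss: "switching_loss r n d < 1" and \<C>: "finite \<C>" "\<And>F. F \<in> \<C> \<Longrightarrow> F \<subseteq> rsets r n" "\<And>F. F \<in> \<C> \<Longrightarrow> card F = k"
    and k: "2 * k < M" and z: "z \<ge> 0"
  shows "real (card {G\<in>Reg r n d. z < ncopies \<C> G}) * z
    \<le> card (Reg r n d) * (card \<C> * ((real M / (n choose r)) * (real M / (real M - k)) ^ (r - 1) / (1 - switching_loss r n d)) ^ k)"
proof -
  let ?w = "(real M / (n choose r)) * (real M / (real M - k)) ^ (r - 1) / (1 - switching_loss r n d)"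
  have "real (card {G\<in>Reg r n d. z < ncopies \<C> G}) * z = (\<Sum>G\<in>{G\<in>Reg r n d. z < ncopies \<C> G}. z)" by simp
  also have "\<dots> \<le> (\<Sum>G\<in>{G\<in>Reg r n d. z < ncopies \<C> G}. real (ncopies \<C> G))" by (rule sum_mono) auto
  also have "\<dots> \<le> (\<Sum>G\<in>Reg r n d. real (ncopies \<C> G))" by (rule sum_mono2) auto
  also have "\<dots> = (\<Sum>F\<in>\<C>. real (card {G\<in>Reg r n d. F \<subseteq> G}))" by (rule sum_ncopies[OF finite_Reg \<C>(1)])
  also have "\<dots> \<le> (\<Sum>F\<in>\<C>. card (Reg r n d) * ?w ^ k)"
  proof (rule sum_mono)
    fix F assume F: "F \<in> \<C>"
    show "real (card {G\<in>Reg r n d. F \<subseteq> G}) \<le> card (Reg r n d) * ?w ^ k"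
      using card_Reg_superset_le[OF r Reg n loss \<C>(2)[OF F], of k] \<C>(3)[OF F] k by simp
  qed
  finally show ?thesis by (simp add: mult_ac)
qed

section \<open>Probabilities in the three models\<close>

lemma prob_Gnd:
  assumes "Reg r n d \<noteq> {}"
  shows "measure_pmf.prob (Gnd r n d) {G. P G} = card {G\<in>Reg r n d. P G} / card (Reg r n d)"
proof -
  have "Gnd r n d = pmf_of_set (Reg r n d)" by (simp add: Gnd_def Reg_def)
  moreover have "Reg r n d \<inter> {G. P G} = {G\<in>Reg r n d. P G}" by auto
  ultimately show ?thesis using measure_pmf_of_set[OF assms finite_Reg] by simp
qed

lemma Gnm_eq: "Gnm r n m = pmf_of_set (slice (rsets r n) m)"
  by (simp add: Gnm_def slice_def)

lemma slice_nonempty: "finite E \<Longrightarrow> m \<le> card E \<Longrightarrow> slice E m \<noteq> {}"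
  by (metis card.empty card_slice zero_less_binomial less_irrefl)

lemma prob_Gnm:
  assumes "m \<le> card (rsets r n)"
  shows "measure_pmf.prob (Gnm r n m) {G. P G} = slice_mean (rsets r n) m (indicator {G. P G})"
proof -
  have "(\<Sum>F\<in>slice (rsets r n) m. indicator {G. P G} F) = real (card (slice (rsets r n) m \<inter> {G. P G}))"
    using finite_slice[OF finite_rsets] by (simp add: indicator_def sum.If_cases)
  then show ?thesis unfolding Gnm_eq slice_mean_def
    using measure_pmf_of_set[OF slice_nonempty[OF finite_rsets assms] finite_slice[OF finite_rsets]]
    by (simp add: card_slice)
qed

lemma expectation_Gnm:
  assumes "m \<le> card (rsets r n)"
  shows "measure_pmf.expectation (Gnm r n m) f = slice_mean (rsets r n) m f"
  unfolding Gnm_eq slice_mean_def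
  using integral_pmf_of_set[OF slice_nonempty[OF finite_rsets assms] finite_slice[OF finite_rsets]]
  by (simp add: card_slice)

lemma pmf_Gnp:
  assumes p: "0 \<le> p" "p \<le> 1" and S: "S \<subseteq> rsets r n"
  shows "pmf (Gnp r n p) S = p ^ card S * (1 - p) ^ (card (rsets r n) - card S)"
proof -
  define E where "E = rsets r n"
  define g where "g f = {e \<in> E. f e}" for f :: "nat set \<Rightarrow> bool"
  define f0 where "f0 = (\<lambda>e. e \<in> S)"
  have fS: "finite S" using S finite_rsets by (rule finite_subset)
  let ?P = "Pi_pmf E False (\<lambda>_. bernoulli_pmf p)"
  have fE: "finite E" by (simp add: E_def)
  \<comment> \<open>Outside \<open>E\<close> the default value is \<open>False\<close>, so on the
    support a function is determined by the edges it selects and the preimage of \<open>S\<close>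
    reduces to \<open>f0\<close>.\<close>
  have sub: "set_pmf ?P \<subseteq> {f. \<forall>e. e \<notin> E \<longrightarrow> \<not> f e}"
    using set_Pi_pmf_subset'[OF fE, of False "\<lambda>_. bernoulli_pmf p"] by (auto simp: PiE_dflt_def)
  have f0: "f0 \<in> {f. \<forall>e. e \<notin> E \<longrightarrow> \<not> f e}" using S by (auto simp: f0_def E_def)
  have inj: "inj_on g {f. \<forall>e. e \<notin> E \<longrightarrow> \<not> f e}"
  proof (rule inj_onI)
    fix f f' assume A: "f \<in> {f. \<forall>e. e \<notin> E \<longrightarrow> \<not> f e}" "f' \<in> {f. \<forall>e. e \<notin> E \<longrightarrow> \<not> f e}" and eq: "g f = g f'"
    have "e \<in> E \<Longrightarrow> f e = f' e" for e
      using eq unfolding g_def set_eq_iff by blast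
    then show "f = f'" using A by blast
  qed
  have g0: "g f0 = S" using S by (auto simp: g_def f0_def E_def)
  have "pmf (map_pmf g ?P) S = measure ?P (g -` {S})" by (rule pmf_map)
  also have "\<dots> = measure ?P {f0}"
  proof (rule measure_eq_AE)
    show "AE x in ?P. (x \<in> g -` {S}) = (x \<in> {f0})"
    proof (rule AE_pmfI)
      fix f assume "f \<in> set_pmf ?P"
      then have "f \<in> {f. \<forall>e. e \<notin> E \<longrightarrow> \<not> f e}" using sub by blast
      then show "(f \<in> g -` {S}) = (f \<in> {f0})"
        using inj_onD[OF inj _ _ f0, of f] g0 by auto
    qed
  qed auto
  also have "\<dots> = pmf ?P f0" by (simp add: measure_pmf_single)
  also have "\<dots> = (\<Prod>e\<in>E. pmf (bernoulli_pmf p) (f0 e))"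
    by (rule pmf_Pi'[OF fE]) (use f0 in auto)
  also have "\<dots> = (\<Prod>e\<in>S. pmf (bernoulli_pmf p) (f0 e)) * (\<Prod>e\<in>E - S. pmf (bernoulli_pmf p) (f0 e))"
    using prod.subset_diff[of S E] S fE by (simp add: E_def mult.commute)
  also have "(\<Prod>e\<in>S. pmf (bernoulli_pmf p) (f0 e)) = p ^ card S"
    using p by (simp add: f0_def)
  also have "(\<Prod>e\<in>E - S. pmf (bernoulli_pmf p) (f0 e)) = (1 - p) ^ (card E - card S)"
    using p fS S by (simp add: f0_def card_Diff_subset E_def)
  finally show ?thesis unfolding Gnp_def E_def g_def .
qed

lemma set_pmf_Gnp: "set_pmf (Gnp r n p) \<subseteq> Pow (rsets r n)"
  unfolding Gnp_def by auto

lemma expectation_Gnp: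
  fixes f :: "nat set set \<Rightarrow> real"
  assumes p: "0 \<le> p" "p \<le> 1"
  shows "measure_pmf.expectation (Gnp r n p) f
    = (\<Sum>S\<in>Pow (rsets r n). f S * (p ^ card S * (1 - p) ^ (card (rsets r n) - card S)))"
proof -
  have "measure_pmf.expectation (Gnp r n p) f = (\<Sum>S\<in>Pow (rsets r n). f S * pmf (Gnp r n p) S)"
    by (rule integral_measure_pmf_real) (use set_pmf_Gnp[of r n p] in auto)
  then show ?thesis using pmf_Gnp[OF p] by simp
qed

text \<open>With binomial weights this is conditioning on the number of edges, given which the
  binomial random graph is uniform.\<close>

lemma sum_Pow_slices:
  fixes f :: "'a set \<Rightarrow> real" and a :: "nat \<Rightarrow> real"
  assumes "finite E"
  shows "(\<Sum>S\<in>Pow E. f S * a (card S)) = (\<Sum>j\<le>card E. (card E choose j) * a j * slice_mean E j f)"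
proof -
  have "Pow E = (\<Union>j\<le>card E. slice E j)" using assms by (auto simp: slice_def card_mono)
  then have "(\<Sum>S\<in>Pow E. f S * a (card S)) = (\<Sum>j\<le>card E. \<Sum>S\<in>slice E j. f S * a (card S))"
    by (simp only:) (rule sum.UNION_disjoint, simp, simp add: finite_slice[OF assms], auto simp: slice_def)
  also have "\<dots> = (\<Sum>j\<le>card E. (card E choose j) * a j * slice_mean E j f)"
  proof (rule sum.cong)
    fix j assume "j \<in> {..card E}"
    then have pos: "real (card E choose j) > 0" by simp
    have "(\<Sum>S\<in>slice E j. f S * a (card S)) = (\<Sum>S\<in>slice E j. f S * a j)"
      by (rule sum.cong) (auto simp: slice_def)
    also have "\<dots> = a j * (\<Sum>S\<in>slice E j. f S)" by (simp add: sum_distrib_left mult.commute)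
    finally show "(\<Sum>S\<in>slice E j. f S * a (card S)) = (card E choose j) * a j * slice_mean E j f"
      unfolding slice_mean_def using pos by simp
  qed simp
  finally show ?thesis .
qed

text \<open>Exponential Markov inequality: the weight \<open>exp (x * (L - j))\<close> is at least 1
  for \<open>j < L\<close>. The exponent uses \<open>1 - exp (-x) \<ge> x - x\<^sup>2\<close>, which
  follows from \<open>exp (-x) \<le> 1 / (1 + x)\<close>.\<close>

lemma binomial_lower_tail:
  fixes p x :: real
  assumes p: "0 \<le> p" "p \<le> 1" and x: "x \<ge> 0"
  shows "(\<Sum>j<L. (N choose j) * (p ^ j * (1 - p) ^ (N - j))) \<le> exp (x * L - N * p * (x - x\<^sup>2))"
proof -
  have e: "1 - exp (-x) \<ge> x - x\<^sup>2"
  proof -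
    have "exp (-x) \<le> 1 / (1 + x)" using exp_ge_add_one_self[of x] x by (simp add: exp_minus field_simps)
    also have "\<dots> \<le> 1 - x + x\<^sup>2"
    proof -
      have "1 \<le> (1 - x + x\<^sup>2) * (1 + x)" using x by (simp add: algebra_simps power2_eq_square)
      then show ?thesis using x by (simp add: divide_le_eq)
    qed
    finally show ?thesis by simp
  qed
  have nn: "0 \<le> p * exp (-x)" "0 \<le> 1 - p" using p by auto
  have "(\<Sum>j<L. (N choose j) * (p ^ j * (1 - p) ^ (N - j)))
     \<le> (\<Sum>j<L. exp (x * L) * ((N choose j) * ((p * exp (-x)) ^ j * (1 - p) ^ (N - j))))"
  proof (rule sum_mono)
    fix j assume "j \<in> {..<L}"
    then have "1 \<le> exp (x * (real L - j))" using x by simp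
    also have "\<dots> = exp (x * L) * exp (-x) ^ j" by (simp add: exp_of_nat_mult[symmetric] exp_add[symmetric] algebra_simps)
    finally have "((N choose j) * (p ^ j * (1 - p) ^ (N - j))) * 1
       \<le> ((N choose j) * (p ^ j * (1 - p) ^ (N - j))) * (exp (x * L) * exp (-x) ^ j)"
      using p by (intro mult_left_mono) auto
    then show "(N choose j) * (p ^ j * (1 - p) ^ (N - j))
       \<le> exp (x * L) * ((N choose j) * ((p * exp (-x)) ^ j * (1 - p) ^ (N - j)))"
      unfolding power_mult_distrib by (simp only: mult_ac mult_1_right)
  qed
  also have "\<dots> = exp (x * L) * (\<Sum>j<L. (N choose j) * ((p * exp (-x)) ^ j * (1 - p) ^ (N - j)))"
    by (simp add: sum_distrib_left)
  also have "\<dots> \<le> exp (x * L) * (\<Sum>j\<le>N. (N choose j) * ((p * exp (-x)) ^ j * (1 - p) ^ (N - j)))"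
  proof (rule mult_left_mono)
    have "(\<Sum>j<L. (N choose j) * ((p * exp (-x)) ^ j * (1 - p) ^ (N - j)))
      = (\<Sum>j\<in>{..<L} \<inter> {..N}. (N choose j) * ((p * exp (-x)) ^ j * (1 - p) ^ (N - j)))"
      by (rule sum.mono_neutral_right) (auto simp: binomial_eq_0)
    also have "\<dots> \<le> (\<Sum>j\<le>N. (N choose j) * ((p * exp (-x)) ^ j * (1 - p) ^ (N - j)))"
      using nn by (intro sum_mono2 mult_nonneg_nonneg) auto
    finally show "(\<Sum>j<L. (N choose j) * ((p * exp (-x)) ^ j * (1 - p) ^ (N - j)))
      \<le> (\<Sum>j\<le>N. (N choose j) * ((p * exp (-x)) ^ j * (1 - p) ^ (N - j)))" .
  qed simp
  also have "(\<Sum>j\<le>N. (N choose j) * ((p * exp (-x)) ^ j * (1 - p) ^ (N - j))) = (p * exp (-x) + (1 - p)) ^ N"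
    by (simp add: binomial_ring mult.assoc)
  also have "exp (x * L) * \<dots> \<le> exp (x * L) * exp (- (p * (x - x\<^sup>2))) ^ N"
  proof (intro mult_left_mono power_mono)
    have "p * (x - x\<^sup>2) \<le> p * (1 - exp (-x))" using e p by (intro mult_left_mono) auto
    then have "p * exp (-x) + (1 - p) \<le> 1 + (- (p * (x - x\<^sup>2)))" by (simp add: algebra_simps)
    also have "\<dots> \<le> exp (- (p * (x - x\<^sup>2)))" by (rule exp_ge_add_one_self)
    finally show "p * exp (-x) + (1 - p) \<le> exp (- (p * (x - x\<^sup>2)))" .
  qed (use nn in auto)
  also have "\<dots> = exp (x * L - N * p * (x - x\<^sup>2))"
    by (simp add: exp_of_nat_mult[symmetric] exp_add[symmetric] algebra_simps)
  finally show ?thesis .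
qed

text \<open>Given at least \<open>L\<close> edges, the binomial random graph is a uniform set that
  dominates the uniform \<open>L\<close>-set; having fewer edges costs the binomial lower
  tail.\<close>

lemma slice_mean_le_prob_Gnp:
  fixes p x :: real
  assumes p: "0 \<le> p" "p \<le> 1" and N: "rsets r n \<noteq> {}" and inc: "increasing_on (rsets r n) (indicator {G. P G})"
    and L: "L \<le> card (rsets r n)" and x: "x \<ge> 0"
  shows "slice_mean (rsets r n) L (indicator {G. P G}) \<le> measure_pmf.prob (Gnp r n p) {G. P G}
     + exp (x * L - card (rsets r n) * p * (x - x\<^sup>2))"
proof -
  define E where "E = rsets r n"
  define N where "N = card E"
  define u where "u j = slice_mean E j (indicator {G. P G})" for j
  define b where "b j = (N choose j) * (p ^ j * (1 - p) ^ (N - j))" for j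
  have b0: "b j \<ge> 0" for j using p by (simp add: b_def)
  have fE: "finite E" "E \<noteq> {}" using N by (auto simp: E_def)
  have u0: "u j \<ge> 0" for j unfolding u_def slice_mean_def by (intro divide_nonneg_nonneg sum_nonneg) auto
  have u1: "u j \<le> 1" for j
  proof -
    have "(\<Sum>F\<in>slice E j. indicator {G. P G} F) \<le> (\<Sum>F\<in>slice E j. (1::real))"
      by (intro sum_mono) (simp add: indicator_def)
    then show ?thesis unfolding u_def slice_mean_def 
      by (cases "card E choose j = 0") (simp_all add: card_slice[OF fE(1)] divide_le_eq_1)
  qed
  have prob: "measure_pmf.prob (Gnp r n p) {G. P G} = (\<Sum>j\<le>N. b j * u j)"
  proof -
    have "measure_pmf.prob (Gnp r n p) {G. P G} = measure_pmf.expectation (Gnp r n p) (indicator {G. P G})" by simp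
    also have "\<dots> = (\<Sum>j\<le>N. b j * u j)" unfolding expectation_Gnp[OF p] E_def[symmetric] N_def b_def u_def
      by (rule sum_Pow_slices[OF fE(1), of "indicator {G. P G}" "\<lambda>j. p ^ j * (1 - p) ^ (card E - j)"])
    finally show ?thesis .
  qed
  have "(\<Sum>j\<le>N. b j) = (p + (1 - p)) ^ N" unfolding b_def binomial_ring by (simp add: mult.assoc)
  then have tot: "(\<Sum>j\<le>N. b j) = 1" by simp
  have "u L = (\<Sum>j\<le>N. b j * u L)" by (simp add: sum_distrib_right[symmetric] tot)
  also have "\<dots> \<le> (\<Sum>j\<le>N. b j * u j + (if j < L then b j else 0))"
  proof (rule sum_mono)
    fix j assume j: "j \<in> {..N}"
    show "b j * u L \<le> b j * u j + (if j < L then b j else 0)"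
    proof (cases "j < L")
      case True
      have "b j * u L \<le> b j * 1" using b0 u1 by (intro mult_left_mono) auto
      then show ?thesis using True b0[of j] u0[of j] by (simp add: add_increasing)
    next
      case False
      then have "u L \<le> u j" unfolding u_def using j inc
        by (intro slice_mean_mono[OF fE]) (auto simp: E_def N_def)
      then show ?thesis using False b0 by (simp add: mult_left_mono)
    qed
  qed
  also have "\<dots> = (\<Sum>j\<le>N. b j * u j) + (\<Sum>j\<in>{..N} \<inter> {j. j < L}. b j)"
    by (simp add: sum.distrib sum.If_cases)
  also have "(\<Sum>j\<in>{..N} \<inter> {j. j < L}. b j) \<le> (\<Sum>j<L. b j)" using b0 by (intro sum_mono2) auto
  also have "\<dots> \<le> exp (x * L - N * p * (x - x\<^sup>2))" unfolding b_def by (rule binomial_lower_tail[OF p x])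
  finally show ?thesis by (simp add: prob u_def E_def N_def)
qed

lemma expectation_ncopies_Gnp:
  fixes p :: real
  assumes p: "0 \<le> p" "p \<le> 1" and \<C>: "finite \<C>" "\<And>F. F \<in> \<C> \<Longrightarrow> F \<subseteq> rsets r n" "\<And>F. F \<in> \<C> \<Longrightarrow> card F = k"
  shows "measure_pmf.expectation (Gnp r n p) (\<lambda>G. real (ncopies \<C> G)) = card \<C> * p ^ k"
proof -
  define E where "E = rsets r n"
  define w where "w S = p ^ card S * (1 - p) ^ (card E - card S)" for S :: "nat set set"
  have fE: "finite E" by (simp add: E_def)
  have one: "(\<Sum>S\<in>Pow E. if F \<subseteq> S then w S else 0) = p ^ k" if F: "F \<in> \<C>" for F
  proof -
    have FE: "F \<subseteq> E" "card F = k" using \<C> F by (auto simp: E_def)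
    have fF: "finite F" using FE(1) fE by (rule finite_subset)
    have "(\<Sum>S\<in>Pow E. if F \<subseteq> S then w S else 0) = (\<Sum>S\<in>{S\<in>Pow E. F \<subseteq> S}. w S)"
      using fE by (simp add: sum.If_cases Int_def)
    also have "\<dots> = (\<Sum>I\<in>Pow (E - F). p ^ k * (p ^ card I * (1 - p) ^ card (E - F - I)))"
    proof (rule sum.reindex_bij_witness[where i = "\<lambda>I. I \<union> F" and j = "\<lambda>S. S - F"])
      fix S assume S: "S \<in> {S\<in>Pow E. F \<subseteq> S}"
      then have fS: "finite S" using finite_subset[OF _ fE] by auto
      have "card S = k + card (S - F)" using S FE fF fS card_mono[OF fS, of F] by (simp add: card_Diff_subset)
      moreover have "E - F - (S - F) = E - S" using S by auto
      moreover have "card (E - S) = card E - card S" using S fS by (intro card_Diff_subset) auto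
      ultimately show "p ^ k * (p ^ card (S - F) * (1 - p) ^ card (E - F - (S - F))) = w S"
        by (simp add: w_def power_add)
    qed (use FE in auto)
    also have "\<dots> = p ^ k * (\<Sum>I\<in>Pow (E - F). (\<Prod>x\<in>I. p) * (\<Prod>x\<in>E - F - I. 1 - p))"
      by (simp add: sum_distrib_left)
    also have "(\<Sum>I\<in>Pow (E - F). (\<Prod>x\<in>I. p) * (\<Prod>x\<in>E - F - I. 1 - p)) = (\<Prod>x\<in>E - F. p + (1 - p))"
      using fE by (intro prod_add[symmetric]) auto
    finally show ?thesis by simp
  qed
  have "measure_pmf.expectation (Gnp r n p) (\<lambda>G. real (ncopies \<C> G)) = (\<Sum>S\<in>Pow E. real (ncopies \<C> S) * w S)"
    unfolding expectation_Gnp[OF p] w_def E_def ..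
  also have "\<dots> = (\<Sum>S\<in>Pow E. \<Sum>F\<in>\<C>. if F \<subseteq> S then w S else 0)"
    unfolding ncopies_def using \<C>(1) by (simp add: sum.If_cases Int_def)
  also have "\<dots> = (\<Sum>F\<in>\<C>. \<Sum>S\<in>Pow E. if F \<subseteq> S then w S else 0)" by (rule sum.swap)
  also have "\<dots> = (\<Sum>F\<in>\<C>. p ^ k)" using one by (rule sum.cong[OF refl])
  finally show ?thesis by simp
qed

text \<open>A bound in product form, so that the density \<open>(m - k) / N\<close>, with
  \<open>N\<close> the number of possible edges, can take the place that \<open>p\<close> has in the
  binomial model.\<close>

lemma expectation_ncopies_Gnm_ge:
  assumes m: "m \<le> card (rsets r n)" and k: "k \<le> m"
    and \<C>: "finite \<C>" "\<And>F. F \<in> \<C> \<Longrightarrow> F \<subseteq> rsets r n" "\<And>F. F \<in> \<C> \<Longrightarrow> card F = k"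
  shows "card \<C> * ((real m - k) / card (rsets r n)) ^ k
    \<le> measure_pmf.expectation (Gnm r n m) (\<lambda>G. real (ncopies \<C> G))"
proof -
  define E where "E = rsets r n"
  define N where "N = card E"
  have fE: "finite E" by (simp add: E_def)
  have fs: "finite (slice E m)" by (rule finite_slice[OF fE])
  have choose: "(N choose m) * ((real m - k) / N) ^ k \<le> real ((N - k) choose (m - k))"
    using m k by (intro binomial_ratio_ge) (auto simp: N_def E_def)
  have sup: "card {S \<in> slice E m. F \<subseteq> S} = (N - k) choose (m - k)" if "F \<in> \<C>" for F
    using card_slice_superset[OF fE N_def[symmetric], of F m] \<C>(2,3)[OF that] k by (simp add: E_def)
  have pos: "real (N choose m) > 0" using m by (simp add: N_def E_def)
  have eq: "(\<Sum>S\<in>slice E m. real (ncopies \<C> S)) = card \<C> * real ((N - k) choose (m - k))"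
    unfolding sum_ncopies[OF fs \<C>(1)] using sup by simp
  have "card \<C> * ((N choose m) * ((real m - k) / N) ^ k) \<le> card \<C> * real ((N - k) choose (m - k))"
    using choose by (rule mult_left_mono) simp
  then show ?thesis unfolding expectation_Gnm[OF m] slice_mean_def E_def[symmetric] eq N_def[symmetric]
    using pos by (simp add: pos_le_divide_eq mult_ac)
qed

section \<open>The upper tail at a fixed number of vertices\<close>

lemma ratio_le_exp:
  fixes \<eta> :: real
  assumes "0 < \<eta>" "\<eta> \<le> 1 / 3"
  shows "(1 + \<eta>) / (1 + 3 * \<eta>) \<le> exp (- \<eta>)"
proof -
  have "3 * (\<eta> * \<eta>) \<le> \<eta>" using mult_left_mono[OF assms(2), of "3 * \<eta>"] assms(1) by simp
  \<comment> \<open>Expanding, this is \<open>3 * \<eta>\<^sup>2 \<le> \<eta>\<close>, so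
    \<open>1 / 3\<close> is the exact limit for \<eta>.\<close>
  then have "1 + \<eta> \<le> (1 - \<eta>) * (1 + 3 * \<eta>)" by (simp add: algebra_simps)
  then have "(1 + \<eta>) / (1 + 3 * \<eta>) \<le> 1 + (- \<eta>)" using assms by (simp add: pos_divide_le_eq)
  also have "\<dots> \<le> exp (- \<eta>)" by (rule exp_ge_add_one_self)
  finally show ?thesis .
qed

lemma one_minus_power_ge:
  fixes x :: real
  assumes "0 \<le> x" "x \<le> 1"
  shows "1 - k * x \<le> (1 - x) ^ k"
  using Bernoulli_inequality[of "-x" k] assms by simp

text \<open>The budget \<open>K2 + 5\<close>: \<open>K2\<close> for the shortfall of
  \<open>h\<close>, 3 for that of \<open>L\<close>, 1 for replacing
  \<open>1 / (1 + \<delta>)\<close> by \<open>1 - \<delta>\<close>, and 1 as the margin. Thus the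
  expected number of advances beats \<open>T\<close> by at least \<open>\<delta> * M\<close>, and
  the Chernoff parameter \<delta> turns this margin into
  \<open>\<delta>\<^sup>2 * M\<close>.\<close>

lemma chernoff_factor_le:
  fixes \<delta> h K2 :: real
  assumes \<delta>: "0 < \<delta>" "\<delta> \<le> 1" and h: "1 - K2 * \<delta> \<le> h" "0 \<le> h" "h \<le> 1" and K2: "K2 \<ge> 0"
    and L: "(1 - 3 * \<delta>) * M \<le> L" and T: "T \<le> (1 - (K2 + 5) * \<delta>) * real M"
    and K: "(K2 + 5) * \<delta> \<le> 1"
  shows "(1 - h + h / (1 + \<delta>)) ^ L * (1 + \<delta>) ^ T \<le> exp (- (\<delta>\<^sup>2 * real M))"
proof -
  have "1 - \<delta> \<le> 1 / (1 + \<delta>)"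
  proof -
    have "(1 - \<delta>) * (1 + \<delta>) \<le> 1" by (simp add: algebra_simps)
    then show ?thesis using \<delta> by (simp add: pos_le_divide_eq)
  qed
  have "1 - (K2 + 1) * \<delta> \<le> (1 - K2 * \<delta>) * (1 - \<delta>)" using K2 \<delta> by (simp add: algebra_simps)
  also have "\<dots> \<le> h * (1 / (1 + \<delta>))"
  proof (rule mult_mono)
    show "0 \<le> h" by (rule h)
  qed (use h \<delta> \<open>1 - \<delta> \<le> 1 / (1 + \<delta>)\<close> in auto)
  finally have h1: "1 - (K2 + 1) * \<delta> \<le> h / (1 + \<delta>)" by simp
  have c: "1 - h + h / (1 + \<delta>) = 1 + (- (\<delta> * (h / (1 + \<delta>))))" using \<delta> by (simp add: field_simps)
  have c0: "0 \<le> 1 - h + h / (1 + \<delta>)" using h \<delta> by simp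
  have a: "0 \<le> 1 - (K2 + 1) * \<delta>" "0 \<le> 1 - 3 * \<delta>"
  proof -
    have "K2 * \<delta> \<ge> 0" using K2 \<delta> by simp
    moreover have "K2 * \<delta> + 5 * \<delta> \<le> 1" using K by (simp add: algebra_simps)
    ultimately have "K2 * \<delta> + \<delta> \<le> 1" "3 * \<delta> \<le> 1" using \<delta> by linarith+
    then show "0 \<le> 1 - (K2 + 1) * \<delta>" "0 \<le> 1 - 3 * \<delta>" by (simp_all add: algebra_simps)
  qed
  have "(1 - (K2 + 4) * \<delta>) * M \<le> ((1 - (K2 + 1) * \<delta>) * (1 - 3 * \<delta>)) * M"
  proof (rule mult_right_mono)
    show "1 - (K2 + 4) * \<delta> \<le> (1 - (K2 + 1) * \<delta>) * (1 - 3 * \<delta>)" using K2 \<delta> by (simp add: algebra_simps)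
  qed simp
  also have "\<dots> = (1 - (K2 + 1) * \<delta>) * ((1 - 3 * \<delta>) * M)" by simp
  also have "\<dots> \<le> h / (1 + \<delta>) * L" using h1 L a by (intro mult_mono) (auto intro: order_trans[OF a(1)])
  finally have hL: "(1 - (K2 + 4) * \<delta>) * M \<le> h / (1 + \<delta>) * L" .
  have "(1 - h + h / (1 + \<delta>)) ^ L \<le> exp (- (\<delta> * (h / (1 + \<delta>)))) ^ L"
    using c0 exp_ge_add_one_self[of "- (\<delta> * (h / (1 + \<delta>)))"] unfolding c by (intro power_mono) auto
  moreover have "(1 + \<delta>) ^ T \<le> exp \<delta> ^ T" using \<delta> exp_ge_add_one_self[of \<delta>] by (intro power_mono) auto
  ultimately have "(1 - h + h / (1 + \<delta>)) ^ L * (1 + \<delta>) ^ T \<le> exp (- (\<delta> * (h / (1 + \<delta>)))) ^ L * exp \<delta> ^ T"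
    using \<delta> by (intro mult_mono) auto
  also have "\<dots> = exp (\<delta> * (T - h / (1 + \<delta>) * L))"
    by (simp add: exp_of_nat_mult[symmetric] exp_add[symmetric] algebra_simps)
  also have "\<dots> \<le> exp (\<delta> * (- \<delta> * M))"
  proof -
    have "T - h / (1 + \<delta>) * L \<le> (1 - (K2 + 5) * \<delta>) * M - (1 - (K2 + 4) * \<delta>) * M" using T hL by linarith
    also have "\<dots> = - \<delta> * M" by (simp add: algebra_simps)
    finally have "\<delta> * (T - h / (1 + \<delta>) * L) \<le> \<delta> * (- \<delta> * M)" using \<delta> by (intro mult_left_mono) auto
    then show ?thesis by simp
  qed
  finally show ?thesis by (simp add: power2_eq_square mult.assoc)
qed

text \<open>All asymptotic input as explicit inequalities for one \<open>n\<close>. \<open>Y\<close>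
  stands for the expectation in the sparse model and \<open>p1\<close> for a density that bounds it
  from below. \<delta> serves at once as the degree tolerance, as the Chernoff parameter and as the
  unit for the shares of edges set aside.\<close>

locale upper_tail =
  fixes r n d M k :: nat and \<delta> K1 K \<eta> Y p1 :: real and \<C> :: "nat set set set"
  assumes r: "r \<ge> 2" and Reg: "Reg r n d \<noteq> {}" "r * M = n * d" and n: "n > 1"
    and MN: "M \<le> n choose r"
    and loss: "switching_loss r n d \<le> K1 * \<delta>" and K1: "K1 \<ge> 0" "K1 * \<delta> \<le> 1 / 2"
    and \<delta>: "0 < \<delta>" "1 \<le> \<delta>\<^sup>2 * M" and K: "K \<ge> K1 + r + 5" "(K + 1) * \<delta> \<le> 1 / 2"
    and tail: "8 * (real r + 2) * ln n \<le> K * \<delta> ^ 3 * d"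
    and \<eta>: "0 < \<eta>" "\<eta> \<le> 1 / 3"
    and \<C>: "finite \<C>" "\<And>F. F \<in> \<C> \<Longrightarrow> F \<subseteq> rsets r n" "\<And>F. F \<in> \<C> \<Longrightarrow> card F = k"
    and k: "k > 0" "2 * k < M" and Y: "Y > 0" "card \<C> * p1 ^ k \<le> Y"
    and p1: "0 \<le> p1"
       "(real M / (n choose r)) * (real M / (real M - k)) ^ (r - 1) / (1 - switching_loss r n d) \<le> (1 + \<eta>) * p1"
begin

definition failure where
  "failure = card {G\<in>Reg r n d. (1 + 3 * \<eta>) ^ k * Y < ncopies \<C> G} / card (Reg r n d)"

lemma M_pos: "M > 0" using k by simp

lemma failure_le_exp: "failure \<le> exp (- (k * \<eta>))"
proof -
  let ?w = "(real M / (n choose r)) * (real M / (real M - k)) ^ (r - 1) / (1 - switching_loss r n d)"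
  let ?z = "(1 + 3 * \<eta>) ^ k * Y"
  have R: "real (card (Reg r n d)) > 0" using Reg by (simp add: card_gt_0_iff)
  have z: "?z > 0" using \<eta> Y by simp
  have loss1: "switching_loss r n d < 1" using loss K1 by simp
  have w0: "0 \<le> ?w" using loss1 k by (intro divide_nonneg_nonneg mult_nonneg_nonneg zero_le_power) auto
  have "real (card {G\<in>Reg r n d. ?z < ncopies \<C> G}) * ?z \<le> card (Reg r n d) * (card \<C> * ?w ^ k)"
    by (rule Reg_ncopies_markov[OF r Reg(2) _ loss1 \<C> k(2)]) (use n z in auto)
  also have "\<dots> \<le> card (Reg r n d) * (card \<C> * ((1 + \<eta>) * p1) ^ k)"
    using p1(2) w0 by (intro mult_left_mono power_mono) auto
  also have "\<dots> = card (Reg r n d) * ((1 + \<eta>) ^ k * (card \<C> * p1 ^ k))" by (simp add: power_mult_distrib)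
  also have "\<dots> \<le> card (Reg r n d) * ((1 + \<eta>) ^ k * Y)"
    using Y \<eta> by (intro mult_left_mono) auto
  finally have le: "real (card {G\<in>Reg r n d. ?z < ncopies \<C> G}) * ?z
    \<le> card (Reg r n d) * ((1 + \<eta>) ^ k * Y)" .
  have "a / b \<le> w / z" if "a * z \<le> b * w" "b > 0" "z > 0" for a b w z :: real
    using that by (simp add: field_simps)
  from this[OF le R z] have "failure \<le> (1 + \<eta>) ^ k * Y / ?z" unfolding failure_def .
  also have "\<dots> = ((1 + \<eta>) / (1 + 3 * \<eta>)) ^ k" using Y by (simp add: power_divide)
  also have "\<dots> \<le> exp (- \<eta>) ^ k" using ratio_le_exp[OF \<eta>] \<eta> by (intro power_mono) auto
  also have "\<dots> = exp (- (k * \<eta>))" by (simp add: exp_of_nat_mult[symmetric])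
  finally show ?thesis .
qed

text \<open>\<open>L\<close> counts uniform edges and \<open>T\<close> process edges. The 2 leaves
  \<open>L\<close> below \<open>(1 - \<delta>) * M\<close>, the expected size of the binomial model,
  by enough to absorb its fluctuations; the gap between \<open>T\<close> and \<open>L\<close> pays
  for the steps not being exactly uniform.\<close>

definition L where "L = nat \<lfloor>(1 - 2 * \<delta>) * M\<rfloor>"
definition T where "T = nat \<lfloor>(1 - K * \<delta>) * M\<rfloor>"

lemma \<delta>_le: "K * \<delta> \<le> 1 / 2" "\<delta> \<le> 1 / 12" "1 \<le> \<delta> * M"
proof -
  have "K \<ge> 5" using K(1) K1(1) by simp
  then have "6 * \<delta> \<le> (K + 1) * \<delta>" using \<delta> by (intro mult_right_mono) auto
  then show d12: "\<delta> \<le> 1 / 12" using K(2) by simp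
  show "K * \<delta> \<le> 1 / 2" using K(2) \<delta> by (simp add: algebra_simps)
  have "\<delta>\<^sup>2 * M \<le> \<delta> * M" unfolding power2_eq_square
    using d12 \<delta> by (intro mult_right_mono) (auto simp: mult_le_cancel_right1)
  then show "1 \<le> \<delta> * M" using \<delta> by simp
qed

lemma L_bounds: "L \<le> (1 - 2 * \<delta>) * M" "(1 - 3 * \<delta>) * M \<le> L"
proof -
  have "0 \<le> (1 - 2 * \<delta>) * M" using \<delta>_le by (intro mult_nonneg_nonneg) auto
  then show "L \<le> (1 - 2 * \<delta>) * M" unfolding L_def by simp
  have "(1 - 2 * \<delta>) * M - 1 \<le> L" unfolding L_def by linarith
  moreover have "(1 - 3 * \<delta>) * M = (1 - 2 * \<delta>) * M - \<delta> * M" by (simp add: algebra_simps)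
  ultimately show "(1 - 3 * \<delta>) * M \<le> L" using \<delta>_le by simp
qed

lemma T_bounds: "T \<le> (1 - K * \<delta>) * M" "(1 - (K + 1) * \<delta>) * M \<le> T" "T < M"
proof -
  have "0 \<le> (1 - K * \<delta>) * M" using \<delta>_le by (intro mult_nonneg_nonneg) auto
  then show 1: "T \<le> (1 - K * \<delta>) * M" unfolding T_def by simp
  have "(1 - K * \<delta>) * M - 1 \<le> T" unfolding T_def by linarith
  moreover have "(1 - (K + 1) * \<delta>) * M = (1 - K * \<delta>) * M - \<delta> * M" by (simp add: algebra_simps)
  ultimately show "(1 - (K + 1) * \<delta>) * M \<le> T" using \<delta>_le by simp
  have "K * \<delta> * M > 0" using K K1 \<delta> M_pos by (intro mult_pos_pos) auto
  then have "real T < M" using 1 by (simp add: algebra_simps)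
  then show "T < M" by simp
qed

text \<open>The factor 4 is two losses of one half: the random subgraph keeps enough copies with
  probability at least 1/2, and the Chernoff factor of the domination is at least 1/2.\<close>

lemma failure_le_slice_mean:
  assumes small: "(K + 1) * (\<delta> / \<eta>) * (1 + k * \<eta>) \<le> 1 / 2"
  shows "failure \<le> 4 * (slice_mean (rsets r n) L (indicator {S. (1 + \<eta>) ^ k * Y < ncopies \<C> S}) + 1 / n)"
proof -
  have "card (rsets r n) > 0" using MN M_pos unfolding card_rsets by linarith
  then have rsets: "rsets r n \<noteq> {}" by auto
  have r0: "r > 0" using r by simp
  interpret edge_process "rsets r n" "Reg r n d" M by (rule Reg_edge_process[OF Reg r0 rsets])
  define \<phi> where "\<phi> = (indicator {S. (1 + \<eta>) ^ k * Y < real (ncopies \<C> S)} :: nat set set \<Rightarrow> real)"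
  have inc: "increasing_on (rsets r n) \<phi>" unfolding \<phi>_def by (rule increasing_ncopies[OF \<C>(1)])
  have loss0: "switching_loss r n d \<ge> 0" by (simp add: switching_loss_def)
  have loss1: "switching_loss r n d < 1" using loss K1 by simp
  define h where "h = (1 - switching_loss r n d) / (1 + \<delta>) ^ r"
  define K2 where "K2 = K1 + r"
  have h: "1 - K2 * \<delta> \<le> h" "0 \<le> h" "h \<le> 1"
  proof -
    have p: "(1 + \<delta>) ^ r \<ge> 1" using \<delta> by simp
    have "(1 - \<delta>) ^ r * (1 + \<delta>) ^ r \<le> 1"
      unfolding power_mult_distrib[symmetric] using \<delta>_le \<delta>
      by (intro power_le_one) (auto simp: algebra_simps mult_le_one)
    then have inv: "(1 - \<delta>) ^ r \<le> 1 / (1 + \<delta>) ^ r" using p by (simp add: pos_le_divide_eq)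
    have "1 - K2 * \<delta> \<le> (1 - K1 * \<delta>) * (1 - r * \<delta>)" using K1 \<delta> by (simp add: K2_def algebra_simps)
    also have "\<dots> \<le> (1 - K1 * \<delta>) * (1 - \<delta>) ^ r"
      using one_minus_power_ge[of \<delta> r] \<delta> \<delta>_le K1 by (intro mult_left_mono) auto
    also have "\<dots> \<le> (1 - switching_loss r n d) * (1 / (1 + \<delta>) ^ r)"
      using inv loss loss1 \<delta>_le \<delta> by (intro mult_mono) auto
    finally show "1 - K2 * \<delta> \<le> h" by (simp add: h_def)
    show "0 \<le> h" unfolding h_def using loss1 p by simp
    show "h \<le> 1" unfolding h_def using loss0 p by (simp add: divide_le_eq)
  qed
  have "(1 - h + h / (1 + \<delta>)) ^ L * (1 + \<delta>) ^ T \<le> exp (- (\<delta>\<^sup>2 * real M))"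
  proof (rule chernoff_factor_le[OF \<delta>(1) _ h _ L_bounds(2)])
    have KK: "K2 + 5 \<le> K" using K by (simp add: K2_def)
    then have "(K2 + 5) * \<delta> \<le> K * \<delta>" using \<delta> by (intro mult_right_mono) auto
    then show "(K2 + 5) * \<delta> \<le> 1" using \<delta>_le by simp
    have "(1 - K * \<delta>) * M \<le> (1 - (K2 + 5) * \<delta>) * M"
      using \<open>(K2 + 5) * \<delta> \<le> K * \<delta>\<close> by (intro mult_right_mono) auto
    then show "T \<le> (1 - (K2 + 5) * \<delta>) * real M" by (rule order_trans[OF T_bounds(1)])
    show "0 \<le> K2" using K1 by (simp add: K2_def)
  qed (use \<delta>_le in auto)
  also have "\<dots> \<le> exp (- 1)" using \<delta> by simp
  also have "\<dots> \<le> 1 / 2" using exp_ge_add_one_self[of 1] by (simp add: exp_minus field_simps)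
  finally have e1: "(1 - h + h / (1 + \<delta>)) ^ L * (1 + \<delta>) ^ T \<le> 1 / 2" .
  have LN: "L \<le> card (rsets r n)"
  proof -
    have "(1 - 2 * \<delta>) * M \<le> 1 * real M" using \<delta> by (intro mult_right_mono) auto
    then have "real L \<le> M" using L_bounds by simp
    then show ?thesis using MN by (simp add: card_rsets)
  qed
  have dom: "mean T \<phi> * (1 - (1 - h + h / (1 + \<delta>)) ^ L * (1 + \<delta>) ^ T)
    \<le> slice_mean (rsets r n) L \<phi> + L * (n * exp (- (\<delta>\<^sup>2 * (d * (real (M - T) / M)) / 8)))"
    by (rule Reg_domination[OF r Reg M_pos rsets loss1 _ _ T_bounds(3) h_def _ refl inc LN]) (use \<delta> \<delta>_le in auto)
  have \<zeta>: "K * \<delta> \<le> real (M - T) / M" "(real M - T) / M \<le> (K + 1) * \<delta>"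
  proof -
    have MT: "real (M - T) = real M - T" using T_bounds(3) by simp
    show "K * \<delta> \<le> real (M - T) / M" unfolding MT using T_bounds(1) M_pos by (simp add: pos_le_divide_eq algebra_simps)
    show "(real M - T) / M \<le> (K + 1) * \<delta>" using T_bounds(2) M_pos by (simp add: pos_divide_le_eq algebra_simps)
  qed
  \<comment> \<open>Origin of \<open>r + 2\<close> in \<open>tail\<close>: at most
    \<open>n ^ r\<close> steps, each with a union bound over \<open>n\<close> vertices, must sum to
    at most \<open>1 / n\<close>.\<close>
  have e2: "L * (n * exp (- (\<delta>\<^sup>2 * (d * (real (M - T) / M)) / 8))) \<le> 1 / n"
  proof -
    have n0: "real n > 0" using n by simp
    have "K * \<delta> ^ 3 * d = \<delta>\<^sup>2 * (d * (K * \<delta>))" by (simp add: power2_eq_square power3_eq_cube)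
    also have "\<dots> \<le> \<delta>\<^sup>2 * (d * (real (M - T) / M))" using \<zeta>(1) by (intro mult_left_mono) auto
    finally have "K * \<delta> ^ 3 * d \<le> \<delta>\<^sup>2 * (d * (real (M - T) / M))" .
    from order_trans[OF tail this]
    have "8 * ((real r + 2) * ln n) \<le> \<delta>\<^sup>2 * (d * (real (M - T) / M))" by (simp only: mult.assoc)
    moreover have "u \<le> w / 8" if "8 * u \<le> w" for u w :: real using that by simp
    ultimately have "(real r + 2) * ln n \<le> \<delta>\<^sup>2 * (d * (real (M - T) / M)) / 8" by blast
    then have "exp (- (\<delta>\<^sup>2 * (d * (real (M - T) / M)) / 8)) \<le> exp (- ((real r + 2) * ln n))" by simp
    also have "\<dots> = 1 / real n ^ (r + 2)"
    proof -
      have "exp (- ((real r + 2) * ln n)) = inverse (exp (real (r + 2) * ln n))" by (simp add: exp_minus)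
      also have "exp (real (r + 2) * ln n) = real n ^ (r + 2)" unfolding exp_of_nat_mult using n0 by simp
      finally show ?thesis by (simp add: inverse_eq_divide)
    qed
    finally have ex: "exp (- (\<delta>\<^sup>2 * (d * (real (M - T) / M)) / 8)) \<le> 1 / real n ^ (r + 2)" .
    have "n choose r \<le> n ^ r"
      using binomial_fact_pow[of n r] by (metis fact_ge_1 le_trans mult.right_neutral mult_le_mono2)
    then have "L \<le> n ^ r" using LN unfolding card_rsets by linarith
    then have "real L \<le> real n ^ r" by (metis of_nat_le_iff of_nat_power)
    then have "L * (n * exp (- (\<delta>\<^sup>2 * (d * (real (M - T) / M)) / 8))) \<le> real n ^ r * (n * (1 / real n ^ (r + 2)))"
      using ex by (intro mult_mono) auto
    also have "\<dots> = 1 / n" using n0 by (simp add: power_add power2_eq_square)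
    finally show ?thesis .
  qed
  \<comment> \<open>The share of copies that may be lost: \<open>1 - x\<close> is exactly the
    quotient of the thresholds \<open>(1 + \<eta>) ^ k * Y\<close> and
    \<open>(1 + 3 * \<eta>) ^ k * Y\<close>.\<close>
  define x where "x = 1 - ((1 + \<eta>) / (1 + 3 * \<eta>)) ^ k"
  have x: "0 < x" "x < 1" "k * \<eta> / (1 + k * \<eta>) \<le> x"
  proof -
    have "((1 + \<eta>) / (1 + 3 * \<eta>)) ^ k \<le> exp (- \<eta>) ^ k" using ratio_le_exp[OF \<eta>] \<eta> by (intro power_mono) auto
    also have "\<dots> = exp (- (k * \<eta>))" by (simp add: exp_of_nat_mult[symmetric])
    also have "\<dots> \<le> 1 / (1 + k * \<eta>)"
      using exp_ge_add_one_self[of "k * \<eta>"] \<eta> by (simp add: exp_minus inverse_eq_divide frac_le add_pos_nonneg)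
    finally have "1 - 1 / (1 + k * \<eta>) \<le> x" by (simp add: x_def)
    moreover have "1 + k * \<eta> > 0" using \<eta> by (simp add: add_pos_nonneg)
    then have "1 - 1 / (1 + k * \<eta>) = k * \<eta> / (1 + k * \<eta>)" by (simp add: field_simps)
    ultimately show 1: "k * \<eta> / (1 + k * \<eta>) \<le> x" by simp
    have "0 < k * \<eta> / (1 + k * \<eta>)" using k \<eta> \<open>1 + k * \<eta> > 0\<close> by (intro divide_pos_pos mult_pos_pos) auto
    then show "0 < x" using 1 by simp
    show "x < 1" unfolding x_def using \<eta> by simp
  qed
  \<comment> \<open>The expected loss is proportional to \<open>k * \<delta>\<close> and the
    tolerated one is at least \<open>k * \<eta> / (1 + k * \<eta>)\<close>. The factor
    \<open>k\<close> cancels and \<open>\<delta> / \<eta>\<close> remains, multiplied by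
    \<open>1 + k * \<eta>\<close>.\<close>
  have q: "k * ((real M - T) / M) / x \<le> 1 / 2"
  proof -
    have k\<eta>: "0 < k * \<eta>" "0 < 1 + k * \<eta>" using k \<eta> by (auto intro: mult_pos_pos add_pos_nonneg)
    have "k * ((real M - T) / M) / x \<le> k * ((K + 1) * \<delta>) / (k * \<eta> / (1 + k * \<eta>))"
    proof (rule frac_le)
      show "0 \<le> real k * ((K + 1) * \<delta>)" using K K1 \<delta> by (intro mult_nonneg_nonneg) auto
      show "real k * ((real M - real T) / real M) \<le> real k * ((K + 1) * \<delta>)" using \<zeta>(2) by (intro mult_left_mono) auto
      show "0 < k * \<eta> / (1 + k * \<eta>)" using k\<eta> by simp
    qed (rule x)
    also have "\<dots> = (K + 1) * (\<delta> / \<eta>) * (1 + k * \<eta>)" using k\<eta> k(1) \<eta> by (simp add: field_simps)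
    also note small
    finally show ?thesis .
  qed
  have "failure * (1 - k * ((real M - T) / M) / x) \<le> mean T \<phi>"
    unfolding failure_def \<phi>_def
  proof (rule mean_ncopies_ge[OF M_pos \<C>(1,3) _ x(1,2)])
    show "T \<le> M" using T_bounds by simp
    have "(1 - x) * ((1 + 3 * \<eta>) ^ k * Y) = (1 + \<eta>) ^ k * Y"
      using \<eta> by (simp add: x_def power_divide)
    then show "(1 + \<eta>) ^ k * Y \<le> (1 - x) * ((1 + 3 * \<eta>) ^ k * Y)" by (rule eq_refl[OF sym])
  qed
  moreover have f0: "failure \<ge> 0" by (simp add: failure_def)
  then have "failure * (1 / 2) \<le> failure * (1 - k * ((real M - T) / M) / x)" using q by (intro mult_left_mono) auto
  ultimately have "failure * (1 / 2) \<le> mean T \<phi>" by (rule order_trans[rotated])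
  then have m: "failure / 2 \<le> mean T \<phi>" by simp
  have "failure / 2 * (1 / 2) \<le> mean T \<phi> * (1 - (1 - h + h / (1 + \<delta>)) ^ L * (1 + \<delta>) ^ T)"
    using m e1 f0 by (intro mult_mono) auto
  then show ?thesis using dom e2 unfolding \<phi>_def by simp
qed

end

section \<open>Asymptotics\<close>

text \<open>A set of edge sets, so permutations with the same image give one copy. The tail
  estimates see \<open>H\<close> only through this finite family of sets of equal size.\<close>

definition images :: "nat \<Rightarrow> nat set set \<Rightarrow> nat set set set" where
  "images n H = {F. \<exists>\<sigma>. \<sigma> permutes {..<n} \<and> F = (\<lambda>e. \<sigma> ` e) ` H}"

lemma copies_eq: "copies n H G = ncopies (images n H) G"
  unfolding copies_def ncopies_def images_def by (rule arg_cong[where f = card]) auto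

lemma images_props:
  assumes H: "H \<subseteq> rsets r n" and F: "F \<in> images n H"
  shows "F \<subseteq> rsets r n" "card F = card H"
proof -
  obtain \<sigma> where \<sigma>: "\<sigma> permutes {..<n}" and F: "F = (\<lambda>e. \<sigma> ` e) ` H" using F by (auto simp: images_def)
  have inj: "inj \<sigma>" using permutes_inj[OF \<sigma>] .
  show "card F = card H" unfolding F by (rule card_image) (auto simp: inj_on_def inj_image_eq_iff[OF inj])
  show "F \<subseteq> rsets r n"
  proof
    fix f assume "f \<in> F"
    then obtain e where e: "e \<in> H" "f = \<sigma> ` e" unfolding F by blast
    have "e \<subseteq> {..<n}" "card e = r" using e H by (auto simp: rsets_def)
    moreover have "\<sigma> ` e \<subseteq> \<sigma> ` {..<n}" using \<open>e \<subseteq> {..<n}\<close> by (rule image_mono)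
    ultimately show "f \<in> rsets r n" unfolding rsets_def e
      using permutes_image[OF \<sigma>] card_image[OF inj_on_subset[OF inj subset_UNIV], of e] by simp
  qed
qed

lemma finite_images: "H \<subseteq> rsets r n \<Longrightarrow> finite (images n H)"
  by (rule finite_subset[of _ "Pow (rsets r n)"]) (blast dest: images_props(1), simp)

lemma images_refl: "H \<in> images n H"
  unfolding images_def by (rule CollectI, rule exI[of _ id]) (auto simp: permutes_id)

lemma card_images_pos: "H \<subseteq> rsets r n \<Longrightarrow> card (images n H) > 0"
  using finite_images images_refl by (metis card_gt_0_iff empty_iff)

lemma copies_empty: "copies n {} G = 1"
proof -
  have "{F. F \<subseteq> G \<and> (\<exists>\<sigma>. \<sigma> permutes {..<n} \<and> F = (\<lambda>e. \<sigma> ` e) ` {})} = {{}}"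
    by (auto intro!: exI[of _ id] permutes_id)
  then show ?thesis unfolding copies_def by (simp only:) simp
qed

lemma card_le_maxdeg:
  assumes "H \<subseteq> rsets r n"
  shows "r * card H \<le> n * maxdeg n H"
proof -
  have "r * card H = (\<Sum>v<n. vdeg H v)" using sum_vdeg[OF assms] by simp
  also have "\<dots> \<le> (\<Sum>v<n. maxdeg n H)"
    by (rule sum_mono) (auto simp: maxdeg_def intro!: Max_ge)
  finally show ?thesis by simp
qed

section \<open>Consequences of the growth conditions\<close>

lemma eventually_adm:
  "eventually P (adm r d) \<longleftrightarrow> eventually (\<lambda>n. r dvd n * d n \<longrightarrow> P n) sequentially"
  unfolding adm_def eventually_inf_principal by simp

text \<open>The Landau conditions control only the absolute value of \<eta>, so the estimates below
  use \<open>\<bar>\<eta> n\<bar>\<close> or are stated for positive \<open>\<eta> n\<close>.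
  Positivity is derived later from the concentration hypothesis.\<close>

locale regime =
  fixes r :: nat and C :: real and d :: "nat \<Rightarrow> nat" and H :: "nat \<Rightarrow> nat set set" and \<eta> :: "nat \<Rightarrow> real"
  assumes r: "r \<ge> 2" and C0: "C > 0"
    and d_lower: "(\<lambda>n. ln (real n)) \<in> o[adm r d](\<lambda>n. real (d n))"
    and d_upper: "(\<lambda>n. real (d n)) \<in> o[adm r d](\<lambda>n. real n ^ (r - 1))"
    and H_graph: "\<And>n. H n \<subseteq> rsets r n"
    and H_deg: "(\<lambda>n. real (maxdeg n (H n))) \<in> O[adm r d](\<lambda>_. 1)"
    and eta_small: "\<eta> \<in> o[adm r d](\<lambda>_. 1)"
    and eps_eta: "(\<lambda>n. eps_nd r n (d n)) \<in> o[adm r d](\<eta>)"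
    and delta_eta: "(\<lambda>n. delta_nd r C n (d n)) \<in> o[adm r d](\<eta>)"
begin

abbreviation "\<F> \<equiv> adm r d"
abbreviation "\<delta> n \<equiv> delta_nd r C n (d n)"
abbreviation "k n \<equiv> card (H n)"
abbreviation "\<C> n \<equiv> images n (H n)"
abbreviation "N n \<equiv> n choose r"
abbreviation "many n y \<equiv> {S. y < real (ncopies (\<C> n) S)}"
abbreviation "concentrated Q \<epsilon> Y \<equiv>
  aas \<F> Q (\<lambda>n G. pm_approx (\<epsilon> n) (k n) (real (copies n (H n) G)) (Y n))"
abbreviation "mean_copies Q n \<equiv> measure_pmf.expectation (Q n) (\<lambda>G. real (copies n (H n) G))"
abbreviation "G_reg n \<equiv> Gnd r n (d n)"
abbreviation "G_bin n \<equiv> Gnp r n (p_d r C n (d n))"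
abbreviation "G_unif n \<equiv> Gnm r n (m_d r C n (d n))"

definition M where "M n = n * d n div r"
text \<open>Converts \<open>switching_loss\<close> into a multiple of \<delta>, because both
  \<open>1 / n\<close> and \<open>d / n ^ (r - 1)\<close> are at most
  \<open>\<delta> / C\<close>.\<close>

definition K1 where "K1 = (2 * real r ^ 4 + fact r * (2 * real r) ^ (r - 1)) / C"
text \<open>The first entry is the budget of \<open>chernoff_factor_le\<close>, with
  \<open>K1\<close> from the switching and \<open>r\<close> from \<open>(1 + \<delta>) ^ r\<close>.
  The second makes \<open>K * \<delta> ^ 3 * d\<close> at least
  \<open>8 * (r + 2) * ln n\<close>.\<close>

definition K where "K = max (K1 + r + 5) (8 * (real r + 2) / C ^ 3)"

lemma K1_nonneg: "K1 \<ge> 0" unfolding K1_def using C0 by simp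

lemma ev_large: "\<forall>\<^sub>F n in \<F>. n \<ge> m"
  unfolding eventually_adm using eventually_ge_at_top[of m] by eventually_elim simp

lemma ev_dvd: "\<forall>\<^sub>F n in \<F>. r * M n = n * d n"
  unfolding eventually_adm M_def by (rule always_eventually) simp

lemma ev_d_large: "\<forall>\<^sub>F n in \<F>. B \<le> real (d n)"
proof -
  have "\<forall>\<^sub>F n in \<F>. norm (ln (real n)) \<le> 1 * norm (real (d n))"
    using landau_o.smallD[OF d_lower, of 1] by simp
  moreover have "\<forall>\<^sub>F n in \<F>. n \<ge> nat \<lceil>exp B\<rceil>" by (rule ev_large)
  moreover have "\<forall>\<^sub>F n in \<F>. n \<ge> 1" by (rule ev_large)
  ultimately show ?thesis
  proof eventually_elim
    case (elim n)
    have "exp B \<le> real n" using elim(2) by linarith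
    then have "B \<le> ln n" using elim(3) by (simp add: ln_ge_iff)
    also have "\<dots> \<le> d n" using elim(1,3) by simp
    finally show ?case .
  qed
qed

lemma ev_d_upper: "c > 0 \<Longrightarrow> \<forall>\<^sub>F n in \<F>. real (d n) \<le> c * real n ^ (r - 1)"
  using landau_o.smallD[OF d_upper, of c] by simp

lemma ev_eta_small: "c > 0 \<Longrightarrow> \<forall>\<^sub>F n in \<F>. \<bar>\<eta> n\<bar> \<le> c"
  using landau_o.smallD[OF eta_small, of c] by simp

lemma ev_delta_eta: "c > 0 \<Longrightarrow> \<forall>\<^sub>F n in \<F>. \<delta> n \<le> c * \<bar>\<eta> n\<bar>"
  using landau_o.smallD[OF delta_eta, of c] by (auto elim!: eventually_mono)

lemma ev_eps_eta: "c > 0 \<Longrightarrow> \<forall>\<^sub>F n in \<F>. eps_nd r n (d n) \<le> c * \<bar>\<eta> n\<bar>"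
  using landau_o.smallD[OF eps_eta, of c] by (auto elim!: eventually_mono)

lemma ev_degree: "\<forall>\<^sub>F n in \<F>. n \<ge> 3 \<and> d n > 0 \<and> r * M n = n * d n \<and> n > r \<and> n \<le> r * M n \<and>
    real (d n) \<le> real n ^ (r - 1) \<and> d n \<le> (n - 1) choose (r - 1) \<and> M n \<le> N n \<and> M n > 0"
proof -
  \<comment> \<open>A multiple of \<open>n ^ (r - 1)\<close> small enough to lie below the lower
    bound \<open>((n - 1) / (r - 1)) ^ (r - 1)\<close> for the maximal degree.\<close>
  have "(1 / (2 * real r)) ^ (r - 1) > 0" using r by simp
  from ev_d_upper[OF this] have "\<forall>\<^sub>F n in \<F>. real (d n) \<le> (1 / (2 * real r)) ^ (r - 1) * real n ^ (r - 1)" .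
  moreover have "\<forall>\<^sub>F n in \<F>. real (d n) \<le> 1 * real n ^ (r - 1)" by (rule ev_d_upper) simp
  moreover have "\<forall>\<^sub>F n in \<F>. n \<ge> r + 3" by (rule ev_large)
  moreover have "\<forall>\<^sub>F n in \<F>. 1 \<le> real (d n)" by (rule ev_d_large)
  moreover note ev_dvd
  ultimately show ?thesis
  proof eventually_elim
    case (elim n)
    have r1: "r - 1 \<le> n - 1" "n \<ge> 2" using elim(3) by auto
    have "real (d n) \<le> (1 / (2 * real r) * n) ^ (r - 1)" using elim(1) by (simp only: power_mult_distrib)
    also have "\<dots> \<le> (real (n - 1) / real (r - 1)) ^ (r - 1)"
    proof (rule power_mono)
      have "real n / (2 * real r) = (real n / 2) / r" by simp
      also have "\<dots> \<le> real (n - 1) / real (r - 1)" using r r1 by (intro frac_le) auto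
      finally show "1 / (2 * real r) * n \<le> real (n - 1) / real (r - 1)" by simp
    qed simp
    also have "\<dots> \<le> real ((n - 1) choose (r - 1))" by (rule binomial_ge_n_over_k_pow_k[OF r1(1)])
    finally have dN: "d n \<le> (n - 1) choose (r - 1)" by simp
    have "r * M n \<le> n * ((n - 1) choose (r - 1))" using elim(5) dN by simp
    also have "\<dots> = r * N n" using times_binomial_minus1_eq[of r n] r by simp
    finally have "M n \<le> N n" using r by simp
    moreover have "n \<le> r * M n" "M n > 0" using elim(3,4,5) r by (auto intro: gr0I)
    ultimately show ?case using elim dN by auto
  qed
qed

text \<open>The cube root only enlarges \<open>d / n ^ (r - 1)\<close>, which is at most 1, so the
  linear bound survives; cubing \<delta> recovers the logarithmic term.\<close>

lemma ev_delta: "\<forall>\<^sub>F n in \<F>. 0 < \<delta> n \<and> C / n \<le> \<delta> n \<and> C * (d n / real n ^ (r - 1)) \<le> \<delta> n \<and>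
    C ^ 3 * (ln n / d n) \<le> \<delta> n ^ 3"
  using ev_degree
proof eventually_elim
  case (elim n)
  define a where "a = real (d n) / real n ^ (r - 1)"
  define b where "b = ln n / d n"
  have n: "n \<ge> 3" "d n > 0" using elim by auto
  have a: "0 < a" "a \<le> 1" using elim by (auto simp: a_def divide_le_eq)
  have b: "0 \<le> b" using n by (simp add: b_def)
  have \<delta>: "\<delta> n = C * ((a + b) powr (1/3) + 1 / n)" by (simp add: delta_nd_def a_def b_def)
  have p: "(a + b) powr (1/3) > 0" using a b by simp
  have "C / n \<le> \<delta> n" unfolding \<delta> using p C0 by (simp add: algebra_simps)
  moreover have "C * a \<le> \<delta> n"
  proof -
    have "a = a powr 1" using a by simp
    also have "\<dots> \<le> a powr (1/3)" using a by (intro powr_mono') auto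
    also have "\<dots> \<le> (a + b) powr (1/3)" using a b by (intro powr_mono2) auto
    finally have "a \<le> (a + b) powr (1/3) + 1 / n" by (simp add: add_increasing2)
    then show ?thesis unfolding \<delta> using C0 by (intro mult_left_mono) auto
  qed
  moreover have "C ^ 3 * b \<le> \<delta> n ^ 3"
  proof -
    have "b \<le> a + b" using a by simp
    also have "\<dots> = ((a + b) powr (1/3)) ^ 3" using a b by (simp add: powr_power)
    also have "\<dots> \<le> ((a + b) powr (1/3) + 1 / n) ^ 3" by (intro power_mono) auto
    finally have "C ^ 3 * b \<le> C ^ 3 * ((a + b) powr (1/3) + 1 / n) ^ 3" using C0 by (intro mult_left_mono) auto
    then show ?thesis unfolding \<delta> power_mult_distrib .
  qed
  moreover have "0 < C / n" using C0 n by simp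
  ultimately show ?case by (auto simp: a_def b_def)
qed

lemma ev_delta_small: "c > 0 \<Longrightarrow> \<forall>\<^sub>F n in \<F>. \<delta> n \<le> c"
  using ev_delta_eta[of 1] ev_eta_small[of c] by (auto elim: eventually_elim2)

text \<open>As \<open>M = n * d / r\<close> and \<open>\<delta> ^ 3\<close> is at least a multiple
  of \<open>ln n / d\<close>, the degree cancels and \<open>\<delta> ^ 3 * M\<close> is at least of
  order \<open>n * ln n\<close>; \<open>\<delta> \<le> 1\<close> allows the square.\<close>

lemma ev_delta_M: "\<forall>\<^sub>F n in \<F>. B \<le> \<delta> n ^ 2 * M n"
proof -
  define B' where "B' = B * r / C ^ 3"
  have "\<forall>\<^sub>F n in \<F>. \<delta> n \<le> 1" by (rule ev_delta_small) simp
  moreover have "\<forall>\<^sub>F n in \<F>. n \<ge> nat \<lceil>B'\<rceil>" by (rule ev_large)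
  moreover note ev_delta ev_degree
  ultimately show ?thesis
  proof eventually_elim
    case (elim n)
    have n: "real n > 0" "real (d n) > 0" "n \<ge> 3" "real r > 0" using elim r by auto
    have rM: "real r * M n = real n * d n" using elim(4) by (metis of_nat_mult)
    then have M: "real (M n) = real n * d n / r" using n by (simp add: field_simps)
    have "1 \<le> ln (real n)"
    proof -
      have "exp 1 \<le> real n" using exp_le n(3) by (metis numeral_le_real_of_nat_iff order_trans)
      then show ?thesis using n by (simp add: ln_ge_iff)
    qed
    have "B' \<le> real n" using elim(2) by linarith
    then have "B \<le> C ^ 3 * n / r" unfolding B'_def using n C0 by (simp add: field_simps)
    also have "\<dots> \<le> C ^ 3 * n * ln n / r"
    proof (rule divide_right_mono)
      have "0 \<le> C ^ 3 * n" using C0 by simp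
      from mult_left_mono[OF \<open>1 \<le> ln (real n)\<close> this] show "C ^ 3 * n \<le> C ^ 3 * n * ln n" by simp
    qed (use n in simp)
    also have "\<dots> = C ^ 3 * (ln n / d n) * M n" unfolding M using n by simp
    also have "\<dots> \<le> \<delta> n ^ 3 * M n" using elim(3) by (intro mult_right_mono) auto
    also have "\<dots> \<le> \<delta> n ^ 2 * M n" using elim(1,3) by (intro mult_right_mono power_decreasing) auto
    finally show ?case .
  qed
qed

lemma ev_loss: "\<forall>\<^sub>F n in \<F>. switching_loss r n (d n) \<le> K1 * \<delta> n"
  using ev_delta ev_degree
proof eventually_elim
  case (elim n)
  have n: "real n > 0" using elim by simp
  have 1: "1 / n \<le> \<delta> n / C" and 2: "d n / real n ^ (r - 1) \<le> \<delta> n / C"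
    using elim(1) C0 by (auto simp: field_simps)
  have "switching_loss r n (d n) = 2 * real r ^ 4 * (1 / n)
      + fact r * (2 * real r) ^ (r - 1) * (d n / real n ^ (r - 1))"
    unfolding switching_loss_def by (simp add: power_divide)
  also have "\<dots> \<le> 2 * real r ^ 4 * (\<delta> n / C) + fact r * (2 * real r) ^ (r - 1) * (\<delta> n / C)"
    using 1 2 by (intro add_mono mult_left_mono) auto
  also have "\<dots> = K1 * \<delta> n" unfolding K1_def using C0 by (simp add: field_simps)
  finally show ?case .
qed

text \<open>Bounded degree gives \<open>k = O(n)\<close>, while \<open>M = n * d / r\<close>. So a
  copy uses a share \<open>O(1 / d)\<close> of the edges, and \<open>1 / d\<close> is a summand of
  \<open>eps_nd\<close>.\<close>

lemma ev_card_H: "c > 0 \<Longrightarrow> \<forall>\<^sub>F n in \<F>. k n \<le> c * \<bar>\<eta> n\<bar> * M n"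
proof -
  assume c: "c > 0"
  obtain D where D: "D > 0" "\<forall>\<^sub>F n in \<F>. norm (real (maxdeg n (H n))) \<le> D * norm (1::real)"
    using landau_o.bigE[OF H_deg] by blast
  have "\<forall>\<^sub>F n in \<F>. eps_nd r n (d n) \<le> c / D * \<bar>\<eta> n\<bar>" by (rule ev_eps_eta) (use c D in simp)
  with D(2) ev_degree show ?thesis
  proof eventually_elim
    case (elim n)
    have n: "real n > 0" "real (d n) > 0" "real r > 0" using elim r by auto
    have rM: "real r * M n = real n * d n" using elim(2) by (metis of_nat_mult)
    have "1 / d n \<le> eps_nd r n (d n)" by (simp add: eps_nd_def)
    then have "1 / d n \<le> c / D * \<bar>\<eta> n\<bar>" using elim(3) by linarith
    then have Dd: "D \<le> c * \<bar>\<eta> n\<bar> * d n" using n D by (simp add: field_simps)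
    have "real (r * k n) \<le> real (n * maxdeg n (H n))"
      using card_le_maxdeg[OF H_graph[of n]] by (rule of_nat_mono)
    then have "real r * k n \<le> real n * D"
      using elim(1) mult_left_mono[of "real (maxdeg n (H n))" D "real n"] by simp
    also have "\<dots> \<le> real n * (c * \<bar>\<eta> n\<bar> * d n)" using Dd by (intro mult_left_mono) auto
    also have "\<dots> = real r * (c * \<bar>\<eta> n\<bar> * M n)" using rM by (simp add: mult_ac)
    finally show ?case using n by simp
  qed
qed

text \<open>The unit of an error budget. The factor \<open>1 + \<eta>\<close> has to absorb
  \<open>r\<close> factors \<open>1 / (1 - \<sigma>)\<close>, of which \<open>r - 1\<close> come
  from \<open>M / (M - k)\<close> and one from the switching, and a density deficit
  \<open>3 * \<sigma>\<close>: together \<open>(r + 3) * \<sigma> = \<eta> / 2\<close>. The other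
  half of \<eta> covers the quadratic term.\<close>

definition \<sigma> where "\<sigma> n = \<eta> n / (2 * (real r + 3))"

lemma ev_markov_base: "\<forall>\<^sub>F n in \<F>. 0 < \<eta> n \<longrightarrow>
   (real (M n) / N n) * (real (M n) / (real (M n) - k n)) ^ (r - 1) / (1 - switching_loss r n (d n))
    \<le> (1 + \<eta> n) * (real (M n) / N n * (1 - 3 * \<sigma> n))"
proof -
  define c where "c = 1 / (2 * (real r + 3))"
  have c: "c > 0" "c < 1" by (auto simp: c_def field_simps)
  have "\<forall>\<^sub>F n in \<F>. \<delta> n \<le> c / (K1 + 1) * \<bar>\<eta> n\<bar>"
    by (rule ev_delta_eta) (use c K1_nonneg in simp)
  moreover have "\<forall>\<^sub>F n in \<F>. \<bar>\<eta> n\<bar> \<le> 1" by (rule ev_eta_small) simp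
  moreover note ev_card_H[OF c(1)] ev_loss ev_degree ev_delta
  ultimately show ?thesis
  proof eventually_elim
    case (elim n)
    show ?case
    proof
      assume \<eta>0: "0 < \<eta> n"
      have \<sigma>c: "\<sigma> n = c * \<eta> n" by (simp add: \<sigma>_def c_def)
      have \<sigma>: "0 < \<sigma> n" "\<sigma> n < 1"
      proof -
        show "0 < \<sigma> n" using \<sigma>c c \<eta>0 by simp
        have "c * \<eta> n \<le> c * 1" using elim(2) c \<eta>0 by (intro mult_left_mono) auto
        then have "c * \<eta> n < 1" using c(2) by linarith
        then show "\<sigma> n < 1" by (simp only: \<sigma>c)
      qed
      have M: "real (M n) > 0" using elim(5) by simp
      have kM: "k n \<le> \<sigma> n * M n" using elim(3) \<eta>0 by (simp add: \<sigma>c)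
      have loss: "switching_loss r n (d n) \<le> \<sigma> n"
      proof -
        have "(K1 + 1) * \<delta> n \<le> \<sigma> n" using elim(1) \<eta>0 K1_nonneg by (simp add: \<sigma>c field_simps)
        then have "K1 * \<delta> n \<le> \<sigma> n" using elim(6) by (simp add: algebra_simps)
        then show ?thesis using elim(4) by simp
      qed
      define q where "q = 1 / (1 - \<sigma> n)"
      have q: "q \<ge> 0" using \<sigma> by (simp add: q_def)
      have Mk: "(1 - \<sigma> n) * M n \<le> real (M n) - k n" using kM by (simp add: algebra_simps)
      have pos: "(1 - \<sigma> n) * M n > 0" using M \<sigma> by simp
      have Mk0: "0 \<le> real (M n) - k n" using Mk pos by linarith
      have "real (M n) / (real (M n) - k n) \<le> real (M n) / ((1 - \<sigma> n) * M n)"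
        by (rule divide_left_mono[OF Mk _ mult_pos_pos[OF _ pos]]) (use Mk pos in linarith)+
      also have "\<dots> = q" using M by (simp add: q_def)
      finally have "(real (M n) / (real (M n) - k n)) ^ (r - 1) \<le> q ^ (r - 1)"
        by (rule power_mono) (intro divide_nonneg_nonneg Mk0 of_nat_0_le_iff)
      moreover have "1 / (1 - switching_loss r n (d n)) \<le> q"
        unfolding q_def using loss \<sigma> by (intro divide_left_mono mult_pos_pos) auto
      ultimately have "(real (M n) / (real (M n) - k n)) ^ (r - 1) * (1 / (1 - switching_loss r n (d n))) \<le> q ^ (r - 1) * q"
        using q loss \<sigma> by (intro mult_mono) auto
      also have "q ^ (r - 1) * q = q ^ r" using r by (cases r) auto
      also have "q ^ r \<le> (1 + \<eta> n) * (1 - 3 * \<sigma> n)"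
      proof -
        have "\<eta> n = 2 * (real r + 3) * \<sigma> n" unfolding \<sigma>_def by simp
        then have half: "(real r + 3) * \<sigma> n = \<eta> n / 2" by (simp add: field_simps)
        have 3: "0 \<le> 1 - 3 * \<sigma> n"
        proof -
          have "3 * \<sigma> n \<le> (real r + 3) * \<sigma> n" using \<sigma> by (intro mult_right_mono) auto
          then show ?thesis using half elim(2) by simp
        qed
        have "\<eta> n * \<eta> n \<le> \<eta> n" using elim(2) \<eta>0 by (simp add: mult_le_cancel_right1)
        then have "1 \<le> (1 + \<eta> n) * (1 - \<eta> n / 2)" by (simp add: algebra_simps)
        also have "1 - \<eta> n / 2 = 1 - (real r + 3) * \<sigma> n" using half by simp
        also have "\<dots> \<le> (1 - 3 * \<sigma> n) * (1 - r * \<sigma> n)" using \<sigma> by (simp add: algebra_simps)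
        also have "\<dots> \<le> (1 - 3 * \<sigma> n) * (1 - \<sigma> n) ^ r"
          using one_minus_power_ge[of "\<sigma> n" r] \<sigma> 3 by (intro mult_left_mono) auto
        finally have "1 \<le> (1 + \<eta> n) * ((1 - 3 * \<sigma> n) * (1 - \<sigma> n) ^ r)" using \<eta>0 by simp
        then show ?thesis using \<sigma> unfolding q_def by (simp add: power_divide divide_le_eq mult.assoc)
      qed
      finally have "real (M n) / N n * ((real (M n) / (real (M n) - k n)) ^ (r - 1) * (1 / (1 - switching_loss r n (d n))))
          \<le> real (M n) / N n * ((1 + \<eta> n) * (1 - 3 * \<sigma> n))"
        by (intro mult_left_mono) auto
      then show "(real (M n) / N n) * (real (M n) / (real (M n) - k n)) ^ (r - 1) / (1 - switching_loss r n (d n))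
        \<le> (1 + \<eta> n) * (real (M n) / N n * (1 - 3 * \<sigma> n))" by (simp add: mult_ac)
    qed
  qed
qed

lemma ev_Reg: "\<forall>\<^sub>F n in \<F>. Reg r n (d n) \<noteq> {}"
  using ev_degree
proof eventually_elim
  case (elim n)
  then have "r dvd n * d n" by (metis dvd_triv_left)
  then show ?case using Reg_nonempty[of r n "d n"] elim r by auto
qed

end

text \<open>What the binomial and the uniform model have in common. \<open>p1\<close> is a density
  close to that of the regular graph with \<open>card (\<C> n) * p1 n ^ k n\<close> below the
  expectation, and \<open>slice\<close> says that, up to a vanishing error, \<open>Q\<close> has at
  least as heavy upper tails as the uniform graph with slightly fewer edges.\<close>

locale model = regime +
  fixes Q :: "nat \<Rightarrow> nat set set pmf" and Y p1 :: "nat \<Rightarrow> real" and cp :: "nat \<Rightarrow> (nat set set \<times> nat set set) pmf"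
  assumes hyp: "concentrated Q \<eta> Y"
    and Y: "\<forall>\<^sub>F n in \<F>. Y n > 0" and Y0: "\<And>n. k n = 0 \<Longrightarrow> Y n = 1"
    and p1: "\<forall>\<^sub>F n in \<F>. 0 < \<eta> n \<longrightarrow> 0 \<le> p1 n \<and> card (\<C> n) * p1 n ^ k n \<le> Y n \<and>
       real (M n) / N n * (1 - 3 * \<sigma> n) \<le> p1 n"
    and slice: "\<And>e. e > 0 \<Longrightarrow> \<forall>\<^sub>F n in \<F>. \<forall>y. slice_mean (rsets r n) (nat \<lfloor>(1 - 2 * \<delta> n) * M n\<rfloor>)
        (indicator (many n y)) \<le> measure_pmf.prob (Q n) (many n y) + e"
    and cp: "\<forall>\<^sub>F n in \<F>. map_pmf fst (cp n) = Q n \<and> map_pmf snd (cp n) = G_reg n"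
    and sub: "((\<lambda>n. measure_pmf.prob (cp n) {x. fst x \<subseteq> snd x}) \<longlongrightarrow> 1) \<F>"
begin

abbreviation "typical n \<equiv> {G. pm_approx (\<eta> n) (k n) (real (copies n (H n) G)) (Y n)}"

lemma ev_upper_tail:
  "\<forall>\<^sub>F n in \<F>. 0 < \<eta> n \<longrightarrow> 0 < k n \<longrightarrow> upper_tail r n (d n) (M n) (k n) (\<delta> n) K1 K (\<eta> n) (Y n) (p1 n) (\<C> n)"
proof -
  have K: "K > 0" "K1 + r + 5 \<le> K" using K1_nonneg by (auto simp: K_def)
  have "\<forall>\<^sub>F n in \<F>. \<delta> n \<le> min (1 / (2 * (K1 + 1))) (1 / (2 * (K + 1)))"
    by (rule ev_delta_small) (use K1_nonneg K in auto)
  moreover have "\<forall>\<^sub>F n in \<F>. k n \<le> 1 * \<bar>\<eta> n\<bar> * M n" by (rule ev_card_H) simp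
  moreover have "\<forall>\<^sub>F n in \<F>. \<bar>\<eta> n\<bar> \<le> 1 / 3" by (rule ev_eta_small) simp
  moreover note ev_delta_M[of 1] ev_loss ev_degree ev_delta ev_Reg ev_markov_base Y p1
  ultimately show ?thesis
  proof eventually_elim
    case (elim n)
    show ?case
    proof (intro impI)
      assume \<eta>0: "0 < \<eta> n" and k0: "0 < k n"
      have \<delta>0: "\<delta> n > 0" using elim(7) by simp
      have M: "real (M n) > 0" using elim(6) by simp
      show "upper_tail r n (d n) (M n) (k n) (\<delta> n) K1 K (\<eta> n) (Y n) (p1 n) (\<C> n)"
      proof
        show "2 * k n < M n"
        proof -
          have "k n \<le> \<eta> n * M n" using elim(2) \<eta>0 by simp
          also have "\<dots> \<le> 1 / 3 * M n" using elim(3) by (intro mult_right_mono) auto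
          finally show ?thesis using M by simp
        qed
        have "K1 * \<delta> n \<le> K1 * (1 / (2 * (K1 + 1)))" using elim(1) K1_nonneg by (intro mult_left_mono) auto
        also have "\<dots> \<le> 1 / 2" using K1_nonneg by (simp add: field_simps)
        finally show "K1 * \<delta> n \<le> 1 / 2" .
        have "(K + 1) * \<delta> n \<le> (K + 1) * (1 / (2 * (K + 1)))" using elim(1) K by (intro mult_left_mono) auto
        also have "\<dots> = 1 / 2" using K by (simp add: field_simps)
        finally show "(K + 1) * \<delta> n \<le> 1 / 2" .
        show "8 * (real r + 2) * ln n \<le> K * \<delta> n ^ 3 * d n"
        proof -
          have n: "real n \<ge> 1" "real (d n) > 0" using elim(6) by auto
          have "C ^ 3 * ln n \<le> \<delta> n ^ 3 * d n" using elim(7) n by (simp add: field_simps)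
          moreover have "8 * (real r + 2) \<le> K * C ^ 3"
          proof -
            have "8 * (real r + 2) / C ^ 3 \<le> K" by (simp add: K_def)
            then show ?thesis using C0 by (simp add: pos_divide_le_eq)
          qed
          then have "8 * (real r + 2) * ln n \<le> K * C ^ 3 * ln n" using n by (intro mult_right_mono) auto
          moreover have "K * (C ^ 3 * ln n) \<le> K * (\<delta> n ^ 3 * d n)" using calculation(1) K by (intro mult_left_mono) auto
          ultimately show ?thesis by (simp add: mult.assoc)
        qed
        show "(real (M n) / (n choose r)) * (real (M n) / (real (M n) - k n)) ^ (r - 1) / (1 - switching_loss r n (d n))
            \<le> (1 + \<eta> n) * p1 n"
        proof -
          have "(1 + \<eta> n) * (real (M n) / N n * (1 - 3 * \<sigma> n)) \<le> (1 + \<eta> n) * p1 n"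
            using elim(11) \<eta>0 by (intro mult_left_mono) auto
          then show ?thesis using elim(9) \<eta>0 by linarith
        qed
        show "F \<in> \<C> n \<Longrightarrow> F \<subseteq> rsets r n" "F \<in> \<C> n \<Longrightarrow> card F = k n" for F
          using images_props[OF H_graph[of n]] by auto
        show "finite (\<C> n)" by (rule finite_images[OF H_graph])
        show "\<eta> n \<le> 1 / 3" using elim(3) by simp
        show "1 \<le> (\<delta> n)\<^sup>2 * M n" using elim(4) by simp
      qed (use r K K1_nonneg elim \<eta>0 k0 \<delta>0 in auto)
    qed
  qed
qed

text \<open>The positive quantity \<open>eps_nd\<close> is at most
  \<open>\<bar>\<eta> n\<bar>\<close>, so \<open>\<eta> n\<close> is not 0. If it were negative, the
  lower threshold would exceed the upper one and \<open>typical n\<close> would be empty, although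
  its probability tends to 1.\<close>

lemma ev_eta_pos: "\<forall>\<^sub>F n in \<F>. 0 < k n \<longrightarrow> 0 < \<eta> n"
proof -
  have "\<forall>\<^sub>F n in \<F>. 0 < measure_pmf.prob (Q n) (typical n)"
    using hyp unfolding aas_def by (rule order_tendstoD) simp
  moreover have "\<forall>\<^sub>F n in \<F>. eps_nd r n (d n) \<le> 1 * \<bar>\<eta> n\<bar>" by (rule ev_eps_eta) simp
  moreover have "\<forall>\<^sub>F n in \<F>. \<bar>\<eta> n\<bar> \<le> 1 / 2" by (rule ev_eta_small) simp
  moreover note Y ev_degree
  ultimately show ?thesis
  proof eventually_elim
    case (elim n)
    show ?case
    proof (rule impI, rule ccontr)
      assume k: "0 < k n" and "\<not> 0 < \<eta> n"
      moreover have "0 < 1 / real n" using elim(5) by simp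
      then have "0 < eps_nd r n (d n)" unfolding eps_nd_def by (simp add: add_pos_nonneg)
      then have "\<eta> n \<noteq> 0" using elim(2) by auto
      ultimately have neg: "\<eta> n < 0" by simp
      have "(1 + \<eta> n) ^ k n < (1 - \<eta> n) ^ k n" using neg elim(3) k by (intro power_strict_mono) auto
      then have "(1 + \<eta> n) ^ k n * Y n < (1 - \<eta> n) ^ k n * Y n" using elim(4) by (intro mult_strict_right_mono) auto
      then have "typical n = {}"
        unfolding pm_approx_def by auto
      then show False using elim(1) by simp
    qed
  qed
qed

text \<open>\<open>B\<close> is fixed by the target error \<open>e\<close> alone. If
  \<open>k n * \<eta> n \<ge> B\<close>, the first moment suffices; otherwise
  \<open>1 + k n * \<eta> n\<close> is at most \<open>1 + B\<close>, and
  \<open>\<delta> = o(\<eta>)\<close> provides the smallness needed for domination.\<close>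

lemma upper_tail_vanishes:
  assumes e: "e > 0"
  shows "\<forall>\<^sub>F n in \<F>. measure_pmf.prob ((G_reg n)) {G. (1 + 3 * \<eta> n) ^ k n * Y n < copies n (H n) G} < e"
proof -
  define B where "B = \<bar>ln (2 / e)\<bar> + 1"
  have B: "B > 0" "exp (- B) < e"
  proof -
    have "exp (- B) \<le> exp (- ln (2 / e))" by (simp add: B_def)
    also have "\<dots> = e / 2" using e by (simp add: exp_minus)
    finally show "exp (- B) < e" using e by simp
  qed (simp add: B_def)
  have K_pos: "K > 0" using K1_nonneg by (simp add: K_def)
  have "\<forall>\<^sub>F n in \<F>. \<delta> n \<le> 1 / (2 * (K + 1) * (1 + B)) * \<bar>\<eta> n\<bar>"
    by (rule ev_delta_eta) (use K_pos B in simp)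
  moreover have "\<forall>\<^sub>F n in \<F>. 1 - e / 16 < measure_pmf.prob (Q n) (typical n)"
    using hyp unfolding aas_def by (rule order_tendstoD) (use e in simp)
  moreover have "\<forall>\<^sub>F n in \<F>. n \<ge> nat \<lceil>16 / e\<rceil>" by (rule ev_large)
  moreover have "\<forall>\<^sub>F n in \<F>. \<forall>y. slice_mean (rsets r n) (nat \<lfloor>(1 - 2 * \<delta> n) * M n\<rfloor>)
        (indicator (many n y)) \<le> measure_pmf.prob (Q n) (many n y) + e / 16"
    by (rule slice) (use e in simp)
  moreover note ev_upper_tail ev_Reg ev_eta_pos ev_degree
  ultimately show ?thesis
  proof eventually_elim
    case (elim n)
    show ?case
    proof (cases "k n = 0")
      case True
      \<comment> \<open>For empty \<open>H\<close> there is always exactly one copy and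
        \<open>Y n = 1\<close>, so the strict excess is impossible whatever the sign of
        \<open>\<eta> n\<close>.\<close>
      then have "H n = {}" using H_graph[of n] finite_subset[OF _ finite_rsets] by (metis card_0_eq)
      then have "{G. (1 + 3 * \<eta> n) ^ k n * Y n < copies n (H n) G} = {}"
        using True Y0[OF True] by (simp add: copies_empty)
      then show ?thesis using e by simp
    next
      case False
      then have \<eta>0: "0 < \<eta> n" using elim(7) by simp
      interpret upper_tail r n "d n" "M n" "k n" "\<delta> n" K1 K "\<eta> n" "Y n" "p1 n" "\<C> n"
        using elim(5) \<eta>0 False by simp
      have fail: "measure_pmf.prob ((G_reg n)) {G. (1 + 3 * \<eta> n) ^ k n * Y n < copies n (H n) G} = failure"
        unfolding copies_eq failure_def by (rule prob_Gnd[OF elim(6)])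
      show ?thesis
      proof (cases "B \<le> k n * \<eta> n")
        case True
        then have "exp (- (k n * \<eta> n)) \<le> exp (- B)" by simp
        then show ?thesis unfolding fail using failure_le_exp B by linarith
      next
        case False
        have "(K + 1) * (\<delta> n / \<eta> n) * (1 + k n * \<eta> n) \<le> (K + 1) * (1 / (2 * (K + 1) * (1 + B))) * (1 + B)"
        proof (intro mult_mono)
          show "\<delta> n / \<eta> n \<le> 1 / (2 * (K + 1) * (1 + B))" using elim(1) \<eta>0 by (simp add: pos_divide_le_eq)
        qed (use False K_pos B \<eta>0 \<delta>(1) in auto)
        also have "\<dots> = 1 / 2"
        proof -
          have "K + 1 \<noteq> 0" "1 + B \<noteq> 0" using K_pos B by auto
          then show ?thesis by simp
        qed
        finally have small: "(K + 1) * (\<delta> n / \<eta> n) * (1 + k n * \<eta> n) \<le> 1 / 2" .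
        let ?y = "(1 + \<eta> n) ^ k n * Y n"
        have "measure_pmf.prob (Q n) (many n ?y)
          \<le> 1 - measure_pmf.prob (Q n) (typical n)"
        proof -
          have "many n ?y \<subseteq> - typical n"
            by (auto simp: pm_approx_def copies_eq)
          then have "measure_pmf.prob (Q n) (many n ?y)
            \<le> measure_pmf.prob (Q n) (- typical n)"
            by (intro measure_pmf.finite_measure_mono) auto
          also have "\<dots> = 1 - measure_pmf.prob (Q n) (typical n)"
            using measure_pmf.prob_compl[of "typical n" "Q n"]
            by (simp add: Compl_eq_Diff_UNIV)
          finally show ?thesis .
        qed
        then have "slice_mean (rsets r n) L (indicator (many n ?y)) < e / 16 + e / 16"
          using elim(2) elim(4)[rule_format, of ?y] unfolding L_def by linarith
        moreover have "1 / n \<le> e / 16"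
        proof -
          have "16 / e \<le> n" using elim(3) by linarith
          then show ?thesis using e n by (simp add: field_simps)
        qed
        \<comment> \<open>Three errors of \<open>e / 16\<close>, multiplied by the factor 4 of
          \<open>failure_le_slice_mean\<close>, stay below \<open>e\<close>.\<close>
        moreover have "f < e" if "s < e / 16 + e / 16" "t \<le> e / 16" "f \<le> 4 * (s + t)" for f s t :: real
          using that e by argo
        ultimately show ?thesis unfolding fail using failure_le_slice_mean[OF small] by blast
      qed
    qed
  qed
qed

lemma lower_tail_vanishes:
  assumes e: "e > 0"
  shows "\<forall>\<^sub>F n in \<F>. measure_pmf.prob ((G_reg n)) {G. copies n (H n) G < (1 - 3 * \<eta> n) ^ k n * Y n} < e"
proof -
  have "\<forall>\<^sub>F n in \<F>. 1 - e / 2 < measure_pmf.prob (cp n) {x. fst x \<subseteq> snd x}"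
    using sub by (rule order_tendstoD) (use e in simp)
  moreover have "\<forall>\<^sub>F n in \<F>. 1 - e / 2 < measure_pmf.prob (Q n) (typical n)"
    using hyp unfolding aas_def by (rule order_tendstoD) (use e in simp)
  moreover have "\<forall>\<^sub>F n in \<F>. \<bar>\<eta> n\<bar> \<le> 1 / 3" by (rule ev_eta_small) simp
  moreover note cp ev_eta_pos Y
  ultimately show ?thesis
  proof eventually_elim
    case (elim n)
    let ?A = "{x. fst x \<subseteq> snd x} :: (nat set set \<times> nat set set) set"
    let ?G = "typical n"
    let ?Z = "{G. real (copies n (H n) G) < (1 - 3 * \<eta> n) ^ k n * Y n}"
    have compl: "measure_pmf.prob p (- S) = 1 - measure_pmf.prob p S" for p :: "'z pmf" and S
      using measure_pmf.prob_compl[of S p] by (simp add: Compl_eq_Diff_UNIV)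
    have incl: "snd -` ?Z \<subseteq> - ?A \<union> - (fst -` ?G)"
    proof (rule subsetI, rule ccontr)
      fix x assume x: "x \<in> snd -` ?Z" and "x \<notin> - ?A \<union> - (fst -` ?G)"
      then have s: "fst x \<subseteq> snd x" and g: "(1 - \<eta> n) ^ k n * Y n \<le> copies n (H n) (fst x)"
        by (auto simp: pm_approx_def)
      \<comment> \<open>\<open>\<bar>\<eta> n\<bar> \<le> 1 / 3\<close> keeps the bases nonnegative.
        For \<open>k n = 0\<close>, where the sign of \<open>\<eta> n\<close> is unknown, both
        powers are 1.\<close>
      have "(1 - 3 * \<eta> n) ^ k n \<le> (1 - \<eta> n) ^ k n"
        using elim(3,5) by (cases "k n = 0") (auto intro!: power_mono)
      then have "(1 - 3 * \<eta> n) ^ k n * Y n \<le> (1 - \<eta> n) ^ k n * Y n" using elim(6) by (intro mult_right_mono) auto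
      also note g
      also have "real (copies n (H n) (fst x)) \<le> copies n (H n) (snd x)"
        unfolding copies_eq using ncopies_mono[OF finite_images[OF H_graph] s] by simp
      finally show False using x by simp
    qed
    have "measure_pmf.prob ((G_reg n)) ?Z = measure_pmf.prob (map_pmf snd (cp n)) ?Z" using elim(4) by simp
    also have "\<dots> = measure_pmf.prob (cp n) (snd -` ?Z)" by (rule measure_map_pmf)
    also have "\<dots> \<le> measure_pmf.prob (cp n) (- ?A \<union> - (fst -` ?G))"
      using incl by (intro measure_pmf.finite_measure_mono) auto
    also have "\<dots> \<le> measure_pmf.prob (cp n) (- ?A) + measure_pmf.prob (cp n) (- (fst -` ?G))"
      by (rule measure_Un_le) auto
    also have "\<dots> = (1 - measure_pmf.prob (cp n) ?A) + (1 - measure_pmf.prob (map_pmf fst (cp n)) ?G)"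
      unfolding compl measure_map_pmf ..
    also have "\<dots> < e / 2 + e / 2" using elim(1,2,4) by (intro add_strict_mono) auto
    finally show ?case by simp
  qed
qed

theorem transfer: "concentrated G_reg (\<lambda>n. 3 * \<eta> n) Y"
  unfolding aas_def
proof (rule tendstoI)
  fix e :: real assume e: "e > 0"
  have "\<forall>\<^sub>F n in \<F>. measure_pmf.prob ((G_reg n)) {G. (1 + 3 * \<eta> n) ^ k n * Y n < copies n (H n) G} < e / 2"
    by (rule upper_tail_vanishes) (use e in auto)
  moreover have "\<forall>\<^sub>F n in \<F>. measure_pmf.prob ((G_reg n)) {G. copies n (H n) G < (1 - 3 * \<eta> n) ^ k n * Y n} < e / 2"
    by (rule lower_tail_vanishes) (use e in auto)
  ultimately show "\<forall>\<^sub>F n in \<F>. dist (measure_pmf.prob ((G_reg n))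
      {G. pm_approx (3 * \<eta> n) (k n) (real (copies n (H n) G)) (Y n)}) 1 < e"
  proof eventually_elim
    case (elim n)
    let ?S = "{G. pm_approx (3 * \<eta> n) (k n) (real (copies n (H n) G)) (Y n)}"
    let ?U = "{G. (1 + 3 * \<eta> n) ^ k n * Y n < copies n (H n) G}"
    let ?Z = "{G. copies n (H n) G < (1 - 3 * \<eta> n) ^ k n * Y n}"
    have "- ?S \<subseteq> ?U \<union> ?Z" by (auto simp: pm_approx_def)
    then have "measure_pmf.prob ((G_reg n)) (- ?S) \<le> measure_pmf.prob ((G_reg n)) (?U \<union> ?Z)"
      by (intro measure_pmf.finite_measure_mono) auto
    also have "\<dots> \<le> measure_pmf.prob ((G_reg n)) ?U + measure_pmf.prob ((G_reg n)) ?Z"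
      by (rule measure_Un_le) auto
    finally have "1 - measure_pmf.prob ((G_reg n)) ?S < e"
      using elim measure_pmf.prob_compl[of ?S "G_reg n"] by (simp add: Compl_eq_Diff_UNIV)
    then show ?case using measure_pmf.prob_le_1[of "G_reg n" ?S] by (simp add: dist_real_def)
  qed
qed

end

section \<open>The binomial and the uniform model\<close>

context regime
begin

text \<open>Both quotients are the edge density of a \<open>d\<close>-regular graph, by
  \<open>n * ((n - 1) choose (r - 1)) = r * N\<close> and \<open>n * d = r * M\<close>. They relate
  \<open>p_d\<close> to \<open>M\<close>.\<close>

lemma ev_model:
  "\<forall>\<^sub>F n in \<F>. n > 0 \<and> r * M n = n * d n \<and> real (d n) / ((n - 1) choose (r - 1)) = real (M n) / N n \<and>
    N n > 0 \<and> 0 < \<delta> n \<and> \<delta> n \<le> 1 / 4 \<and> M n \<le> N n \<and> M n > 0"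
  using ev_degree ev_delta ev_delta_small[of "1/4", simplified]
proof eventually_elim
  case (elim n)
  have N: "real n * ((n - 1) choose (r - 1)) = real r * N n"
    using times_binomial_minus1_eq[of r n] r by (metis of_nat_mult not_numeral_le_zero gr0I)
  have rM: "real r * M n = real n * d n" using elim by (metis of_nat_mult)
  have pos: "real n > 0" "real r > 0" "real (N n) > 0" using elim r by auto
  then have "real ((n - 1) choose (r - 1)) > 0" using N by (metis mult_pos_pos zero_less_mult_pos)
  then have "real (d n) / ((n - 1) choose (r - 1)) = (real n * d n) / (real n * ((n - 1) choose (r - 1)))"
    using pos by simp
  also have "\<dots> = real (M n) / N n" unfolding N rM[symmetric] using pos by simp
  finally show ?case using elim pos by auto
qed

lemma p_d_eq: "\<forall>\<^sub>F n in \<F>. p_d r C n (d n) = (1 - \<delta> n) * (real (M n) / N n) \<and> 0 < p_d r C n (d n) \<and> p_d r C n (d n) \<le> 1"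
  using ev_model
proof eventually_elim
  case (elim n)
  have "p_d r C n (d n) = (1 - \<delta> n) * (real (d n) / ((n - 1) choose (r - 1)))"
    by (simp add: p_d_def)
  then have 1: "p_d r C n (d n) = (1 - \<delta> n) * (real (M n) / N n)"
    using elim by (simp only:)
  have "real (M n) / N n \<le> 1" "0 < real (M n) / N n" using elim by auto
  then have "(1 - \<delta> n) * (real (M n) / N n) \<le> 1 * 1" "0 < (1 - \<delta> n) * (real (M n) / N n)"
    using elim by (intro mult_mono, auto)
  then show ?case using 1 by simp
qed

lemma m_d_bounds: "\<forall>\<^sub>F n in \<F>. (1 - \<delta> n) * M n - 1 \<le> m_d r C n (d n) \<and> m_d r C n (d n) \<le> N n \<and>
    nat \<lfloor>(1 - 2 * \<delta> n) * M n\<rfloor> \<le> m_d r C n (d n)"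
  using ev_model
proof eventually_elim
  case (elim n)
  have "real r * M n = real n * d n" using elim by (metis of_nat_mult)
  then have "(1 - \<delta> n) * real n * real (d n) / real r = (1 - \<delta> n) * M n"
    using r by (simp add: field_simps)
  then have m: "m_d r C n (d n) = nat \<lfloor>(1 - \<delta> n) * M n\<rfloor>" by (simp add: m_d_def)
  have "(1 - 2 * \<delta> n) * M n \<le> (1 - \<delta> n) * M n" using elim by (intro mult_right_mono) auto
  then have 1: "nat \<lfloor>(1 - 2 * \<delta> n) * M n\<rfloor> \<le> m_d r C n (d n)"
    unfolding m by (intro nat_mono floor_mono)
  have "0 \<le> (1 - \<delta> n) * M n" using elim by (intro mult_nonneg_nonneg) auto
  then have "m_d r C n (d n) \<le> (1 - \<delta> n) * M n" unfolding m by simp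
  also have "\<dots> \<le> 1 * real (M n)" using elim by (intro mult_right_mono) auto
  finally have 2: "m_d r C n (d n) \<le> N n" using elim by simp
  have "(1 - \<delta> n) * M n - 1 \<le> m_d r C n (d n)" unfolding m by linarith
  then show ?case using 1 2 by simp
qed

lemma ev_delta_sigma: "\<forall>\<^sub>F n in \<F>. 0 < \<eta> n \<longrightarrow> \<delta> n \<le> \<sigma> n"
proof -
  have c: "1 / (2 * (real r + 3)) > 0" by simp
  show ?thesis using ev_delta_eta[OF c] by eventually_elim (auto simp: \<sigma>_def)
qed

lemma card_images_empty: "k n = 0 \<Longrightarrow> real (copies n (H n) G) = 1"
  using H_graph[of n] finite_subset[OF _ finite_rsets] by (metis card_0_eq copies_empty of_nat_1)

lemma images_facts: "finite (\<C> n)" "\<And>F. F \<in> \<C> n \<Longrightarrow> F \<subseteq> rsets r n" "\<And>F. F \<in> \<C> n \<Longrightarrow> card F = k n"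
  using finite_images[OF H_graph] images_props[OF H_graph] by auto

text \<open>Here \<open>p1\<close> is \<open>p_d\<close> itself. The condition \<open>slice\<close>
  holds because the number of edges has mean \<open>(1 - \<delta>) * M\<close> and falls below
  \<open>(1 - 2 * \<delta>) * M\<close> with probability tending to 0.\<close>

lemma Gnp_case:
  assumes hyp: "concentrated G_bin \<eta> (mean_copies G_bin)"
    and cp: "\<forall>\<^sub>F n in \<F>. map_pmf fst (cp n) = G_bin n \<and> map_pmf snd (cp n) = G_reg n"
    and sub: "((\<lambda>n. measure_pmf.prob (cp n) {x. fst x \<subseteq> snd x}) \<longlongrightarrow> 1) \<F>"
  shows "concentrated G_reg (\<lambda>n. 3 * \<eta> n) (mean_copies G_bin)"
proof (rule model.transfer[OF model.intro[OF regime_axioms model_axioms.intro[OF hyp _ _ _ _ cp sub]]])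
  let ?Y = "mean_copies G_bin"
  let ?p = "\<lambda>n. p_d r C n (d n)"
  have Y: "\<forall>\<^sub>F n in \<F>. ?Y n = card (\<C> n) * ?p n ^ k n"
    using p_d_eq
  proof eventually_elim
    case (elim n)
    then show ?case unfolding copies_eq by (intro expectation_ncopies_Gnp images_facts) auto
  qed
  show "\<forall>\<^sub>F n in \<F>. ?Y n > 0"
    using Y p_d_eq
  proof eventually_elim
    case (elim n)
    then show ?case using card_images_pos[OF H_graph[of n]] by simp
  qed
  show "?Y n = 1" if "k n = 0" for n using card_images_empty[OF that] by simp
  show "\<forall>\<^sub>F n in \<F>. 0 < \<eta> n \<longrightarrow> 0 \<le> ?p n \<and> card (\<C> n) * ?p n ^ k n \<le> ?Y n \<and> real (M n) / N n * (1 - 3 * \<sigma> n) \<le> ?p n"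
    using Y p_d_eq ev_delta_sigma ev_delta
  proof eventually_elim
    case (elim n)
    show ?case
    proof
      assume \<eta>: "0 < \<eta> n"
      then have "\<sigma> n > 0" by (simp add: \<sigma>_def)
      then have "real (M n) / N n * (1 - 3 * \<sigma> n) \<le> real (M n) / N n * (1 - \<delta> n)"
        using elim \<eta> by (intro mult_left_mono) auto
      then show "0 \<le> ?p n \<and> card (\<C> n) * ?p n ^ k n \<le> ?Y n \<and> real (M n) / N n * (1 - 3 * \<sigma> n) \<le> ?p n"
        using elim by (simp add: mult.commute)
    qed
  qed
  fix e :: real assume e: "e > 0"
  \<comment> \<open>Makes the tail bound \<open>exp (- \<delta>\<^sup>2 * M / 8)\<close> obtained
    below at most \<open>e\<close>.\<close>
  have "\<forall>\<^sub>F n in \<F>. 8 * \<bar>ln e\<bar> \<le> \<delta> n ^ 2 * M n" by (rule ev_delta_M)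
  with ev_model p_d_eq show "\<forall>\<^sub>F n in \<F>. \<forall>y. slice_mean (rsets r n) (nat \<lfloor>(1 - 2 * \<delta> n) * M n\<rfloor>)
        (indicator (many n y)) \<le> measure_pmf.prob (G_bin n) (many n y) + e"
  proof eventually_elim
    case (elim n)
    define L where "L = nat \<lfloor>(1 - 2 * \<delta> n) * M n\<rfloor>"
    \<comment> \<open>The exponent per edge is
      \<open>x\<^sup>2 - \<delta> * x - \<delta> * x\<^sup>2\<close>; this choice minimises its
      leading part.\<close>
    define x where "x = \<delta> n / 2"
    have \<delta>: "0 < \<delta> n" "\<delta> n \<le> 1 / 4" and M: "M n > 0" "M n \<le> N n" using elim by auto
    have "0 \<le> (1 - 2 * \<delta> n) * M n" using \<delta> by (intro mult_nonneg_nonneg) auto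
    then have L1: "L \<le> (1 - 2 * \<delta> n) * M n" by (simp add: L_def)
    also have "\<dots> \<le> 1 * real (M n)" using \<delta> by (intro mult_right_mono) auto
    finally have LN: "L \<le> card (rsets r n)" using M by (simp add: card_rsets)
    have Np: "N n * ?p n = (1 - \<delta> n) * M n" using elim M by simp
    have rn: "rsets r n \<noteq> {}" using M card_rsets[of r n] by (metis card.empty gr_zeroI le_zero_eq less_numeral_extra(3))
    have "x * L - N n * ?p n * (x - x\<^sup>2) \<le> x * ((1 - 2 * \<delta> n) * M n) - (1 - \<delta> n) * M n * (x - x\<^sup>2)"
      unfolding Np using L1 \<delta> by (intro diff_right_mono mult_left_mono) (auto simp: x_def)
    also have "\<dots> = - (\<delta> n ^ 2 * M n) / 4 * (1 + \<delta> n)"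
      by (simp add: x_def power2_eq_square field_simps)
    also have "\<dots> \<le> - (\<delta> n ^ 2 * M n) / 8"
    proof -
      have "\<delta> n ^ 2 * M n * 1 \<le> \<delta> n ^ 2 * M n * (1 + \<delta> n)" using \<delta> by (intro mult_left_mono) auto
      moreover have "0 \<le> \<delta> n ^ 2 * M n" by simp
      moreover have "- u / 4 * w \<le> - u / 8" if "u * 1 \<le> u * w" "0 \<le> u" for u w :: real
      proof -
        have "- u / 4 * w = - (u * w) / 4" by simp
        then show ?thesis using that by linarith
      qed
      ultimately show ?thesis by blast
    qed
    also have "\<dots> \<le> - \<bar>ln e\<bar>" using elim(3) by simp
    also have "\<dots> \<le> ln e" by simp
    finally have ex: "exp (x * L - N n * ?p n * (x - x\<^sup>2)) \<le> e" using e by (metis exp_le_cancel_iff exp_ln)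
    show ?case
    proof
      fix y
      have "slice_mean (rsets r n) L (indicator (many n y))
         \<le> measure_pmf.prob (G_bin n) (many n y)
           + exp (x * L - card (rsets r n) * ?p n * (x - x\<^sup>2))"
        by (rule slice_mean_le_prob_Gnp[OF _ _ rn increasing_ncopies[OF images_facts(1)] LN])
           (use elim \<delta> in \<open>auto simp: x_def\<close>)
      then show "slice_mean (rsets r n) (nat \<lfloor>(1 - 2 * \<delta> n) * M n\<rfloor>)
        (indicator (many n y)) \<le> measure_pmf.prob (G_bin n) (many n y) + e"
        using ex unfolding card_rsets L_def by linarith
    qed
  qed
qed

text \<open>The three units of \<open>\<sigma>\<close> pay for the factor
  \<open>1 - \<delta>\<close>, for rounding in \<open>m_d\<close>, and for the \<open>k\<close>
  edges of a copy.\<close>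

lemma ev_m_d_minus:
  "\<forall>\<^sub>F n in \<F>. 0 < \<bar>\<eta> n\<bar> \<and> real (M n) * (1 - 3 * \<bar>\<sigma> n\<bar>) \<le> real (m_d r C n (d n)) - k n \<and> k n \<le> m_d r C n (d n)"
proof -
  define c where "c = 1 / (2 * (real r + 3))"
  have c: "c > 0" "c < 1" by (auto simp: c_def field_simps)
  have "\<forall>\<^sub>F n in \<F>. \<bar>\<eta> n\<bar> \<le> 1 / 3" by (rule ev_eta_small) simp
  with ev_delta_eta[OF c(1)] ev_eps_eta[OF c(1)] ev_card_H[OF c(1)] m_d_bounds ev_model ev_degree
  show ?thesis
  proof eventually_elim
    case (elim n)
    have \<sigma>: "\<bar>\<sigma> n\<bar> = c * \<bar>\<eta> n\<bar>" by (simp add: \<sigma>_def c_def)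
    have M: "real (M n) > 0" and n: "real n > 0" using elim by auto
    have "1 / real n \<le> eps_nd r n (d n)" by (simp add: eps_nd_def)
    moreover have "0 < 1 / real n" using n by simp
    ultimately have e1: "0 < c * \<bar>\<eta> n\<bar>" using elim(2) by linarith
    \<comment> \<open>One edge of rounding is affordable because \<open>1 / d\<close> is at most
      \<open>\<bar>\<sigma> n\<bar>\<close> and \<open>d \<le> M\<close>.\<close>
    have "1 \<le> \<bar>\<sigma> n\<bar> * M n"
    proof -
      have "1 / d n \<le> eps_nd r n (d n)" by (simp add: eps_nd_def)
      then have "1 / d n \<le> \<bar>\<sigma> n\<bar>" using elim(2) \<sigma> by linarith
      moreover have "real (d n) \<le> M n"
      proof -
        have "r * d n \<le> n * d n" using elim(6) by (intro mult_right_mono) auto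
        then have "r * d n \<le> r * M n" using elim(5) by simp
        then show ?thesis using r by simp
      qed
      ultimately have "1 / d n * real (d n) \<le> \<bar>\<sigma> n\<bar> * M n" by (intro mult_mono) auto
      then show ?thesis using elim(6) by simp
    qed
    moreover have "\<delta> n * M n \<le> \<bar>\<sigma> n\<bar> * M n" using elim(1) \<sigma> by (intro mult_right_mono) auto
    moreover have "k n \<le> \<bar>\<sigma> n\<bar> * M n" using elim(3) \<sigma> by simp
    ultimately have 1: "real (M n) * (1 - 3 * \<bar>\<sigma> n\<bar>) \<le> real (m_d r C n (d n)) - k n"
      using elim(4) by (simp add: algebra_simps)
    have "\<bar>\<sigma> n\<bar> \<le> 1 * (1 / 3)" unfolding \<sigma> using c elim(7) by (intro mult_mono) auto
    then have "0 \<le> real (M n) * (1 - 3 * \<bar>\<sigma> n\<bar>)" by (intro mult_nonneg_nonneg) auto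
    then show ?case using 1 e1 c by (auto simp: zero_less_mult_iff)
  qed
qed

text \<open>Here \<open>p1\<close> is \<open>(m_d - k) / N\<close>, from the product bound on the
  expectation. The condition \<open>slice\<close> is plain monotonicity in the number of edges,
  since \<open>m_d\<close> is at least \<open>(1 - 2 * \<delta>) * M\<close> rounded down.\<close>

lemma Gnm_case:
  assumes hyp: "concentrated G_unif \<eta> (mean_copies G_unif)"
    and cp: "\<forall>\<^sub>F n in \<F>. map_pmf fst (cp n) = G_unif n \<and> map_pmf snd (cp n) = G_reg n"
    and sub: "((\<lambda>n. measure_pmf.prob (cp n) {x. fst x \<subseteq> snd x}) \<longlongrightarrow> 1) \<F>"
  shows "concentrated G_reg (\<lambda>n. 3 * \<eta> n) (mean_copies G_unif)"
proof (rule model.transfer[OF model.intro[OF regime_axioms model_axioms.intro[OF hyp _ _ _ _ cp sub]]])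
  let ?m = "\<lambda>n. m_d r C n (d n)"
  let ?Y = "mean_copies G_unif"
  let ?p = "\<lambda>n. (real (?m n) - k n) / N n"
  have Y: "\<forall>\<^sub>F n in \<F>. card (\<C> n) * ?p n ^ k n \<le> ?Y n"
    using m_d_bounds ev_m_d_minus
  proof eventually_elim
    case (elim n)
    then show ?case unfolding copies_eq card_rsets[symmetric]
      by (intro expectation_ncopies_Gnm_ge images_facts) (auto simp: card_rsets)
  qed
  show "?Y n = 1" if "k n = 0" for n using card_images_empty[OF that] by simp
  have "\<forall>\<^sub>F n in \<F>. \<bar>\<eta> n\<bar> \<le> 1 / 3" by (rule ev_eta_small) simp
  with Y ev_m_d_minus ev_model show "\<forall>\<^sub>F n in \<F>. ?Y n > 0"
  proof eventually_elim
    case (elim n)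
    have "\<bar>\<sigma> n\<bar> < 1 / 3"
    proof -
      have "\<bar>\<sigma> n\<bar> = \<bar>\<eta> n\<bar> / (2 * (real r + 3))" by (simp add: \<sigma>_def)
      also have "\<dots> \<le> (1 / 3) / (2 * (real r + 3))" using elim(4) by (intro divide_right_mono) auto
      also have "\<dots> < 1 / 3" by (simp add: field_simps)
      finally show ?thesis .
    qed
    then have "0 < real (M n) * (1 - 3 * \<bar>\<sigma> n\<bar>)" using elim(3) by (intro mult_pos_pos) auto
    then have "0 < ?p n" using elim by (intro divide_pos_pos) auto
    then have "0 < card (\<C> n) * ?p n ^ k n" using card_images_pos[OF H_graph[of n]] by simp
    then show ?case using elim(1) by linarith
  qed
  show "\<forall>\<^sub>F n in \<F>. 0 < \<eta> n \<longrightarrow> 0 \<le> ?p n \<and> card (\<C> n) * ?p n ^ k n \<le> ?Y n \<and> real (M n) / N n * (1 - 3 * \<sigma> n) \<le> ?p n"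
    using Y ev_m_d_minus ev_model
  proof eventually_elim
    case (elim n)
    show ?case
    proof
      assume "0 < \<eta> n"
      then have "\<bar>\<sigma> n\<bar> = \<sigma> n" by (simp add: \<sigma>_def)
      then have "real (M n) * (1 - 3 * \<sigma> n) / N n \<le> ?p n" using elim by (intro divide_right_mono) auto
      then show "0 \<le> ?p n \<and> card (\<C> n) * ?p n ^ k n \<le> ?Y n \<and> real (M n) / N n * (1 - 3 * \<sigma> n) \<le> ?p n"
        using elim by simp
    qed
  qed
  fix e :: real assume e: "e > 0"
  show "\<forall>\<^sub>F n in \<F>. \<forall>y. slice_mean (rsets r n) (nat \<lfloor>(1 - 2 * \<delta> n) * M n\<rfloor>)
        (indicator (many n y)) \<le> measure_pmf.prob (G_unif n) (many n y) + e"
    using m_d_bounds ev_model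
  proof eventually_elim
    case (elim n)
    have "card (rsets r n) > 0" using elim by (simp add: card_rsets)
    then have rn: "rsets r n \<noteq> {}" by auto
    show ?case
    proof
      fix y
      have "slice_mean (rsets r n) (nat \<lfloor>(1 - 2 * \<delta> n) * M n\<rfloor>) (indicator (many n y))
         \<le> slice_mean (rsets r n) (?m n) (indicator (many n y))"
        by (rule slice_mean_mono[OF finite_rsets rn increasing_ncopies[OF images_facts(1)]])
           (use elim in \<open>auto simp: card_rsets\<close>)
      also have "\<dots> = measure_pmf.prob (G_unif n) (many n y)"
        by (rule prob_Gnm[symmetric]) (use elim in \<open>auto simp: card_rsets\<close>)
      finally show "slice_mean (rsets r n) (nat \<lfloor>(1 - 2 * \<delta> n) * M n\<rfloor>)
        (indicator (many n y)) \<le> measure_pmf.prob (G_unif n) (many n y) + e"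
        using e by simp
    qed
  qed
qed

end

theorem theorem3p6:
  fixes r :: nat and C :: real and d :: "nat \<Rightarrow> nat"
    and H :: "nat \<Rightarrow> nat set set" and \<eta> :: "nat \<Rightarrow> real"
  assumes r: "r \<ge> 2"
    and C: "sandwich_const r C"
    and adm_inf: "infinite {n. r dvd n * d n}"
    and d_lower: "(\<lambda>n. ln (real n)) \<in> o[adm r d](\<lambda>n. real (d n))"
    and d_upper: "(\<lambda>n. real (d n)) \<in> o[adm r d](\<lambda>n. real n ^ (r - 1))"
    and H_graph: "\<forall>n. H n \<subseteq> rsets r n"
    and H_deg: "(\<lambda>n. real (maxdeg n (H n))) \<in> O[adm r d](\<lambda>_. 1)"
    and eta_small: "\<eta> \<in> o[adm r d](\<lambda>_. 1)"
    and eps_eta: "(\<lambda>n. eps_nd r n (d n)) \<in> o[adm r d](\<eta>)"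
    and delta_eta: "(\<lambda>n. delta_nd r C n (d n)) \<in> o[adm r d](\<eta>)"
    and eta_large: "(\<lambda>n. 1 / real n) \<in> o[adm r d](\<eta>)"
  shows
   "(aas (adm r d) (\<lambda>n. Gnp r n (p_d r C n (d n)))
        (\<lambda>n G. pm_approx (\<eta> n) (card (H n)) (real (copies n (H n) G))
           (measure_pmf.expectation (Gnp r n (p_d r C n (d n))) (\<lambda>G. real (copies n (H n) G))))
     \<longrightarrow> aas (adm r d) (\<lambda>n. Gnd r n (d n))
        (\<lambda>n G. pm_approx (3 * \<eta> n) (card (H n)) (real (copies n (H n) G))
           (measure_pmf.expectation (Gnp r n (p_d r C n (d n))) (\<lambda>G. real (copies n (H n) G)))))
  \<and> (aas (adm r d) (\<lambda>n. Gnm r n (m_d r C n (d n)))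
        (\<lambda>n G. pm_approx (\<eta> n) (card (H n)) (real (copies n (H n) G))
           (measure_pmf.expectation (Gnm r n (m_d r C n (d n))) (\<lambda>G. real (copies n (H n) G))))
     \<longrightarrow> aas (adm r d) (\<lambda>n. Gnd r n (d n))
        (\<lambda>n G. pm_approx (3 * \<eta> n) (card (H n)) (real (copies n (H n) G))
           (measure_pmf.expectation (Gnm r n (m_d r C n (d n))) (\<lambda>G. real (copies n (H n) G)))))"
proof -
  have C0: "C > 0" using C by (simp add: sandwich_const_def)
  interpret regime r C d H \<eta>
    by standard (use r C0 d_lower d_upper H_graph H_deg eta_small eps_eta delta_eta in auto)
  \<comment> \<open>The sandwich property applies because \<open>\<delta> = o(\<eta>)\<close> and
    \<open>\<eta> = o(1)\<close>.\<close>
  have "\<forall>\<^sub>F n in adm r d. delta_nd r C n (d n) < 1"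
    using ev_delta_small[of "1/2"] by (auto elim: eventually_mono)
  then have sw: "(\<exists>cp :: nat \<Rightarrow> (nat set set \<times> nat set set) pmf.
          (\<forall>\<^sub>F n in adm r d. map_pmf fst (cp n) = Gnp r n (p_d r C n (d n)) \<and> map_pmf snd (cp n) = Gnd r n (d n))
        \<and> ((\<lambda>n. measure_pmf.prob (cp n) {x. fst x \<subseteq> snd x}) \<longlongrightarrow> 1) (adm r d))
     \<and> (\<exists>cm :: nat \<Rightarrow> (nat set set \<times> nat set set) pmf.
          (\<forall>\<^sub>F n in adm r d. map_pmf fst (cm n) = Gnm r n (m_d r C n (d n)) \<and> map_pmf snd (cm n) = Gnd r n (d n))
        \<and> ((\<lambda>n. measure_pmf.prob (cm n) {x. fst x \<subseteq> snd x}) \<longlongrightarrow> 1) (adm r d))"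
    using C adm_inf unfolding sandwich_const_def by blast
  show ?thesis using sw Gnp_case Gnm_case by blast
qed

end
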